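(* Let $(A,B,C,H^3,c_2\cdot H,c_3)$ be any one of the 14 rows of the table given in the context, and let $$L=\theta^4-Cz(\theta+A)(\theta+1-A)(\theta+B)(\theta+1-B),\qquad \theta=z\frac{d}{dz}.$$ Let $y_0,y_1,y_2,y_3$ be the Frobenius basis of solutions of $L$ at $z=0$. Then, with respect to the ordered basis $\{y_3/(2\pi i)^3,\ y_2/(2\pi i)^2,\ y_1/(2\pi i),\ y_0\}$, the monodromy matrices of $L$ around $z=0$ and around $z=1/C$ are $$\begin{pmatrix} 1 & 1 & 1/2 & 1/6 \\ 0 & 1 & 1 & 1/2 \\ 0 & 0 & 1 & 1 \\ 0 & 0 & 0 & 1 \end{pmatrix}\quad\text{and}\quad \begin{pmatrix} 1+a & 0 & ab/d & a^2/d \\ -b & 1 & -b^2/d & -ab/d \\ 0 & 0 & 1 & 0 \\ -d & 0 & -b & 1-a \end{pmatrix},$$ respectively, where $$a=\frac{c_3}{(2\pi i)^3}\zeta(3),\qquad b=\frac{c_2\cdot H}{24},\qquad d=H^3.$$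
   Context: The 14 cases (the numbers $H^3$, $c_2\cdot H$, $c_3$ are the degree, second Chern number and Euler number of an associated Calabi-Yau threefold with Picard number one; here they are just the listed integers), each listed as $(A,B;\,C;\,H^3,\,c_2\cdot H,\,c_3)$: 1. $(1/5,2/5;\ 3125;\ 5,50,-200)$ 2. $(1/10,3/10;\ 8\cdot 10^5;\ 1,34,-288)$ 3. $(1/2,1/2;\ 256;\ 16,64,-128)$ 4. $(1/3,1/3;\ 729;\ 9,54,-144)$ 5. $(1/3,1/2;\ 432;\ 12,60,-144)$ 6. $(1/4,1/2;\ 1024;\ 8,56,-176)$ 7. $(1/8,3/8;\ 65536;\ 2,44,-296)$ 8. $(1/6,1/3;\ 11664;\ 3,42,-204)$ 9. $(1/12,5/12;\ 12^6;\ 1,46,-484)$ 10. $(1/4,1/4;\ 4096;\ 4,40,-144)$ 11. $(1/4,1/3;\ 1728;\ 6,48,-156)$ 12. $(1/6,1/4;\ 27648;\ 2,32,-156)$ 13. $(1/6,1/6;\ 2^8\cdot 3^6;\ 1,22,-120)$ 14. $(1/6,1/2;\ 6912;\ 4,52,-256)$ The singular points of $L$ are $0$, $1/C$ and $\infty$. Frobenius basis at $z=0$: the solutions of $Ly=0$ of the form $$y_0=1+\cdots,\quad y_1=y_0\log z+g_1,\quad y_2=\tfrac12 y_0\log^2 z+g_1\log z+g_2,\quad y_3=\tfrac16 y_0\log^3 z+\tfrac12 g_1\log^2 z+g_2\log z+g_3,$$ where $y_0$ is holomorphic at $0$ with $y_0(0)=1$ and $g_1,g_2,g_3$ are holomorphic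 at $z=0$ and vanish there. Monodromy convention: if analytic continuation of the solutions $f_1,\dots,f_n$ along a closed loop $\gamma$ turns $f_i$ into $\sum_j a_{ij}f_j$, then the matrix of the monodromy along $\gamma$ relative to the ordered basis $\{f_1,\dots,f_n\}$ is $(a_{ij})$ (it acts on the column vector $(f_1,\dots,f_n)^t$ from the left). Here $\log z$ is the principal branch with cut $(-\infty,0]$, the base point lies in the open interval $(0,1/C)$, the loop around $0$ is a circle centered at $0$ traversed once counterclockwise, and the loop around $1/C$ is a simple loop contained in $\mathbb{C}\setminus(-\infty,0]$ encircling $1/C$ once counterclockwise. *)

theory Defs
  imports "HOL-Complex_Analysis.Complex_Analysis"
begin

section \<open>The fourteen hypergeometric operators\<close>

text \<open>Rows are \<open>(A, B, C, H\<^sup>3, c\<^sub>2 \<cdot> H, c\<^sub>3)\<close>.\<close>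

definition cy_table :: "(real \<times> real \<times> nat \<times> nat \<times> nat \<times> int) set" where
  "cy_table =
    {(1/5, 2/5, 3125, 5, 50, -200),
     (1/10, 3/10, 8 * 10^5, 1, 34, -288),
     (1/2, 1/2, 256, 16, 64, -128),
     (1/3, 1/3, 729, 9, 54, -144),
     (1/3, 1/2, 432, 12, 60, -144),
     (1/4, 1/2, 1024, 8, 56, -176),
     (1/8, 3/8, 65536, 2, 44, -296),
     (1/6, 1/3, 11664, 3, 42, -204),
     (1/12, 5/12, 12^6, 1, 46, -484),
     (1/4, 1/4, 4096, 4, 40, -144),
     (1/4, 1/3, 1728, 6, 48, -156),
     (1/6, 1/4, 27648, 2, 32, -156),
     (1/6, 1/6, 2^8 * 3^6, 1, 22, -120),
     (1/6, 1/2, 6912, 4, 52, -256)}"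

definition theta :: "(complex \<Rightarrow> complex) \<Rightarrow> complex \<Rightarrow> complex" where
  "theta f = (\<lambda>z. z * deriv f z)"

text \<open>The operator \<open>\<theta> + a\<close>.\<close>

definition theta_plus :: "real \<Rightarrow> (complex \<Rightarrow> complex) \<Rightarrow> complex \<Rightarrow> complex" where
  "theta_plus a f = (\<lambda>z. theta f z + of_real a * f z)"

definition hyp_op ::
    "real \<Rightarrow> real \<Rightarrow> nat \<Rightarrow> (complex \<Rightarrow> complex) \<Rightarrow> complex \<Rightarrow> complex" where
  "hyp_op A B C f = (\<lambda>z. (theta ^^ 4) f z
     - of_nat C * z * theta_plus A (theta_plus (1 - A) (theta_plus B (theta_plus (1 - B) f))) z)"

text \<open>
  The slit disc on which the Frobenius solutions live; it contains the interval \<open>(0, 1/C)\<close> of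
  base points. The library's \<open>Ln\<close> is holomorphic off \<open>(-\<infinity>, 0]\<close>.
\<close>

definition slit_disc :: "nat \<Rightarrow> complex set" where
  "slit_disc C = ball 0 (1 / real C) - \<real>\<^sub>\<le>\<^sub>0"

text \<open>
  The power series \<open>y\<^sub>0, g\<^sub>1, g\<^sub>2, g\<^sub>3\<close> are only required to be germs at \<open>0\<close>, so the logarithmic
  expansions are required near \<open>0\<close> off the cut. As \<open>slit_disc C\<close> is connected, this determines
  \<open>y\<^sub>0, ..., y\<^sub>3\<close> on all of it.
\<close>

definition frobenius_basis ::
    "real \<Rightarrow> real \<Rightarrow> nat \<Rightarrow> (complex \<Rightarrow> complex) \<Rightarrow> (complex \<Rightarrow> complex) \<Rightarrow>
     (complex \<Rightarrow> complex) \<Rightarrow> (complex \<Rightarrow> complex) \<Rightarrow> bool" where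
  "frobenius_basis A B C y0 y1 y2 y3 \<longleftrightarrow>
     (\<forall>y\<in>{y0, y1, y2, y3}.
        y holomorphic_on slit_disc C \<and> (\<forall>z\<in>slit_disc C. hyp_op A B C y z = 0)) \<and>
     y0 analytic_on {0} \<and> y0 0 = 1 \<and>
     (\<exists>g1 g2 g3.
        (\<forall>g\<in>{g1, g2, g3}. g analytic_on {0} \<and> g 0 = 0) \<and>
        (\<forall>\<^sub>F z in at 0 within - \<real>\<^sub>\<le>\<^sub>0.
           y1 z = y0 z * Ln z + g1 z \<and>
           y2 z = 1/2 * y0 z * (Ln z)^2 + g1 z * Ln z + g2 z \<and>
           y3 z = 1/6 * y0 z * (Ln z)^3 + 1/2 * g1 z * (Ln z)^2 + g2 z * Ln z + g3 z))"

definition frobenius_vector ::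
    "(complex \<Rightarrow> complex) \<Rightarrow> (complex \<Rightarrow> complex) \<Rightarrow> (complex \<Rightarrow> complex) \<Rightarrow>
     (complex \<Rightarrow> complex) \<Rightarrow> complex \<Rightarrow> complex^4" where
  "frobenius_vector y0 y1 y2 y3 z =
     vector [y3 z / (2 * of_real pi * \<i>)^3, y2 z / (2 * of_real pi * \<i>)^2,
             y1 z / (2 * of_real pi * \<i>), y0 z]"


section \<open>Analytic continuation and monodromy\<close>

text \<open>
  Continuation along \<open>\<gamma>\<close>: a family of function germs \<open>F s\<close> at \<open>\<gamma> s\<close> for \<open>0 \<le> s \<le> 1\<close>, locally
  constant in \<open>s\<close>, leading from the germ of \<open>f\<close> at \<open>\<gamma> 0\<close> to the germ of \<open>h\<close> at \<open>\<gamma> 1\<close>.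
\<close>

definition continues_along ::
    "(real \<Rightarrow> complex) \<Rightarrow> (complex \<Rightarrow> complex) \<Rightarrow> (complex \<Rightarrow> complex) \<Rightarrow> bool" where
  "continues_along \<gamma> f h \<longleftrightarrow>
     (\<exists>F :: real \<Rightarrow> complex \<Rightarrow> complex.
        (\<forall>s\<in>{0..1}. F s analytic_on {\<gamma> s}) \<and>
        (\<forall>s\<in>{0..1}. \<forall>\<^sub>F r in at s within {0..1}. \<forall>\<^sub>F z in nhds (\<gamma> r). F r z = F s z) \<and>
        (\<forall>\<^sub>F z in nhds (\<gamma> 0). F 0 z = f z) \<and>
        (\<forall>\<^sub>F z in nhds (\<gamma> 1). F 1 z = h z))"

text \<open>Continuation along \<open>\<gamma>\<close> turns \<open>f\<^sub>i\<close> into \<open>\<Sum>\<^sub>j M\<^sub>i\<^sub>j f\<^sub>j\<close>.\<close>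

definition has_monodromy_matrix ::
    "(real \<Rightarrow> complex) \<Rightarrow> (complex \<Rightarrow> complex^'n) \<Rightarrow> complex^'n^'n \<Rightarrow> bool" where
  "has_monodromy_matrix \<gamma> f M \<longleftrightarrow>
     (\<forall>i. continues_along \<gamma> (\<lambda>z. f z $ i) (\<lambda>z. \<Sum>j\<in>UNIV. M $ i $ j * f z $ j))"

text \<open>The winding number of a simple loop around a point off it is \<open>0\<close>, \<open>1\<close> or \<open>-1\<close>.\<close>

definition conifold_loop :: "nat \<Rightarrow> real \<Rightarrow> (real \<Rightarrow> complex) \<Rightarrow> bool" where
  "conifold_loop C t \<gamma> \<longleftrightarrow>
     simple_path \<gamma> \<and> pathstart \<gamma> = of_real t \<and> pathfinish \<gamma> = of_real t \<and>
     path_image \<gamma> \<subseteq> - \<real>\<^sub>\<le>\<^sub>0 - {1 / of_nat C} \<and> winding_number \<gamma> (1 / of_nat C) = 1"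


section \<open>The two matrices\<close>

text \<open>The value \<open>\<zeta>(k)\<close> for an integer \<open>k \<ge> 2\<close>.\<close>

definition zeta_nat :: "nat \<Rightarrow> real" where
  "zeta_nat k = (\<Sum>n. 1 / real (Suc n) ^ k)"

definition matrix_at_zero :: "complex^4^4" where
  "matrix_at_zero = vector
     [vector [1, 1, 1/2, 1/6],
      vector [0, 1, 1, 1/2],
      vector [0, 0, 1, 1],
      vector [0, 0, 0, 1]]"

definition matrix_at_conifold :: "complex \<Rightarrow> complex \<Rightarrow> complex \<Rightarrow> complex^4^4" where
  "matrix_at_conifold a b d = vector
     [vector [1 + a, 0, a * b / d, a^2 / d],
      vector [- b, 1, - (b^2 / d), - (a * b / d)],
      vector [0, 0, 1, 0],
      vector [- d, 0, - b, 1 - a]]"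

end

theory Submission
  imports Defs
begin

text \<open>
  Let \<open>X\<close> be the density on \<open>(0, \<infinity>)\<close>, in the variable \<open>y = ln u\<close>, whose Laplace transform is
  \<open>\<Gamma>(s+A) \<Gamma>(s+1-A) \<Gamma>(s+B) \<Gamma>(s+1-B) / \<Gamma>(s+1)\<^sup>4\<close>; it is a convolution of two densities of order two, one
  for \<open>A\<close> and one for \<open>B\<close>. Expanding its logarithmic Stieltjes transforms
  \<open>\<Phi>\<^sub>k(x) = \<integral> X(y) e\<^sup>y (Ln x - y)\<^sup>k / (x - e\<^sup>y) dy\<close> at \<open>x = C z\<close>, \<open>\<bar>z\<bar> < 1/C\<close>, in powers of \<open>z\<close> gives combinations of
  the Frobenius basis whose coefficients are the Taylor coefficients of
  \<open>C\<^sup>s \<Gamma>(s+A) \<Gamma>(s+1-A) \<Gamma>(s+B) \<Gamma>(s+1-B) / \<Gamma>(s+1)\<^sup>4\<close> at \<open>s = 0\<close>. For \<open>k > 0\<close> the factor \<open>(Ln x - y)\<^sup>k\<close> cancels the pole of the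
  integrand on \<open>(1, \<infinity>)\<close>, so \<open>\<Phi>\<^sub>k\<close> extends holomorphically to the plane slit along the negative reals,
  while \<open>\<Phi>\<^sub>0\<close> acquires \<open>W(x) Ln (1 - x)\<close>, where \<open>W\<close> is the analytic continuation of \<open>X\<close> in \<open>x = e\<^sup>y\<close>. Hence
  the monodromy around \<open>1/C\<close> is a transvection along \<open>W\<close>, and it remains to express \<open>W\<close> in the
  Frobenius basis: a convolution identity writes \<open>W\<close> as a combination of \<open>\<Phi>\<^sub>1\<close> and \<open>\<Phi>\<^sub>3\<close>. The constants
  come from the reflection and multiplication formulas for the polygamma functions.
\<close>

subsection \<open>Logarithmic power series\<close>

text \<open>The formula for \<open>W\<close> rests on a reproducing property in order two. Let
  \<open>P\<^sub>a\<close> be the density of order two for a parameter a. Convolving it with Y /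
  (e^Y - 1) returns (pi / sin (pi a))^2 times its own analytic continuation to the whole line. When
  the continuations for A and B are multiplied out, the product of their parts on Y < 0 is, up to
  sign, the continuation of \<open>X\<close> to Y < 0, where \<open>X\<close> itself is zero. Thus
  \<open>W\<close> is a combination of \<open>X\<close> convolved with Y / (e^Y - 1) and with the
  convolution square of that kernel. The square is (Y^3 / 6 + 2 pi^2 Y / 3) / (e^Y - 1), which is
  why exactly \<open>\<Phi>\<^sub>1\<close> and \<open>\<Phi>\<^sub>3\<close> occur. Convolutions
  take values in \<open>ennreal\<close>, so that regrouping them needs only Tonelli; the price is
  that identities are written without subtraction, finiteness being recovered afterwards. Apart from
  ranges and signs, the table enters through four identities: one Digamma sum, which fixes C, one
  sum of second polygamma values, which gives c_3, and two symmetric functions of sin^2 (pi A),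
  sin^2 (pi B), which give H^3 and c_2.H.\<close>

text \<open>
  A sequence \<open>f\<close> of power series stands for \<open>z\<^sup>\<epsilon> \<Sum>\<^sub>i f\<^sub>i(z) \<epsilon>\<^sup>i\<close>, and \<open>frob f k\<close> is its coefficient of \<open>\<epsilon>\<^sup>k\<close>.
  In terms of the series \<open>fps_row f n\<close> in \<open>\<epsilon>\<close>, the coefficient of \<open>z\<^sup>n\<close>, the operator \<open>\<theta> + a\<close> is
  multiplication by \<open>n + a + \<epsilon>\<close>.
\<close>

definition frob :: "(nat \<Rightarrow> complex fps) \<Rightarrow> nat \<Rightarrow> complex \<Rightarrow> complex" where
  "frob f k z = (\<Sum>i\<le>k. eval_fps (f i) z * Ln z ^ (k - i) / fact (k - i))"

definition fps_theta :: "complex \<Rightarrow> (nat \<Rightarrow> complex fps) \<Rightarrow> nat \<Rightarrow> complex fps" where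
  "fps_theta a f i =
     fps_X * fps_deriv (f i) + fps_const a * f i + (if i = 0 then 0 else f (i - 1))"

definition fps_row :: "(nat \<Rightarrow> complex fps) \<Rightarrow> nat \<Rightarrow> complex fps" where
  "fps_row f n = Abs_fps (\<lambda>i. fps_nth (f i) n)"

definition fps_hyp_op :: "real \<Rightarrow> real \<Rightarrow> nat \<Rightarrow> (nat \<Rightarrow> complex fps) \<Rightarrow> nat \<Rightarrow> complex fps" where
  "fps_hyp_op A B C f = (\<lambda>i.
     fps_theta 0 (fps_theta 0 (fps_theta 0 (fps_theta 0 f))) i
     - fps_const (of_nat C) * (fps_X * fps_theta (of_real A) (fps_theta (of_real (1 - A))
         (fps_theta (of_real B) (fps_theta (of_real (1 - B)) f))) i))"

abbreviation slit_ball :: "real \<Rightarrow> complex set" where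
  "slit_ball R \<equiv> ball 0 R - \<real>\<^sub>\<le>\<^sub>0"

lemma open_slit_ball: "open (slit_ball R)"
  by (intro open_Diff open_ball closed_nonpos_Reals_complex)

lemma fps_row_theta:
  "fps_row (fps_theta a f) n = (fps_const (of_nat n + a) + fps_X) * fps_row f n"
proof (rule fps_ext)
  fix i
  have 1: "fps_nth (fps_X * fps_deriv (f i)) n = of_nat n * fps_nth (f i) n"
    by (cases n) (auto simp: fps_X_mult_nth)
  show "fps_nth (fps_row (fps_theta a f) n) i
      = fps_nth ((fps_const (of_nat n + a) + fps_X) * fps_row f n) i"
    unfolding distrib_right fps_add_nth fps_X_mult_nth
    by (simp add: fps_row_def fps_theta_def 1 algebra_simps)
qed

lemma fps_row_hyp_op:
  "fps_row (fps_hyp_op A B C f) n =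
     (fps_const (of_nat n) + fps_X) ^ 4 * fps_row f n -
     (if n = 0 then 0 else fps_const (of_nat C) *
        ((fps_const (of_nat (n - 1) + of_real A) + fps_X) *
         (fps_const (of_nat (n - 1) + of_real (1 - A)) + fps_X) *
         (fps_const (of_nat (n - 1) + of_real B) + fps_X) *
         (fps_const (of_nat (n - 1) + of_real (1 - B)) + fps_X)) * fps_row f (n - 1))"
proof -
  define g where "g = fps_theta (of_real A) (fps_theta (of_real (1 - A))
         (fps_theta (of_real B) (fps_theta (of_real (1 - B)) f)))"
  define h where "h = fps_theta 0 (fps_theta 0 (fps_theta 0 (fps_theta 0 f)))"
  have h: "fps_row h n = (fps_const (of_nat n) + fps_X) ^ 4 * fps_row f n"
    by (simp add: h_def fps_row_theta power4_eq_xxxx mult.assoc)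
  have g: "fps_row g m = (fps_const (of_nat m + of_real A) + fps_X) *
         (fps_const (of_nat m + of_real (1 - A)) + fps_X) *
         (fps_const (of_nat m + of_real B) + fps_X) *
         (fps_const (of_nat m + of_real (1 - B)) + fps_X) * fps_row f m" for m
    by (simp only: g_def fps_row_theta mult.assoc)
  have 1: "fps_row (fps_hyp_op A B C f) n = fps_row h n -
      (if n = 0 then 0 else fps_const (of_nat C) * fps_row g (n - 1))"
    by (rule fps_ext) (simp add: fps_hyp_op_def fps_row_def g_def h_def fps_X_mult_nth)
  show ?thesis
    unfolding 1 h g by (simp only: mult.assoc)
qed

lemma fps_conv_radius_theta:
  assumes "\<And>i. fps_conv_radius (f i) \<ge> R"
  shows "fps_conv_radius (fps_theta a f i) \<ge> R"
proof -
  have *: "fps_conv_radius (x + y) \<ge> R" if "fps_conv_radius x \<ge> R" "fps_conv_radius y \<ge> R"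
    for x y :: "complex fps"
    using fps_conv_radius_add[of x y] that by (meson min.boundedI order_trans)
  have **: "fps_conv_radius (x * y) \<ge> R" if "fps_conv_radius x \<ge> R" "fps_conv_radius y \<ge> R"
    for x y :: "complex fps"
    using fps_conv_radius_mult[of x y] that by (meson min.boundedI order_trans)
  show ?thesis
    unfolding fps_theta_def
    using assms by (intro * **) (auto intro: order_trans[OF assms fps_conv_radius_deriv])
qed

lemma has_field_derivative_frob:
  assumes R: "\<And>i. fps_conv_radius (f i) \<ge> ereal R" and z: "z \<in> slit_ball R"
  shows "(frob f k has_field_derivative frob (fps_theta 0 f) k z / z) (at z)"
proof -
  have z0: "z \<noteq> 0" and zn: "z \<notin> \<real>\<^sub>\<le>\<^sub>0" using z by auto
  have zb: "norm z < R" using z by simp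
  have rad: "z \<in> eball 0 (fps_conv_radius (f i))" for i
    using R[of i] zb by (simp add: in_eball_iff) (metis ereal_less_ereal_Ex less_le_trans less_ereal.simps(1))
  have conv: "ereal (norm z) < fps_conv_radius (f i)" for i
    using rad by (simp add: in_eball_iff)
  have convd: "ereal (norm z) < fps_conv_radius (fps_deriv (f i))" for i
    using conv[of i] fps_conv_radius_deriv[of "f i"] less_le_trans by blast
  have convX: "ereal (norm z) < fps_conv_radius (fps_X * fps_deriv (f i))" for i
    using convd[of i] fps_conv_radius_mult[of fps_X "fps_deriv (f i)"] by (simp add: less_le_trans)
  have evX: "eval_fps (fps_X * fps_deriv (f i)) z = z * eval_fps (fps_deriv (f i)) z" for i
    using convd[of i] by (subst eval_fps_mult) auto
  have ev: "eval_fps (fps_theta 0 f i) z = z * eval_fps (fps_deriv (f i)) z +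
      (if i = 0 then 0 else eval_fps (f (i - 1)) z)" for i
    unfolding fps_theta_def
    using conv convX by (auto simp: eval_fps_add evX)
  have "(frob f k has_field_derivative
     (\<Sum>i\<le>k. eval_fps (fps_deriv (f i)) z * Ln z ^ (k - i) / fact (k - i)
        + eval_fps (f i) z * (of_nat (k - i) * Ln z ^ (k - i - 1) / z) / fact (k - i))) (at z)"
    unfolding frob_def
  proof (rule DERIV_sum)
    fix i
    show "((\<lambda>z. eval_fps (f i) z * Ln z ^ (k - i) / fact (k - i)) has_field_derivative
        eval_fps (fps_deriv (f i)) z * Ln z ^ (k - i) / fact (k - i)
        + eval_fps (f i) z * (of_nat (k - i) * Ln z ^ (k - i - 1) / z) / fact (k - i)) (at z)"
    proof -
      have d1: "(eval_fps (f i) has_field_derivative eval_fps (fps_deriv (f i)) z) (at z)"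
        using conv by (intro has_field_derivative_eval_fps) auto
      have d2: "((\<lambda>x. Ln x ^ m) has_field_derivative of_nat m * Ln z ^ (m - 1) / z) (at z)" for m
        using DERIV_power[OF has_field_derivative_Ln[OF zn], of m] by (simp add: divide_inverse mult_ac)
      show ?thesis
        using DERIV_cdivide[OF DERIV_mult[OF d1 d2], of "k - i" "fact (k - i)"]
        by (simp add: add_divide_distrib mult.commute)
    qed
  qed
  moreover have "(\<Sum>i\<le>k. eval_fps (fps_deriv (f i)) z * Ln z ^ (k - i) / fact (k - i)
        + eval_fps (f i) z * (of_nat (k - i) * Ln z ^ (k - i - 1) / z) / fact (k - i))
      = frob (fps_theta 0 f) k z / z"
  proof -
    \<comment> \<open>Differentiating a power of the logarithm lowers k - i by one; after shifting i
      this is the summand \<open>f (i - 1)\<close> of \<open>fps_theta\<close>, that is,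
      multiplication by epsilon.\<close>
    have "(\<Sum>i\<le>k. (eval_fps (f i) z * of_nat (k - i) * Ln z ^ (k - i - 1)) / fact (k - i)) =
          (\<Sum>i\<le>k. (if i = 0 then 0 else eval_fps (f (i - 1)) z) * Ln z ^ (k - i) / fact (k - i))"
    proof (cases k)
      case (Suc m)
      have "(\<Sum>i\<le>k. (eval_fps (f i) z * of_nat (k - i) * Ln z ^ (k - i - 1)) / fact (k - i))
         = (\<Sum>i\<le>m. (eval_fps (f i) z * of_nat (k - i) * Ln z ^ (k - i - 1)) / fact (k - i))"
        by (simp add: Suc)
      also have "\<dots> = (\<Sum>i\<le>m. eval_fps (f i) z * Ln z ^ (m - i) / fact (m - i))"
      proof (rule sum.cong)
        fix i assume "i \<in> {..m}"
        then have e: "k - i = Suc (m - i)" using Suc by auto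
        show "eval_fps (f i) z * of_nat (k - i) * Ln z ^ (k - i - 1) / fact (k - i)
            = eval_fps (f i) z * Ln z ^ (m - i) / fact (m - i)"
          unfolding e fact_Suc of_nat_mult diff_Suc_1 
          by (simp add: field_simps del: of_nat_Suc)
      qed simp
      also have "\<dots> = (\<Sum>i\<le>k. (if i = 0 then 0 else eval_fps (f (i - 1)) z) * Ln z ^ (k - i) / fact (k - i))"
        unfolding Suc by (subst sum.atMost_Suc_shift) simp
      finally show ?thesis .
    qed simp
    then have "frob (fps_theta 0 f) k z
       = (\<Sum>i\<le>k. z * eval_fps (fps_deriv (f i)) z * Ln z ^ (k - i) / fact (k - i))
        + (\<Sum>i\<le>k. (eval_fps (f i) z * of_nat (k - i) * Ln z ^ (k - i - 1)) / fact (k - i))"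
      unfolding frob_def ev by (simp add: sum.distrib algebra_simps add_divide_distrib)
    then show ?thesis
      unfolding sum.distrib[symmetric] sum_divide_distrib
      using z0 by (simp add: sum_divide_distrib field_simps)
  qed
  ultimately show ?thesis by simp
qed

lemma holomorphic_on_frob:
  assumes "\<And>i. fps_conv_radius (f i) \<ge> ereal R"
  shows "frob f k holomorphic_on slit_ball R"
  unfolding holomorphic_on_def field_differentiable_def
  by (meson has_field_derivative_frob[where f=f, OF assms] has_field_derivative_at_within)

lemma theta_plus_cong:
  assumes "open S" "z \<in> S" "\<And>w. w \<in> S \<Longrightarrow> f w = g w"
  shows "theta_plus a f z = theta_plus a g z"
proof -
  have "deriv f z = deriv g z"
    using assms by (intro deriv_cong_ev eventually_nhds[THEN iffD2]) auto
  then show ?thesis using assms by (simp add: theta_plus_def theta_def)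
qed

lemma theta_plus_frob:
  assumes R: "\<And>i. fps_conv_radius (f i) \<ge> ereal R" and z: "z \<in> slit_ball R"
    and g: "\<And>w. w \<in> slit_ball R \<Longrightarrow> g w = frob f k w"
  shows "theta_plus a g z = frob (fps_theta (of_real a) f) k z"
proof -
  have z0: "z \<noteq> 0" using z by auto
  have zb: "norm z < R" using z by simp
  have conv: "ereal (norm z) < fps_conv_radius (f i)" for i
    using R[of i] zb by (metis less_le_trans less_ereal.simps(1))
  have conv0: "ereal (norm z) < fps_conv_radius (fps_theta 0 f i)" for i
    using fps_conv_radius_theta[where f=f and a=0 and i=i, OF R] zb by (metis less_le_trans less_ereal.simps(1))
  have "theta_plus a g z = theta_plus a (frob f k) z"
    using open_slit_ball z g by (rule theta_plus_cong)
  also have "\<dots> = frob (fps_theta 0 f) k z + of_real a * frob f k z"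
    using DERIV_imp_deriv[OF has_field_derivative_frob[where f=f, OF R z]] z0
    by (simp add: theta_plus_def theta_def)
  also have "\<dots> = frob (fps_theta (of_real a) f) k z"
  proof -
    have "fps_theta (of_real a) f i = fps_theta 0 f i + fps_const (of_real a) * f i" for i
      by (simp add: fps_theta_def)
    moreover have "eval_fps (fps_theta 0 f i + fps_const (of_real a) * f i) z
        = eval_fps (fps_theta 0 f i) z + of_real a * eval_fps (f i) z" for i
      using conv conv0 less_le_trans[OF conv fps_conv_radius_mult[of "fps_const (of_real a)" "f i", simplified]]
      by (subst eval_fps_add) (auto simp: eval_fps_mult)
    ultimately show ?thesis
      by (simp add: frob_def sum.distrib[symmetric] sum_distrib_left add_divide_distrib algebra_simps)
  qed
  finally show ?thesis .
qed

lemma theta_funpow_4: "(theta ^^ 4) f = theta_plus 0 (theta_plus 0 (theta_plus 0 (theta_plus 0 f)))"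
  by (simp add: theta_plus_def numeral_eq_Suc)

lemma hyp_op_frob:
  assumes R: "\<And>i. fps_conv_radius (f i) \<ge> ereal R" and z: "z \<in> slit_ball R"
    and g: "\<And>w. w \<in> slit_ball R \<Longrightarrow> g w = frob f k w"
  shows "hyp_op A B C g z = frob (fps_hyp_op A B C f) k z"
proof -
  note T = fps_conv_radius_theta
  define f1 where "f1 = fps_theta 0 (fps_theta 0 (fps_theta 0 (fps_theta 0 f)))"
  define f2 where "f2 = fps_theta (of_real A) (fps_theta (of_real (1 - A))
         (fps_theta (of_real B) (fps_theta (of_real (1 - B)) f)))"
  have R1: "fps_conv_radius (f1 i) \<ge> ereal R" for i unfolding f1_def by (intro T R)
  have R2: "fps_conv_radius (f2 i) \<ge> ereal R" for i unfolding f2_def by (intro T R)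
  have zb: "ereal (norm z) < ereal R" using z by simp
  have c1: "ereal (norm z) < fps_conv_radius (f1 i)" for i
    using R1[of i] zb by (metis less_le_trans)
  have c2: "ereal (norm z) < fps_conv_radius (f2 i)" for i
    using R2[of i] zb by (metis less_le_trans)
  have tp0: "theta_plus 0 h w = frob (fps_theta 0 f') k w"
    if "\<And>i. fps_conv_radius (f' i) \<ge> ereal R" "w \<in> slit_ball R"
      "\<And>w. w \<in> slit_ball R \<Longrightarrow> h w = frob f' k w" for h f' w
    using theta_plus_frob[of R f' w h k 0] that by simp
  have t1: "(theta ^^ 4) g z = frob f1 k z"
    unfolding theta_funpow_4 f1_def
    by (intro tp0 T) (use R z g in auto)
  have t2: "theta_plus A (theta_plus (1 - A) (theta_plus B (theta_plus (1 - B) g))) z = frob f2 k z"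
    unfolding f2_def by (intro theta_plus_frob T) (use R z g in auto)
  have m: "ereal (norm z) < fps_conv_radius (fps_X * f2 i)" for i
    using c2[of i] fps_conv_radius_mult[of fps_X "f2 i"] by (simp add: less_le_trans)
  have m': "ereal (norm z) < fps_conv_radius (fps_const (of_nat C) * (fps_X * f2 i))" for i
    using m[of i] fps_conv_radius_mult[of "fps_const (of_nat C)" "fps_X * f2 i"] by (simp add: less_le_trans)
  have e: "eval_fps (f1 i - fps_const (of_nat C) * (fps_X * f2 i)) z
      = eval_fps (f1 i) z - of_nat C * z * eval_fps (f2 i) z" for i
    using c1[of i] m[of i] m'[of i] c2[of i]
    by (subst eval_fps_diff) (auto simp: eval_fps_mult)
  have "frob (fps_hyp_op A B C f) k z = frob f1 k z - of_nat C * z * frob f2 k z"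
    unfolding frob_def fps_hyp_op_def f1_def[symmetric] f2_def[symmetric] e
    by (simp add: sum_subtractf sum_distrib_left diff_divide_distrib algebra_simps)
  then show ?thesis
    unfolding hyp_op_def t1 t2 by simp
qed

text \<open>The recurrence kills every row with n > 0 of the image. Row 0 of the image is epsilon^4
  times row 0 of \<open>f\<close>, so exactly the orders below 4 in epsilon are safe; this is the
  origin of k < 4.\<close>

lemma hyp_op_frob_eq_0:
  assumes R: "\<And>i. fps_conv_radius (f i) \<ge> ereal R" and z: "z \<in> slit_ball R" and k: "k < 4"
    and rec: "\<And>n. (fps_const (of_nat (Suc n)) + fps_X) ^ 4 * fps_row f (Suc n) =
        fps_const (of_nat C) *
        ((fps_const (of_nat n + of_real A) + fps_X) *
         (fps_const (of_nat n + of_real (1 - A)) + fps_X) *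
         (fps_const (of_nat n + of_real B) + fps_X) *
         (fps_const (of_nat n + of_real (1 - B)) + fps_X)) * fps_row f n"
  shows "hyp_op A B C (frob f k) z = 0"
proof -
  have "fps_hyp_op A B C f i = 0" if "i \<le> k" for i
  proof (rule fps_ext)
    fix n
    have "fps_nth (fps_hyp_op A B C f i) n = fps_nth (fps_row (fps_hyp_op A B C f) n) i"
      by (simp add: fps_row_def)
    also have "\<dots> = 0"
    proof (cases n)
      case 0
      have "fps_row (fps_hyp_op A B C f) n = fps_X ^ 4 * fps_row f 0"
        by (simp add: fps_row_hyp_op 0)
      then show ?thesis using that k by (simp add: fps_X_power_mult_nth)
    next
      case (Suc m)
      then show ?thesis unfolding fps_row_hyp_op using rec[of m] by simp
    qed
    finally show "fps_nth (fps_hyp_op A B C f i) n = fps_nth 0 n" by simp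
  qed
  then have "frob (fps_hyp_op A B C f) k z = 0" by (simp add: frob_def)
  then show ?thesis using hyp_op_frob[where f=f and g="frob f k", OF R z] by simp
qed

text \<open>All four exponents of L at 0 vanish: for a power series solution the recurrence
  expresses n^4 u_n as a multiple of u_(n-1), so the value at 0 determines the germ. The equation is
  given only off the cut, and the identity theorem carries it to the whole disc.\<close>

lemma hyp_op_germ_unique:
  assumes u: "u analytic_on {0}" "u 0 = 0"
    and L: "\<forall>\<^sub>F z in at 0 within - \<real>\<^sub>\<le>\<^sub>0. hyp_op A B C u z = 0"
  shows "\<forall>\<^sub>F z in nhds 0. u z = 0"
proof -
  define U where "U = fps_expansion u 0"
  have U: "u has_fps_expansion U"
    unfolding U_def using u(1) by (rule analytic_at_imp_has_fps_expansion_0)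
  then have ev: "\<forall>\<^sub>F z in nhds 0. eval_fps U z = u z" and rad: "fps_conv_radius U > 0"
    by (auto simp: has_fps_expansion_def)
  obtain r where r: "r > 0" "\<And>z. norm z < r \<Longrightarrow> eval_fps U z = u z"
    using ev unfolding eventually_nhds_metric by (auto simp: dist_norm)
  obtain r2 where r2: "r2 > 0" "\<And>z. norm z < r2 \<Longrightarrow> z \<noteq> 0 \<Longrightarrow> z \<notin> \<real>\<^sub>\<le>\<^sub>0 \<Longrightarrow> hyp_op A B C u z = 0"
    using L unfolding eventually_at by (auto simp: dist_norm)
  obtain R where R: "0 < R" "ereal R < fps_conv_radius U" "R < r" "R < r2"
  proof -
    obtain q where q: "0 < q" "ereal q < fps_conv_radius U"
      using rad ereal_dense2[of 0 "fps_conv_radius U"] by (metis less_ereal.simps(1) zero_ereal_def)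
    define R where "R = min q (min r r2) / 2"
    have "R > 0" "R < r" "R < r2" "R \<le> q" using q(1) r(1) r2(1) by (auto simp: R_def min_def)
    moreover have "ereal R < fps_conv_radius U"
      using q(2) \<open>R \<le> q\<close> by (meson ereal_less_eq(3) order_le_less_trans)
    ultimately show ?thesis using that by blast
  qed
  \<comment> \<open>A germ without logarithms sits in component 0, and \<open>frob f 0\<close> is
    then the germ itself.\<close>
  define f where "f = (\<lambda>i::nat. if i = 0 then U else 0)"
  have Rf: "fps_conv_radius (f i) \<ge> ereal R" for i using R by (auto simp: f_def)
  have "eval_fps (fps_hyp_op A B C f 0) z = 0" if "z \<in> slit_ball R" for z
  proof -
    have "hyp_op A B C u z = frob (fps_hyp_op A B C f) 0 z"
      using that R by (intro hyp_op_frob[where f=f, OF Rf that]) (auto simp: frob_def f_def r(2))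
    moreover have "hyp_op A B C u z = 0"
      using that R by (intro r2(2)) auto
    ultimately show ?thesis by (simp add: frob_def)
  qed
  note ev0 = this
  have radL: "fps_conv_radius (fps_hyp_op A B C f 0) \<ge> ereal R"
  proof -
    note T = fps_conv_radius_theta
    have *: "fps_conv_radius (x - y) \<ge> ereal R"
      if "fps_conv_radius x \<ge> ereal R" "fps_conv_radius y \<ge> ereal R" for x y :: "complex fps"
      using fps_conv_radius_diff[of x y] that by (meson min.boundedI order_trans)
    have **: "fps_conv_radius (x * y) \<ge> ereal R"
      if "fps_conv_radius x \<ge> ereal R" "fps_conv_radius y \<ge> ereal R" for x y :: "complex fps"
      using fps_conv_radius_mult[of x y] that by (meson min.boundedI order_trans)
    show ?thesis unfolding fps_hyp_op_def by (intro * ** T Rf) auto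
  qed
  have hol: "eval_fps (fps_hyp_op A B C f 0) holomorphic_on ball 0 R"
  proof (intro holomorphic_on_eval_fps subsetI)
    fix x :: complex assume "x \<in> ball 0 R"
    then have "ereal (norm x) < ereal R" by simp
    from less_le_trans[OF this radL]
    show "x \<in> eball 0 (fps_conv_radius (fps_hyp_op A B C f 0))" by (simp add: in_eball_iff)
  qed
  have zero: "eval_fps (fps_hyp_op A B C f 0) z = 0" if "z \<in> ball 0 R" for z
  proof (rule analytic_continuation[OF hol, where U="slit_ball R" and \<xi> = "of_real (R/2)"])
    show "of_real (R/2) islimpt slit_ball R"
    proof (rule interior_limit_point)
      have "of_real (R/2) \<in> slit_ball R"
        using R(1) by (simp add: complex_nonpos_Reals_iff norm_divide)
      then show "of_real (R/2) \<in> interior (slit_ball R)"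
        by (simp only: interior_open[OF open_slit_ball])
    qed
    show "complex_of_real (R/2) \<in> ball 0 R" unfolding mem_ball_0 norm_of_real using R(1) by simp
    show "eval_fps (fps_hyp_op A B C f 0) z = 0" if "z \<in> slit_ball R" for z
      using that by (rule ev0)
  qed (use that in auto)
  have "fps_hyp_op A B C f 0 = 0"
  proof -
    have "eval_fps (fps_hyp_op A B C f 0) has_fps_expansion fps_hyp_op A B C f 0"
      using radL R(1) by (intro eval_fps_has_fps_expansion) (metis ereal_less(2) less_le_trans)
    moreover have "eval_fps (fps_hyp_op A B C f 0) has_fps_expansion 0"
      unfolding has_fps_expansion_0_iff eventually_nhds_metric using R(1) zero by (auto simp: dist_norm)
    ultimately show ?thesis by (metis fps_expansion_unique_complex)
  qed
  then have coef: "fps_nth (fps_row (fps_hyp_op A B C f) n) 0 = 0" for n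
    by (simp add: fps_row_def)
  have U0: "fps_nth U n = 0" for n
  proof (induction n)
    case 0
    have "u 0 = fps_nth U 0" using r(2)[of 0] r(1) by (simp add: eval_fps_at_0)
    then show ?case using u by simp
  next
    case (Suc n)
    have "of_nat (Suc n) ^ 4 * fps_nth U (Suc n) = 0"
      using coef[of "Suc n"] Suc
      unfolding fps_row_hyp_op by (simp add: fps_row_def f_def fps_nth_power_0 del: of_nat_Suc)
    then show ?case by (simp del: of_nat_Suc)
  qed
  then have "U = 0" by (intro fps_ext) simp
  then show ?thesis using U by (simp add: has_fps_expansion_0_iff)
qed

subsection \<open>Integrals depending holomorphically on a parameter\<close>

lemma norm_le_of_sphere:
  assumes "F holomorphic_on S" "cball x0 r \<subseteq> S"
    and "\<And>x. x \<in> sphere x0 r \<Longrightarrow> norm (F x) \<le> K" and "x \<in> cball x0 r"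
  shows "norm (F x) \<le> (K::real)"
proof (cases "r > 0")
  case True
  show ?thesis
  proof (rule maximum_modulus_frontier[of F "cball x0 r"])
    show "F holomorphic_on interior (cball x0 r)"
      using assms(1,2) interior_subset[of "cball x0 r"] by (meson holomorphic_on_subset subset_trans)
    have "F holomorphic_on cball x0 r" using assms(1,2) by (rule holomorphic_on_subset)
    then show "continuous_on (closure (cball x0 r)) F"
      by (simp add: holomorphic_on_imp_continuous_on)
    show "norm (F z) \<le> K" if "z \<in> frontier (cball x0 r)" for z
      using that True assms(3) by (simp add: frontier_cball)
  qed (use assms(4) in auto)
next
  case False
  then have "x \<in> sphere x0 r" using assms(4) by (metis antisym_conv2 dist_le_zero_iff mem_cball mem_sphere not_less order_le_less_trans zero_le_dist)
  then show ?thesis by (rule assms(3))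
qed

lemma measurable_deriv_param:
  fixes f :: "complex \<Rightarrow> 'a \<Rightarrow> complex"
  assumes "open S" "x0 \<in> S"
    and hol: "\<And>t. t \<in> space M \<Longrightarrow> (\<lambda>x. f x t) holomorphic_on S"
    and meas: "\<And>x. x \<in> S \<Longrightarrow> f x \<in> borel_measurable M"
  shows "(\<lambda>t. deriv (\<lambda>x. f x t) x0) \<in> borel_measurable M"
proof -
  obtain e where e: "e > 0" "ball x0 e \<subseteq> S" using assms(1,2) openE by blast
  \<comment> \<open>The shift by 2 keeps every increment strictly shorter than e, also for n =
    0.\<close>
  define h where "h = (\<lambda>n. complex_of_real (e / real (n + 2)))"
  have h0: "h n \<noteq> 0" for n using e(1) unfolding h_def of_real_eq_0_iff by simp
  have hn: "norm (h n) < e" for n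
    unfolding h_def norm_of_real using e(1) by (auto simp: field_simps intro: add_pos_nonneg)
  have hS: "x0 + h n \<in> S" for n
    using e(2) hn[of n] by (auto simp: subset_iff dist_norm)
  have hlim: "h \<longlonglongrightarrow> 0"
  proof -
    have "(\<lambda>n. e / real (n + 2)) \<longlonglongrightarrow> 0"
      by (rule LIMSEQ_ignore_initial_segment[where f="\<lambda>n. e / real n"]) (rule lim_const_over_n)
    then have "(\<lambda>n. complex_of_real (e / real (n + 2))) \<longlonglongrightarrow> of_real 0" by (rule tendsto_of_real)
    then show ?thesis by (simp add: h_def)
  qed
  show ?thesis
  proof (rule borel_measurable_LIMSEQ_metric)
    show "(\<lambda>t. (f (x0 + h n) t - f x0 t) / h n) \<in> borel_measurable M" for n
      using meas[OF hS[of n]] meas[OF assms(2)] by measurable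
    fix t assume t: "t \<in> space M"
    have "((\<lambda>x. f x t) has_field_derivative deriv (\<lambda>x. f x t) x0) (at x0)"
      using hol[OF t] assms(1,2) by (rule holomorphic_derivI)
    then have "((\<lambda>k. (f (x0 + k) t - f x0 t) / k) \<longlongrightarrow> deriv (\<lambda>x. f x t) x0) (at 0)"
      by (simp add: DERIV_def)
    then show "(\<lambda>n. (f (x0 + h n) t - f x0 t) / h n) \<longlonglongrightarrow> deriv (\<lambda>x. f x t) x0"
      unfolding tendsto_at_iff_sequentially using h0 hlim by (auto simp: o_def)
  qed
qed

text \<open>Dominated convergence applied to difference quotients. Once the removable singularity at
  \<open>x0\<close> is filled in, the maximum principle on the sphere of radius r bounds the
  quotient at all interior points by 2 G / r, so a local bound on \<open>f\<close> controls the
  derivative too.\<close>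

lemma holomorphic_on_lebesgue_integral:
  fixes f :: "complex \<Rightarrow> 'a \<Rightarrow> complex"
  assumes S: "open S"
    and hol: "\<And>t. t \<in> space M \<Longrightarrow> (\<lambda>x. f x t) holomorphic_on S"
    and meas: "\<And>x. x \<in> S \<Longrightarrow> f x \<in> borel_measurable M"
    and dom: "\<And>x0. x0 \<in> S \<Longrightarrow> \<exists>r>0. \<exists>G::'a \<Rightarrow> real. cball x0 r \<subseteq> S \<and> integrable M G \<and>
        (\<forall>x\<in>cball x0 r. \<forall>t\<in>space M. norm (f x t) \<le> G t)"
  shows "(\<lambda>x. \<integral>t. f x t \<partial>M) holomorphic_on S"
proof -
  have "\<exists>D. ((\<lambda>x. \<integral>t. f x t \<partial>M) has_field_derivative D) (at x0)" if x0: "x0 \<in> S" for x0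
  proof -
    obtain r G where r: "r > 0" "cball x0 r \<subseteq> S" and G: "integrable M G"
      and b: "\<And>x t. x \<in> cball x0 r \<Longrightarrow> t \<in> space M \<Longrightarrow> norm (f x t) \<le> G t"
      using dom[OF x0] by metis
    define D where "D = (\<integral>t. deriv (\<lambda>x. f x t) x0 \<partial>M)"
    have int: "integrable M (f x)" if "x \<in> cball x0 r" for x
      using G meas[of x] r(2) that b[OF that]
      by (intro Bochner_Integration.integrable_bound[OF G]) (auto intro!: AE_I2 intro: order_trans[OF _ abs_ge_self])
    have quot: "norm ((f (x0 + k) t - f x0 t) / k) \<le> 2 * G t / r"
      if "k \<noteq> 0" "norm k < r" "t \<in> space M" for k t
    proof -
      let ?F = "\<lambda>z. if z = x0 then deriv (\<lambda>x. f x t) x0 else (f z t - f x0 t) / (z - x0)"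
      have "norm (?F (x0 + k)) \<le> 2 * G t / r"
      proof (rule norm_le_of_sphere[where F="?F" and r=r])
        show "(\<lambda>z. if z = x0 then deriv (\<lambda>x. f x t) x0 else (f z t - f x0 t) / (z - x0)) holomorphic_on S"
          using hol[OF that(3)] S by (rule pole_lemma_open)
        fix x assume x: "x \<in> sphere x0 r"
        then have "norm (f x t - f x0 t) \<le> 2 * G t"
          using b[of x t] b[of x0 t] r(1) that(3) norm_triangle_ineq4[of "f x t" "f x0 t"] by auto
        moreover have "norm (x - x0) = r" "x \<noteq> x0" using x r(1) by (auto simp: dist_norm norm_minus_commute)
        ultimately show "norm (if x = x0 then deriv (\<lambda>x. f x t) x0 else (f x t - f x0 t) / (x - x0)) \<le> 2 * G t / r"
          using r(1) by (simp add: norm_divide divide_right_mono)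
      qed (use r that in \<open>auto simp: dist_norm\<close>)
      then show ?thesis using that(1) by simp
    qed
    have "((\<lambda>k. ((\<integral>t. f (x0 + k) t \<partial>M) - (\<integral>t. f x0 t \<partial>M)) / k) \<longlongrightarrow> D) (at 0)"
      unfolding tendsto_at_iff_sequentially
    proof (intro allI impI)
      fix X :: "nat \<Rightarrow> complex" assume X: "\<forall>i. X i \<in> UNIV - {0}" "X \<longlonglongrightarrow> 0"
      have "eventually (\<lambda>n. norm (X n) < r) sequentially"
        using tendstoD[OF X(2) r(1)] by (simp add: dist_norm)
      then obtain N where N: "\<And>n. n \<ge> N \<Longrightarrow> norm (X n) < r"
        by (auto simp: eventually_sequentially)
      have xb: "x0 + X (n + N) \<in> cball x0 r" for n using N[of "n + N"] by (auto simp: dist_norm)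
      have xS: "x0 + X (n + N) \<in> S" for n using xb r(2) by blast
      have "(\<lambda>n. \<integral>t. (f (x0 + X (n + N)) t - f x0 t) / X (n + N) \<partial>M) \<longlonglongrightarrow> D"
        unfolding D_def
      proof (rule integral_dominated_convergence[where w="\<lambda>t. 2 * G t / r"])
        show "(\<lambda>t. deriv (\<lambda>x. f x t) x0) \<in> borel_measurable M"
          using S x0 hol meas by (rule measurable_deriv_param)
        show "(\<lambda>t. (f (x0 + X (n + N)) t - f x0 t) / X (n + N)) \<in> borel_measurable M" for n
          using meas[OF xS[of n]] meas[OF x0] by measurable
        show "integrable M (\<lambda>t. 2 * G t / r)" using G by simp
        show "AE t in M. (\<lambda>n. (f (x0 + X (n + N)) t - f x0 t) / X (n + N)) \<longlonglongrightarrow> deriv (\<lambda>x. f x t) x0"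
        proof (rule AE_I2)
          fix t assume t: "t \<in> space M"
          have "((\<lambda>x. f x t) has_field_derivative deriv (\<lambda>x. f x t) x0) (at x0)"
            using hol[OF t] S x0 by (rule holomorphic_derivI)
          then have "((\<lambda>k. (f (x0 + k) t - f x0 t) / k) \<longlongrightarrow> deriv (\<lambda>x. f x t) x0) (at 0)"
            by (simp add: DERIV_def)
          then have "(\<lambda>n. (f (x0 + X n) t - f x0 t) / X n) \<longlonglongrightarrow> deriv (\<lambda>x. f x t) x0"
            unfolding tendsto_at_iff_sequentially using X by (auto simp: o_def)
          then show "(\<lambda>n. (f (x0 + X (n + N)) t - f x0 t) / X (n + N)) \<longlonglongrightarrow> deriv (\<lambda>x. f x t) x0"
            by (rule LIMSEQ_ignore_initial_segment)
        qed
        show "AE t in M. norm ((f (x0 + X (n + N)) t - f x0 t) / X (n + N)) \<le> 2 * G t / r" for n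
          using X(1) N[of "n + N"] by (intro AE_I2 quot) auto
      qed
      moreover have "(\<integral>t. (f (x0 + X (n + N)) t - f x0 t) / X (n + N) \<partial>M)
          = ((\<integral>t. f (x0 + X (n + N)) t \<partial>M) - (\<integral>t. f x0 t \<partial>M)) / X (n + N)" for n
        using int[OF xb[of n]] int[of x0] r(1) by (simp add: Bochner_Integration.integral_diff)
      ultimately have "(\<lambda>n. ((\<integral>t. f (x0 + X (n + N)) t \<partial>M) - (\<integral>t. f x0 t \<partial>M)) / X (n + N)) \<longlonglongrightarrow> D"
        by (simp only:)
      then show "((\<lambda>k. ((\<integral>t. f (x0 + k) t \<partial>M) - (\<integral>t. f x0 t \<partial>M)) / k) \<circ> X) \<longlonglongrightarrow> D"
        unfolding o_def by (rule LIMSEQ_offset)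
    qed
    then show ?thesis by (auto simp: DERIV_def)
  qed
  then show ?thesis
    unfolding holomorphic_on_def field_differentiable_def
    by (meson has_field_derivative_at_within)
qed

text \<open>The zero of the numerator cancels the moving pole \<open>q t\<close>. For large
  \<open>q t\<close> the division gains a factor of order 1 / norm (q t), which is why the
  domination hypothesis allows the factor 1 + norm (q t).\<close>

lemma holomorphic_on_removable_integral:
  fixes N :: "complex \<Rightarrow> 'a \<Rightarrow> complex" and q :: "'a \<Rightarrow> complex"
  assumes S: "open S"
    and hol: "\<And>t. t \<in> space M \<Longrightarrow> (\<lambda>x. N x t) holomorphic_on S"
    and meas: "\<And>x. x \<in> S \<Longrightarrow> N x \<in> borel_measurable M"
    and q: "q \<in> borel_measurable M"
    and zero: "\<And>t. t \<in> space M \<Longrightarrow> q t \<in> S \<Longrightarrow> N (q t) t = 0"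
    and null: "\<And>x. x \<in> S \<Longrightarrow> AE t in M. q t \<noteq> x"
    and dom: "\<And>x0. x0 \<in> S \<Longrightarrow> \<exists>r>0. \<exists>G::'a \<Rightarrow> real. cball x0 r \<subseteq> S \<and> integrable M G \<and>
        (\<forall>x\<in>cball x0 r. \<forall>t\<in>space M. norm (N x t) \<le> G t * (1 + norm (q t)))"
  shows "(\<lambda>x. \<integral>t. N x t / (x - q t) \<partial>M) holomorphic_on S"
proof -
  define F where "F = (\<lambda>x t. if x = q t then deriv (\<lambda>x. N x t) x else N x t / (x - q t))"
  have holF: "(\<lambda>x. F x t) holomorphic_on S" if t: "t \<in> space M" for t
  proof (cases "q t \<in> S")
    case True
    have "(\<lambda>z. if z = q t then deriv (\<lambda>x. N x t) (q t) else (N z t - N (q t) t) / (z - q t)) holomorphic_on S"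
      using hol[OF t] S by (rule pole_lemma_open)
    also have "?this \<longleftrightarrow> ?thesis"
      unfolding F_def using zero[OF t True] by (intro holomorphic_cong) auto
    finally show ?thesis .
  next
    case False
    then have "(\<lambda>x. N x t / (x - q t)) holomorphic_on S"
      using hol[OF t] by (intro holomorphic_intros) auto
    also have "?this \<longleftrightarrow> ?thesis"
      unfolding F_def using False by (intro holomorphic_cong) auto
    finally show ?thesis .
  qed
  have measF: "F x \<in> borel_measurable M" if "x \<in> S" for x
  proof -
    have [measurable]: "(\<lambda>t. deriv (\<lambda>x. N x t) x) \<in> borel_measurable M"
      using S that hol meas by (rule measurable_deriv_param)
    have [measurable]: "N x \<in> borel_measurable M" "q \<in> borel_measurable M"
      using meas[OF that] q by auto
    show ?thesis unfolding F_def by measurable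
  qed
  have domF: "\<exists>r>0. \<exists>G::'a \<Rightarrow> real. cball x0 r \<subseteq> S \<and> integrable M G \<and>
        (\<forall>x\<in>cball x0 r. \<forall>t\<in>space M. norm (F x t) \<le> G t)" if x0S: "x0 \<in> S" for x0
  proof -
    obtain r G where r: "r > 0" "cball x0 r \<subseteq> S" and G: "integrable M G"
      and b: "\<And>x t. x \<in> cball x0 r \<Longrightarrow> t \<in> space M \<Longrightarrow> norm (N x t) \<le> G t * (1 + norm (q t))"
      using dom[OF x0S] by metis
    define K where "K = (1 + norm x0 + 2 * r) * 3 / r"
    have far: "norm (N x t / (x - q t)) \<le> K * G t"
      if x: "x \<in> cball x0 r" and t: "t \<in> space M" and d: "norm (x - q t) \<ge> r / 3" for x t
    proof -
      have G0: "G t \<ge> 0" using b[OF x t] by (smt (verit) norm_ge_zero zero_le_mult_iff)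
      have nx: "norm x \<le> norm x0 + r"
        using x norm_triangle_ineq2[of x x0] by (auto simp: dist_norm norm_minus_commute)
      have "norm (q t) \<le> norm x + norm (x - q t)" by norm
      then have "1 + norm (q t) \<le> (1 + norm x0 + r) + norm (x - q t)" using nx by linarith
      also have "\<dots> \<le> (1 + norm x0 + r) * (norm (x - q t) * 3 / r) + norm (x - q t) * (r * 3 / r)"
      proof -
        have "1 \<le> norm (x - q t) * 3 / r" using d r(1) by (simp add: field_simps)
        then have "(1 + norm x0 + r) * 1 \<le> (1 + norm x0 + r) * (norm (x - q t) * 3 / r)"
          using r(1) by (intro mult_left_mono) auto
        moreover have "norm (x - q t) \<le> norm (x - q t) * (r * 3 / r)" using r(1) by simp
        ultimately show ?thesis by (simp only: mult_1_right add_mono)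
      qed
      also have "\<dots> = K * norm (x - q t)" using r(1) by (simp add: K_def field_simps)
      finally have "G t * (1 + norm (q t)) \<le> G t * (K * norm (x - q t))"
        using G0 by (intro mult_left_mono)
      then have "norm (N x t) \<le> K * G t * norm (x - q t)" using b[OF x t] by (simp add: mult_ac)
      moreover have "norm (x - q t) > 0" using d r(1) by linarith
      ultimately show ?thesis by (simp add: norm_divide field_simps)
    qed
    \<comment> \<open>A pole at distance at least 2 r / 3 from \<open>x0\<close> stays r / 3 away
      from the small disc, where the direct bound applies. A nearer pole is r / 3 away from the
      sphere of radius r, and the maximum principle carries the bound inwards.\<close>
    have "norm (F x t) \<le> K * G t" if x: "x \<in> cball x0 (r / 3)" and t: "t \<in> space M" for x t
    proof (cases "norm (x0 - q t) \<ge> 2 * r / 3")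
      case True
      have "norm (x0 - q t) \<le> norm (x - q t) + norm (x0 - x)" by norm
      then have "norm (x - q t) \<ge> r / 3" using True x by (simp add: dist_norm)
      moreover from this have "x \<noteq> q t" using r(1) by auto
      ultimately show ?thesis using far[of x t] x t r(1) by (auto simp: F_def)
    next
      case False
      show ?thesis
      proof (rule norm_le_of_sphere[where F="\<lambda>x. F x t" and r=r, OF holF[OF t] r(2)])
        show "x \<in> cball x0 r" using x r(1) by auto
        fix y assume y: "y \<in> sphere x0 r"
        have "norm (x0 - y) \<le> norm (x0 - q t) + norm (y - q t)" by norm
        then have "norm (y - q t) \<ge> r / 3" using False y by (simp add: dist_norm)
        moreover from this have "y \<noteq> q t" using r(1) by auto
        ultimately show "norm (F y t) \<le> K * G t" using far[of y t] y t r(1) by (auto simp: F_def)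
      qed
    qed
    moreover have "cball x0 (r / 3) \<subseteq> S" using r(1) by (intro order_trans[OF subset_cball r(2)]) simp
    ultimately show ?thesis using r(1) G by (intro exI[of _ "r / 3"] conjI exI[of _ "\<lambda>t. K * G t"]) auto
  qed
  have "(\<lambda>x. \<integral>t. F x t \<partial>M) holomorphic_on S"
    using S holF measF domF by (rule holomorphic_on_lebesgue_integral)
  also have "?this \<longleftrightarrow> ?thesis"
  proof (rule holomorphic_cong)
    fix x assume x: "x \<in> S"
    show "(\<integral>t. F x t \<partial>M) = (\<integral>t. N x t / (x - q t) \<partial>M)"
    proof (rule integral_cong_AE)
      show "F x \<in> borel_measurable M" using x by (rule measF)
      show "(\<lambda>t. N x t / (x - q t)) \<in> borel_measurable M" using meas[OF x] q by measurable
      show "AE t in M. F x t = N x t / (x - q t)"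
        using null[OF x] by eventually_elim (auto simp: F_def)
    qed
  qed simp
  finally show ?thesis .
qed

section \<open>Substitution in nonnegative integrals, and Beta integrals\<close>

lemma absolutely_integrable_on_iff_nn_integral:
  fixes f :: "real \<Rightarrow> real"
  assumes "(\<lambda>x. indicator S x * f x) \<in> borel_measurable borel" "\<And>x. x \<in> S \<Longrightarrow> 0 \<le> f x"
  shows "f absolutely_integrable_on S \<longleftrightarrow> (\<integral>\<^sup>+x. ennreal (indicator S x * f x) \<partial>lborel) < \<infinity>"
proof -
  have "f absolutely_integrable_on S \<longleftrightarrow> integrable lborel (\<lambda>x. indicator S x * f x)"
    unfolding set_integrable_def using assms(1) by (simp add: integrable_completion)
  also have "\<dots> \<longleftrightarrow> (\<integral>\<^sup>+x. ennreal (indicator S x * f x) \<partial>lborel) < \<infinity>"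
    using assms by (subst integrable_iff_bounded) (auto intro!: arg_cong[where f="\<lambda>x. x < \<infinity>"] nn_integral_cong simp: indicator_def)
  finally show ?thesis .
qed

lemma nn_integral_eq_integral_on:
  fixes f :: "real \<Rightarrow> real"
  assumes "(\<lambda>x. indicator S x * f x) \<in> borel_measurable borel" "\<And>x. x \<in> S \<Longrightarrow> 0 \<le> f x"
    and "f absolutely_integrable_on S"
  shows "(\<integral>\<^sup>+x. ennreal (indicator S x * f x) \<partial>lborel) = ennreal (integral S f)"
proof -
  have i: "integrable lborel (\<lambda>x. indicator S x * f x)"
    using assms(1,3) unfolding set_integrable_def by (simp add: integrable_completion)
  have "(\<integral>\<^sup>+x. ennreal (indicator S x * f x) \<partial>lborel) = ennreal (\<integral>x. indicator S x * f x \<partial>lborel)"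
    using i assms(2) by (intro nn_integral_eq_integral) (auto simp: indicator_def)
  also have "(\<integral>x. indicator S x * f x \<partial>lborel) = (LINT x:S|lebesgue. f x)"
    unfolding set_lebesgue_integral_def using assms(1) by (simp add: integral_completion)
  also have "\<dots> = integral S f" using assms(3) by (rule set_lebesgue_integral_eq_integral)
  finally show ?thesis .
qed

text \<open>Change of variables transfers absolute integrability in both directions, so if one side
  is infinite then so is the other, and no convergence has to be checked in applications. The
  explicit inverse \<open>h\<close> supplies injectivity and the image.\<close>

lemma nn_integral_substitution_bij:
  fixes f g g' h :: "real \<Rightarrow> real"
  assumes S: "S \<in> sets lebesgue"
    and der: "\<And>x. x \<in> S \<Longrightarrow> (g has_field_derivative g' x) (at x within S)"
    and gh: "\<And>x. x \<in> S \<Longrightarrow> g x \<in> T" "\<And>x. x \<in> S \<Longrightarrow> h (g x) = x"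
      "\<And>y. y \<in> T \<Longrightarrow> h y \<in> S" "\<And>y. y \<in> T \<Longrightarrow> g (h y) = y"
    and f: "(\<lambda>x. indicator T x * f x) \<in> borel_measurable borel" "\<And>x. x \<in> T \<Longrightarrow> 0 \<le> f x"
    and fg: "(\<lambda>x. indicator S x * (\<bar>g' x\<bar> * f (g x))) \<in> borel_measurable borel"
  shows "(\<integral>\<^sup>+x. ennreal (indicator T x * f x) \<partial>lborel)
       = (\<integral>\<^sup>+x. ennreal (indicator S x * (\<bar>g' x\<bar> * f (g x))) \<partial>lborel)"
proof -
  have inj: "inj_on g S" using gh(2) by (metis inj_onI)
  have T: "g ` S = T" using gh by (auto simp: image_iff) metis
  have fg0: "\<And>x. x \<in> S \<Longrightarrow> 0 \<le> \<bar>g' x\<bar> * f (g x)" using f(2) T by auto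
  note cv = has_absolute_integral_change_of_variables_1'[OF S der inj, of f, unfolded T]
  show ?thesis
  proof (cases "f absolutely_integrable_on T")
    case True
    with cv[of "integral T f"] have "(\<lambda>x. \<bar>g' x\<bar> * f (g x)) absolutely_integrable_on S"
      "integral S (\<lambda>x. \<bar>g' x\<bar> * f (g x)) = integral T f" by auto
    then show ?thesis
      using nn_integral_eq_integral_on[OF f True] nn_integral_eq_integral_on[OF fg fg0] by simp
  next
    case False
    with cv have "\<not> (\<lambda>x. \<bar>g' x\<bar> * f (g x)) absolutely_integrable_on S" by blast
    then show ?thesis
      using absolutely_integrable_on_iff_nn_integral[OF f] absolutely_integrable_on_iff_nn_integral[OF fg fg0] False
      by (metis infinity_ennreal_def top.not_eq_extremum)
  qed
qed

lemma nn_integral_Beta: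
  assumes "a > 0" "b > (0::real)"
  shows "(\<integral>\<^sup>+x. ennreal (indicator {0<..<1} x * (x powr (a - 1) * (1 - x) powr (b - 1))) \<partial>lborel)
       = ennreal (Beta a b)"
proof -
  have "(\<integral>\<^sup>+x. ennreal (indicator {0<..<1} x * (x powr (a - 1) * (1 - x) powr (b - 1))) \<partial>lborel)
      = (\<integral>\<^sup>+x. ennreal (indicator {0..1} x * (x powr (a - 1) * (1 - x) powr (b - 1))) \<partial>lborel)"
    by (intro nn_integral_cong) (auto simp: indicator_def)
  also have "\<dots> = ennreal (integral {0..1} (\<lambda>x. x powr (a - 1) * (1 - x) powr (b - 1)))"
  proof (rule nn_integral_eq_integral_on)
    show "(\<lambda>x. x powr (a - 1) * (1 - x) powr (b - 1)) absolutely_integrable_on {0..1}"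
      using integrable_Beta[OF assms] by (simp add: set_integrable_def integrable_completion)
  qed auto
  also have "integral {0..1} (\<lambda>x. x powr (a - 1) * (1 - x) powr (b - 1)) = Beta a b"
    using has_integral_Beta_real[OF assms] by (rule integral_unique)
  finally show ?thesis .
qed

lemma Beta_reflection:
  assumes "0 < a" "a < (1::real)"
  shows "Beta (1 - a) a = pi / sin (pi * a)"
proof -
  have "complex_of_real (Gamma a * Gamma (1 - a)) = of_real (pi / sin (pi * a))"
    using Gamma_reflection_complex[of "of_real a"]
    by (simp add: Gamma_complex_of_real[symmetric] sin_of_real[symmetric])
  then have "Gamma a * Gamma (1 - a) = pi / sin (pi * a)" by (simp only: of_real_eq_iff)
  then show ?thesis by (simp add: Beta_def mult.commute)
qed

subsection \<open>Additive convolution\<close>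

definition conv :: "(real \<Rightarrow> ennreal) \<Rightarrow> (real \<Rightarrow> ennreal) \<Rightarrow> real \<Rightarrow> ennreal" where
  "conv f g x = (\<integral>\<^sup>+y. f y * g (x - y) \<partial>lborel)"

lemma measurable_conv [measurable]:
  assumes [measurable]: "f \<in> borel_measurable borel" "g \<in> borel_measurable borel"
  shows "conv f g \<in> borel_measurable borel"
  unfolding conv_def by measurable

lemma nn_integral_shift:
  assumes "f \<in> borel_measurable borel"
  shows "(\<integral>\<^sup>+y. f (y + c) \<partial>lborel) = (\<integral>\<^sup>+y. f (y::real) \<partial>lborel)"
  using nn_integral_real_affine[OF assms, of 1 c] by (simp add: add.commute)

lemma nn_integral_reflect:
  assumes "f \<in> borel_measurable borel"
  shows "(\<integral>\<^sup>+y. f (c - y) \<partial>lborel) = (\<integral>\<^sup>+y. f (y::real) \<partial>lborel)"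
  using nn_integral_real_affine[OF assms, of "-1" c] by simp

lemma conv_commute:
  assumes [measurable]: "f \<in> borel_measurable borel" "g \<in> borel_measurable borel"
  shows "conv f g = conv g f"
proof
  fix x
  have "conv f g x = (\<integral>\<^sup>+y. f (x - y) * g (x - (x - y)) \<partial>lborel)"
    unfolding conv_def by (rule nn_integral_reflect[symmetric]) measurable
  then show "conv f g x = conv g f x" by (simp add: conv_def mult.commute)
qed

lemma conv_assoc:
  assumes [measurable]: "f \<in> borel_measurable borel" "g \<in> borel_measurable borel" "h \<in> borel_measurable borel"
  shows "conv (conv f g) h = conv f (conv g h)"
proof
  fix x
  have "conv (conv f g) h x = (\<integral>\<^sup>+z. \<integral>\<^sup>+y. f y * g (z - y) * h (x - z) \<partial>lborel \<partial>lborel)"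
    unfolding conv_def by (intro nn_integral_cong nn_integral_multc[symmetric]) measurable
  also have "\<dots> = (\<integral>\<^sup>+y. \<integral>\<^sup>+z. f y * g (z - y) * h (x - z) \<partial>lborel \<partial>lborel)"
    by (rule lborel_pair.Fubini'[symmetric]) measurable
  also have "\<dots> = (\<integral>\<^sup>+y. f y * (\<integral>\<^sup>+z. g (z - y) * h (x - z) \<partial>lborel) \<partial>lborel)"
    unfolding mult.assoc by (intro nn_integral_cong nn_integral_cmult) measurable
  also have "\<dots> = conv f (conv g h) x"
  proof -
    have "(\<integral>\<^sup>+z. g (z - y) * h (x - z) \<partial>lborel) = (\<integral>\<^sup>+z. g ((z + y) - y) * h (x - (z + y)) \<partial>lborel)" for y
      by (rule nn_integral_shift[symmetric]) measurable
    then have "(\<integral>\<^sup>+z. g (z - y) * h (x - z) \<partial>lborel) = conv g h (x - y)" for y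
      by (simp add: conv_def algebra_simps)
    then show ?thesis by (simp only: conv_def[of f])
  qed
  finally show "conv (conv f g) h x = conv f (conv g h) x" .
qed

lemma conv_conv_swap:
  assumes [measurable]: "f \<in> borel_measurable borel" "g \<in> borel_measurable borel"
    "h \<in> borel_measurable borel" "k \<in> borel_measurable borel"
  shows "conv (conv f g) (conv h k) = conv (conv f h) (conv g k)"
  by (simp add: conv_assoc conv_assoc[of g h k, symmetric] conv_commute[of g h])

lemma conv_cong_AE_left:
  assumes "AE x in lborel. f x = f' x"
  shows "conv f g = conv f' g"
  unfolding conv_def using assms by (intro ext nn_integral_cong_AE) (auto elim: eventually_mono)

lemma conv_add_left:
  assumes [measurable]: "f \<in> borel_measurable borel" "f' \<in> borel_measurable borel" "g \<in> borel_measurable borel"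
  shows "conv (\<lambda>x. f x + f' x) g x = conv f g x + conv f' g x"
  unfolding conv_def by (simp add: distrib_right nn_integral_add)

lemma conv_cmult_left:
  assumes [measurable]: "f \<in> borel_measurable borel" "g \<in> borel_measurable borel"
  shows "conv (\<lambda>x. c * f x) g x = c * conv f g x"
  unfolding conv_def by (simp add: mult.assoc nn_integral_cmult)

lemma nn_integral_conv_exp:
  assumes [measurable]: "f \<in> borel_measurable borel" "g \<in> borel_measurable borel"
  shows "(\<integral>\<^sup>+x. conv f g x * ennreal (exp (s * x)) \<partial>lborel)
    = (\<integral>\<^sup>+x. f x * ennreal (exp (s * x)) \<partial>lborel) * (\<integral>\<^sup>+x. g x * ennreal (exp (s * x)) \<partial>lborel)"
proof -
  have "(\<integral>\<^sup>+x. conv f g x * ennreal (exp (s * x)) \<partial>lborel)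
      = (\<integral>\<^sup>+x. \<integral>\<^sup>+y. f y * g (x - y) * ennreal (exp (s * x)) \<partial>lborel \<partial>lborel)"
    unfolding conv_def by (intro nn_integral_cong nn_integral_multc[symmetric]) measurable
  also have "\<dots> = (\<integral>\<^sup>+y. \<integral>\<^sup>+x. f y * g (x - y) * ennreal (exp (s * x)) \<partial>lborel \<partial>lborel)"
    by (rule lborel_pair.Fubini'[symmetric]) measurable
  also have "\<dots> = (\<integral>\<^sup>+y. \<integral>\<^sup>+x. f y * g x * ennreal (exp (s * (x + y))) \<partial>lborel \<partial>lborel)"
  proof (rule nn_integral_cong)
    fix y
    have "(\<integral>\<^sup>+x. f y * g (x - y) * ennreal (exp (s * x)) \<partial>lborel) =
          (\<integral>\<^sup>+x. f y * g ((x + y) - y) * ennreal (exp (s * (x + y))) \<partial>lborel)"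
      by (rule nn_integral_shift[symmetric]) measurable
    then show "(\<integral>\<^sup>+x. f y * g (x - y) * ennreal (exp (s * x)) \<partial>lborel) =
      (\<integral>\<^sup>+x. f y * g x * ennreal (exp (s * (x + y))) \<partial>lborel)" by simp
  qed
  also have "\<dots> = (\<integral>\<^sup>+y. (f y * ennreal (exp (s * y))) * (\<integral>\<^sup>+x. g x * ennreal (exp (s * x)) \<partial>lborel) \<partial>lborel)"
    by (intro nn_integral_cong, subst nn_integral_cmult[symmetric])
       (auto intro!: nn_integral_cong simp: distrib_left exp_add ennreal_mult mult_ac)
  also have "\<dots> = (\<integral>\<^sup>+x. f x * ennreal (exp (s * x)) \<partial>lborel) * (\<integral>\<^sup>+x. g x * ennreal (exp (s * x)) \<partial>lborel)"
    by (rule nn_integral_multc) measurable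
  finally show ?thesis .
qed

section \<open>Exponential kernels and their transforms\<close>

text \<open>In the variable u = e^y this is (u - 1)^(-a) on u > 1, whose Mellin transform is a Beta
  value.\<close>

definition beta_ker :: "real \<Rightarrow> real \<Rightarrow> ennreal" where
  "beta_ker a y = ennreal (indicator {0<..} y * (exp y - 1) powr (- a))"

text \<open>Convolution with this kernel is the Stieltjes transform in exponential variables: with u
  = e^y and x = e^Y the factor \<open>logistic (Y - y)\<close> times dy is du / (u + x).\<close>

definition logistic :: "real \<Rightarrow> ennreal" where
  "logistic y = ennreal (1 / (1 + exp y))"

lemma measurable_kernels [measurable]:
  "beta_ker a \<in> borel_measurable borel" "logistic \<in> borel_measurable borel"
  unfolding beta_ker_def logistic_def by measurable

text \<open>The Mellin transform of 1 / (w + c) with w = e^y. The substitution u = w / (w + c) makes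
  it the Beta integral with parameters 1 + e and - e, and the reflection formula produces the
  sine.\<close>

lemma nn_integral_exp_over_exp_plus:
  assumes e: "-1 < e" "e < 0" and c: "c > 0"
  shows "(\<integral>\<^sup>+y. ennreal (exp ((1 + e) * y) / (exp y + c)) \<partial>lborel)
       = ennreal (c powr e * (pi / sin (pi * (- e))))"
proof -
  have "(\<integral>\<^sup>+y. ennreal (indicator UNIV y * (exp ((1 + e) * y) / (exp y + c))) \<partial>lborel)
     = (\<integral>\<^sup>+u. ennreal (indicator {0<..<1} u *
          (\<bar>1 / (u * (1 - u))\<bar> * (exp ((1 + e) * ln (c * u / (1 - u))) / (exp (ln (c * u / (1 - u))) + c)))) \<partial>lborel)"
  proof (rule nn_integral_substitution_bij[where h = "\<lambda>y. exp y / (exp y + c)" and g="\<lambda>u. ln (c * u / (1 - u))"])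
    fix u :: real assume u: "u \<in> {0<..<1}"
    then show "((\<lambda>u. ln (c * u / (1 - u))) has_field_derivative 1 / (u * (1 - u))) (at u within {0<..<1})"
      using c by (auto intro!: derivative_eq_intros simp: divide_simps) (simp add: algebra_simps)
    show "exp (ln (c * u / (1 - u))) / (exp (ln (c * u / (1 - u))) + c) = u"
      using u c by (simp add: field_simps)
  next
    fix y :: real
    have p: "exp y + c > 0" using c by (simp add: add_pos_pos)
    show "exp y / (exp y + c) \<in> {0<..<1}" using c p by (auto simp: field_simps)
    have "1 - exp y / (exp y + c) = c / (exp y + c)" using p by (simp add: diff_divide_eq_iff)
    then have "c * (exp y / (exp y + c)) / (1 - exp y / (exp y + c)) = exp y"
      using c p by simp
    then show "ln (c * (exp y / (exp y + c)) / (1 - exp y / (exp y + c))) = y" by simp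
  qed (use c in \<open>auto intro!: add_nonneg_pos divide_nonneg_pos\<close>)
  also have "\<dots> = (\<integral>\<^sup>+u. ennreal (c powr e) * ennreal (indicator {0<..<1} u * (u powr ((1 + e) - 1) * (1 - u) powr ((- e) - 1))) \<partial>lborel)"
  proof (rule nn_integral_cong)
    fix u :: real
    show "ennreal (indicator {0<..<1} u *
          (\<bar>1 / (u * (1 - u))\<bar> * (exp ((1 + e) * ln (c * u / (1 - u))) / (exp (ln (c * u / (1 - u))) + c))))
        = ennreal (c powr e) * ennreal (indicator {0<..<1} u * (u powr ((1 + e) - 1) * (1 - u) powr ((- e) - 1)))"
    proof (cases "u \<in> {0<..<1}")
      case True
      then have u: "0 < u" "u < 1" by auto
      define w where "w = c * u / (1 - u)"
      have w: "w > 0" using u c by (simp add: w_def)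
      have "exp ((1 + e) * ln w) = w * w powr e"
        using w by (simp add: distrib_right exp_add powr_def)
      also have "w powr e = c powr e * u powr e * (1 - u) powr (- e)"
        unfolding w_def using u c by (simp add: powr_divide powr_mult powr_minus field_simps)
      finally have 1: "exp ((1 + e) * ln w) = w * (c powr e * u powr e * (1 - u) powr (- e))" .
      have 2: "w / (exp (ln w) + c) = u" using u c w by (simp add: w_def field_simps)
      have 3: "(1 - u) powr (- e - 1) = (1 - u) powr (- e) / (1 - u)"
        using u powr_diff[of "1 - u" "- e" 1] by simp
      have "\<bar>1 / (u * (1 - u))\<bar> * (exp ((1 + e) * ln w) / (exp (ln w) + c))
          = 1 / (u * (1 - u)) * (w / (exp (ln w) + c)) * (c powr e * u powr e * (1 - u) powr (- e))"
        unfolding 1 using u by simp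
      also have "\<dots> = c powr e * (u powr e * (1 - u) powr (- e - 1))"
        unfolding 2 3 using u by simp
      finally show ?thesis using True
        by (simp add: w_def[symmetric] ennreal_mult[symmetric])
    qed simp
  qed
  also have "\<dots> = ennreal (c powr e) * ennreal (Beta (1 + e) (- e))"
    using e by (subst nn_integral_cmult) (auto simp: nn_integral_Beta[of "1 + e" "- e", simplified])
  also have "\<dots> = ennreal (c powr e * (pi / sin (pi * (- e))))"
    using Beta_reflection[of "- e"] e by (simp add: ennreal_mult'[symmetric])
  finally show ?thesis by simp
qed

text \<open>The Stieltjes transform of (w - 1)^(-a) over w > 1. The Moebius substitution u = (w - 1)
  / (w + x), with w = e^y and x = e^Y, pulls out the factor (1 + x)^(-a) and leaves a Beta integral
  free of x.\<close>

lemma conv_beta_logistic: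
  assumes a: "0 < a" "a < 1"
  shows "conv (beta_ker a) logistic Y = ennreal (pi / sin (pi * a) * (1 + exp Y) powr (- a))"
proof -
  define x where "x = exp Y"
  have x: "x > 0" by (simp add: x_def)
  let ?g = "\<lambda>u. ln ((1 + x * u) / (1 - u))"
  let ?f = "\<lambda>y. (exp y - 1) powr (- a) * (1 / (1 + exp (Y - y)))"
  let ?g' = "\<lambda>u. (1 + x) / ((1 - u) * (1 + x * u))"
  have "conv (beta_ker a) logistic Y = (\<integral>\<^sup>+y. ennreal (indicator {0<..} y * ?f y) \<partial>lborel)"
    unfolding conv_def beta_ker_def logistic_def
    by (intro nn_integral_cong) (auto simp: indicator_def ennreal_mult[symmetric] add_nonneg_nonneg)
  also have "\<dots> = (\<integral>\<^sup>+u. ennreal (indicator {0<..<1} u * (\<bar>?g' u\<bar> * ?f (?g u))) \<partial>lborel)"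
  proof (rule nn_integral_substitution_bij[where h = "\<lambda>y. (exp y - 1) / (exp y + x)" and g="?g"])
    fix u :: real assume "u \<in> {0<..<1}"
    then have u: "0 < u" "u < 1" by auto
    have pos: "1 + x * u > 0" using x u by (simp add: add_pos_pos)
    show "(?g has_field_derivative ?g' u) (at u within {0<..<1})"
      using x u pos by (auto intro!: derivative_eq_intros simp: divide_simps) (simp add: algebra_simps)
    have gt: "(1 + x * u) / (1 - u) > 1" using u x pos by (simp add: field_simps) (smt (verit) mult_pos_pos)
    then show "?g u \<in> {0<..}" by simp
    have eg: "exp (?g u) = (1 + x * u) / (1 - u)" using u pos by simp
    have "exp (?g u) - 1 = (1 + x) * u / (1 - u)" "exp (?g u) + x = (1 + x) / (1 - u)"
      unfolding eg using u by (simp_all add: field_simps)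
    then show "(exp (?g u) - 1) / (exp (?g u) + x) = u"
      using u x by simp
  next
    fix y :: real assume y: "y \<in> {0<..}"
    then have e: "exp y > 1" by simp
    then have p: "exp y + x > 0" using x by (simp add: add_pos_pos)
    show "(exp y - 1) / (exp y + x) \<in> {0<..<1}" using e p x by (auto simp: field_simps)
    have "1 + x * ((exp y - 1) / (exp y + x)) = exp y * (1 + x) / (exp y + x)"
      "1 - (exp y - 1) / (exp y + x) = (1 + x) / (exp y + x)"
      using p by (simp_all add: field_simps)
    then have "(1 + x * ((exp y - 1) / (exp y + x))) / (1 - (exp y - 1) / (exp y + x)) = exp y"
      using p x by simp
    then show "ln ((1 + x * ((exp y - 1) / (exp y + x))) / (1 - (exp y - 1) / (exp y + x))) = y" by simp
  qed (auto simp: add_nonneg_nonneg)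
  also have "\<dots> = (\<integral>\<^sup>+u. ennreal ((1 + x) powr (- a)) * ennreal (indicator {0<..<1} u * (u powr ((1 - a) - 1) * (1 - u) powr (a - 1))) \<partial>lborel)"
  proof (rule nn_integral_cong)
    fix u :: real
    show "ennreal (indicator {0<..<1} u * (\<bar>?g' u\<bar> * ?f (?g u)))
       = ennreal ((1 + x) powr (- a)) * ennreal (indicator {0<..<1} u * (u powr ((1 - a) - 1) * (1 - u) powr (a - 1)))"
    proof (cases "u \<in> {0<..<1}")
      case True
      then have u: "0 < u" "u < 1" by auto
      have pos: "1 + x * u > 0" using x u by (simp add: add_pos_pos)
      have eg: "exp (?g u) = (1 + x * u) / (1 - u)" using u pos by simp
      have 1: "exp (?g u) - 1 = (1 + x) * u / (1 - u)"
        unfolding eg using u by (simp add: field_simps)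
      have 2: "1 / (1 + exp (Y - ?g u)) = (1 + x * u) / (1 + x)"
        unfolding exp_diff eg x_def[symmetric] using u pos x by (simp add: field_simps)
      have 3: "((1 + x) * u / (1 - u)) powr (- a) = (1 + x) powr (- a) * u powr (- a) * (1 - u) powr a"
        using u x by (simp add: powr_divide powr_mult powr_minus divide_simps)
      have 4: "(1 - u) powr (a - 1) = (1 - u) powr a / (1 - u)"
        using u powr_diff[of "1 - u" a 1] by simp
      have 5: "\<bar>?g' u\<bar> = (1 + x) / ((1 - u) * (1 + x * u))" using u x pos by simp
      have "\<bar>?g' u\<bar> * ?f (?g u) = (1 + x) powr (- a) * (u powr (- a) * (1 - u) powr (a - 1))"
        unfolding 1 2 3 4 5 using u x pos by (simp add: mult_ac)
      then show ?thesis using True by (simp add: ennreal_mult[symmetric])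
    qed simp
  qed
  also have "\<dots> = ennreal ((1 + x) powr (- a)) * ennreal (Beta (1 - a) a)"
    using a by (subst nn_integral_cmult) (auto simp: nn_integral_Beta[of "1 - a" a, simplified])
  also have "\<dots> = ennreal (pi / sin (pi * a) * (1 + exp Y) powr (- a))"
    using Beta_reflection[of a] a by (simp add: ennreal_mult''[symmetric] x_def mult.commute)
  finally show ?thesis .
qed

lemma nn_integral_beta_ker_exp:
  assumes a: "a < 1" "s + a > 0"
  shows "(\<integral>\<^sup>+y. beta_ker a y * ennreal (exp (- s * y)) \<partial>lborel) = ennreal (Beta (1 - a) (s + a))"
proof -
  let ?g = "\<lambda>u. - ln (1 - u) :: real"
  let ?f = "\<lambda>y. (exp y - 1) powr (- a) * exp (- s * y)"
  have "(\<integral>\<^sup>+y. beta_ker a y * ennreal (exp (- s * y)) \<partial>lborel) = (\<integral>\<^sup>+y. ennreal (indicator {0<..} y * ?f y) \<partial>lborel)"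
    unfolding beta_ker_def
    by (intro nn_integral_cong) (auto simp: indicator_def ennreal_mult[symmetric])
  also have "\<dots> = (\<integral>\<^sup>+u. ennreal (indicator {0<..<1} u * (\<bar>1 / (1 - u)\<bar> * ?f (?g u))) \<partial>lborel)"
    by (rule nn_integral_substitution_bij[where h = "\<lambda>y. 1 - exp (- y)" and g="?g"])
      (auto intro!: derivative_eq_intros simp: divide_simps)
  also have "\<dots> = (\<integral>\<^sup>+u. ennreal (indicator {0<..<1} u * (u powr ((1 - a) - 1) * (1 - u) powr ((s + a) - 1))) \<partial>lborel)"
  proof (rule nn_integral_cong)
    fix u :: real
    show "ennreal (indicator {0<..<1} u * (\<bar>1 / (1 - u)\<bar> * ?f (?g u)))
       = ennreal (indicator {0<..<1} u * (u powr ((1 - a) - 1) * (1 - u) powr ((s + a) - 1)))"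
    proof (cases "u \<in> {0<..<1}")
      case True
      then have u: "0 < u" "u < 1" by auto
      have 1: "exp (?g u) - 1 = u / (1 - u)" using u by (simp add: exp_minus field_simps)
      have 2: "exp (- s * ?g u) = (1 - u) powr s" using u by (simp add: powr_def)
      have 3: "(u / (1 - u)) powr (- a) = u powr (- a) * (1 - u) powr a"
        using u by (simp add: powr_divide powr_minus field_simps)
      have 4: "(1 - u) powr (s + a - 1) = (1 - u) powr s * (1 - u) powr a / (1 - u)"
        using u by (simp add: powr_diff powr_add)
      have "\<bar>1 / (1 - u)\<bar> * ?f (?g u) = u powr (- a) * (1 - u) powr (s + a - 1)"
        unfolding 1 2 3 4 using u by (simp add: field_simps)
      then show ?thesis using True by simp
    qed simp
  qed
  also have "\<dots> = ennreal (Beta (1 - a) (s + a))"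
    using a by (intro nn_integral_Beta) auto
  finally show ?thesis .
qed

section \<open>Moments from exponential integrals\<close>

lemma power_le_fact_mult_exp:
  assumes "0 \<le> (x::real)"
  shows "x ^ m \<le> fact m * exp x"
proof -
  have "(\<Sum>n\<in>{m}. x ^ n /\<^sub>R fact n) \<le> (\<Sum>n. x ^ n /\<^sub>R fact n)"
    using assms by (intro sum_le_suminf summable_exp_generic) auto
  then show ?thesis by (simp add: exp_def field_simps)
qed

text \<open>Turns a closed formula for an exponential integral into formulas for polynomial moments,
  by comparing Taylor coefficients in e. It serves both the moments of \<open>logistic_pair\<close>
  and the expansion of the Laplace transform of \<open>X\<close> in epsilon.\<close>

lemma exp_moment_series:
  fixes w :: "real \<Rightarrow> real"
  assumes w: "w \<in> borel_measurable borel" "\<And>y. 0 \<le> w y"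
    and d: "0 < d" "(\<integral>\<^sup>+y. ennreal (w y * exp (d * \<bar>y\<bar>)) \<partial>lborel) < \<infinity>"
  shows "integrable lborel (\<lambda>y. w y * exp (d * \<bar>y\<bar>))"
    and "integrable lborel (\<lambda>y. w y * y ^ m)"
    and "\<bar>e\<bar> \<le> d \<Longrightarrow> integrable lborel (\<lambda>y. w y * exp (e * y))"
    and "\<bar>e\<bar> \<le> d \<Longrightarrow> (\<lambda>m. (\<integral>y. w y * y ^ m \<partial>lborel) / fact m * e ^ m) sums (\<integral>y. w y * exp (e * y) \<partial>lborel)"
proof -
  note [measurable] = w(1)
  show I: "integrable lborel (\<lambda>y. w y * exp (d * \<bar>y\<bar>))"
    using d(2) w(2) by (intro integrableI_nonneg) auto
  show P: "integrable lborel (\<lambda>y. w y * y ^ m)" for m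
  proof (rule Bochner_Integration.integrable_bound)
    show "integrable lborel (\<lambda>y. fact m / d ^ m * (w y * exp (d * \<bar>y\<bar>)))" using I by simp
    show "AE y in lborel. norm (w y * y ^ m) \<le> norm (fact m / d ^ m * (w y * exp (d * \<bar>y\<bar>)))"
    proof (rule AE_I2)
      fix y :: real
      have "(d * \<bar>y\<bar>) ^ m \<le> fact m * exp (d * \<bar>y\<bar>)"
        using d(1) by (intro power_le_fact_mult_exp) auto
      then have "\<bar>y\<bar> ^ m \<le> fact m / d ^ m * exp (d * \<bar>y\<bar>)"
        using d(1) by (simp add: power_mult_distrib field_simps)
      then have "w y * \<bar>y\<bar> ^ m \<le> w y * (fact m / d ^ m * exp (d * \<bar>y\<bar>))"
        using w(2) by (intro mult_left_mono)
      then show "norm (w y * y ^ m) \<le> norm (fact m / d ^ m * (w y * exp (d * \<bar>y\<bar>)))"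
        using w(2)[of y] d(1) by (simp add: abs_mult power_abs mult_ac)
    qed
  qed measurable
  assume e: "\<bar>e\<bar> \<le> d"
  have le: "exp \<bar>e * y\<bar> \<le> exp (d * \<bar>y\<bar>)" for y
    using e d(1) by (simp add: abs_mult mult_right_mono)
  show "integrable lborel (\<lambda>y. w y * exp (e * y))"
  proof (rule Bochner_Integration.integrable_bound[OF I])
    show "AE y in lborel. norm (w y * exp (e * y)) \<le> norm (w y * exp (d * \<bar>y\<bar>))"
      using w(2) le by (intro AE_I2) (auto simp: abs_mult intro!: mult_left_mono
        intro: order_trans[OF _ le, simplified] order_trans[OF abs_ge_self])
  qed measurable
  have "(\<lambda>n. \<integral>y. w y * (\<Sum>m<n. (e * y) ^ m / fact m) \<partial>lborel) \<longlonglongrightarrow> (\<integral>y. w y * exp (e * y) \<partial>lborel)"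
  proof (rule integral_dominated_convergence[OF _ _ I])
    show "AE y in lborel. (\<lambda>n. w y * (\<Sum>m<n. (e * y) ^ m / fact m)) \<longlonglongrightarrow> w y * exp (e * y)"
      using exp_converges[of "e * y" for y] unfolding sums_def
      by (intro AE_I2 tendsto_mult_left) (simp add: scaleR_conv_of_real field_simps)
    show "AE y in lborel. norm (w y * (\<Sum>m<n. (e * y) ^ m / fact m)) \<le> w y * exp (d * \<bar>y\<bar>)" for n
    proof (rule AE_I2)
      fix y :: real
      have "\<bar>\<Sum>m<n. (e * y) ^ m / fact m\<bar> \<le> (\<Sum>m<n. \<bar>e * y\<bar> ^ m /\<^sub>R fact m)"
        by (rule order_trans[OF sum_abs]) (simp add: power_abs abs_mult divide_inverse mult.commute)
      also have "\<dots> \<le> exp \<bar>e * y\<bar>"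
        unfolding exp_def by (intro sum_le_suminf summable_exp_generic) auto
      also note le
      finally show "norm (w y * (\<Sum>m<n. (e * y) ^ m / fact m)) \<le> w y * exp (d * \<bar>y\<bar>)"
        using w(2)[of y] by (simp add: abs_mult mult_left_mono)
    qed
  qed measurable
  moreover have "(\<integral>y. w y * (\<Sum>m<n. (e * y) ^ m / fact m) \<partial>lborel)
      = (\<Sum>m<n. (\<integral>y. w y * y ^ m \<partial>lborel) / fact m * e ^ m)" for n
  proof -
    have "(\<integral>y. w y * (\<Sum>m<n. (e * y) ^ m / fact m) \<partial>lborel)
        = (\<integral>y. (\<Sum>m<n. w y * y ^ m * (e ^ m / fact m)) \<partial>lborel)"
      by (simp add: sum_distrib_left power_mult_distrib mult_ac)
    also have "\<dots> = (\<Sum>m<n. (\<integral>y. w y * y ^ m \<partial>lborel) * (e ^ m / fact m))"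
      using P by (subst Bochner_Integration.integral_sum) auto
    finally show ?thesis by simp
  qed
  ultimately show "(\<lambda>m. (\<integral>y. w y * y ^ m \<partial>lborel) / fact m * e ^ m) sums (\<integral>y. w y * exp (e * y) \<partial>lborel)"
    by (simp add: sums_def)
qed

text \<open>The two Mellin integrals behind \<open>integral_logistic_pair_exp\<close> converge
  separately only for -1 < e < 0. The point 0, where Taylor coefficients are compared, is an end
  point of that interval, so the identity theorem has to cross it.\<close>

lemma holomorphic_zero_of_real_zero:
  assumes "G holomorphic_on ball 0 r" "r > 0"
    and "\<And>e. -r < e \<Longrightarrow> e < 0 \<Longrightarrow> G (of_real e) = 0" and "z \<in> ball 0 r"
  shows "G z = 0"
proof (rule analytic_continuation[OF assms(1), where U="of_real ` {-r<..<0}" and \<xi>="complex_of_real (- r / 2)"])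
  have "(- r / 2) islimpt {-r<..<0}"
    using assms(2) by (intro interior_limit_point) auto
  then show "complex_of_real (- r / 2) islimpt of_real ` {-r<..<0}"
    by (rule islimpt_isCont_image) (auto simp: eventually_at_filter simp del: of_real_divide of_real_minus)
  show "complex_of_real (- r / 2) \<in> ball 0 r" unfolding mem_ball_0 norm_of_real using assms(2) by simp
  show "complex_of_real ` {-r<..<0} \<subseteq> ball 0 r" by auto
qed (use assms in auto)

lemma fps_conv_radius_of_real_summable:
  assumes "\<And>e. -r < e \<Longrightarrow> e < 0 \<Longrightarrow> summable (\<lambda>m. c m * e ^ m :: real)" "r > 0"
  shows "fps_conv_radius (Abs_fps (\<lambda>m. complex_of_real (c m))) \<ge> ereal r"
  unfolding fps_conv_radius_def
proof (rule conv_radius_geI_ex)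
  fix s :: real assume s: "0 < s" "ereal s < ereal r"
  have "summable (\<lambda>m. c m * (- s) ^ m)" using s by (intro assms(1)) auto
  then have "summable (\<lambda>m. complex_of_real (c m * (- s) ^ m))" by (rule summable_of_real)
  then have "summable (\<lambda>m. complex_of_real (c m) * complex_of_real (- s) ^ m)" by simp
  then show "\<exists>z. norm z = s \<and> summable (\<lambda>n. fps_nth (Abs_fps (\<lambda>m. complex_of_real (c m))) n * z ^ n)"
    using s by (intro exI[of _ "complex_of_real (- s)"]) auto
qed

lemma eval_fps_of_real_sums:
  assumes "(\<lambda>m. c m * e ^ m :: real) sums s"
  shows "eval_fps (Abs_fps (\<lambda>m. complex_of_real (c m))) (of_real e) = of_real s"
proof -
  have "(\<lambda>m. complex_of_real (c m * e ^ m)) sums of_real s" using assms by (rule sums_of_real)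
  then show ?thesis by (simp add: eval_fps_def sums_iff)
qed

section \<open>Convolution powers of the logistic kernel\<close>

text \<open>The integrand of the convolution square of \<open>logistic\<close>, kept real-valued
  because its signed moments in y are needed.\<close>

definition logistic_pair :: "real \<Rightarrow> real \<Rightarrow> real" where
  "logistic_pair Y y = 1 / (1 + exp y) * (1 / (1 + exp (Y - y)))"

lemma logistic_pair_measurable [measurable]: "logistic_pair Y \<in> borel_measurable borel"
  unfolding logistic_pair_def by measurable

lemma logistic_pair_nonneg: "logistic_pair Y y \<ge> 0"
  by (simp add: logistic_pair_def add_nonneg_nonneg)

lemma logistic_pair_altdef: "logistic_pair Y y = exp y / ((1 + exp y) * (exp y + exp Y))"
proof -
  have "1 + exp y > 0" "exp y + exp Y > 0" by (auto intro: add_pos_pos)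
  then show ?thesis by (simp add: logistic_pair_def exp_diff field_simps)
qed

text \<open>The integrand decays like e^(-|y|) in both directions, so the weight with exponent 1/2
  is harmless; the majorant is the Mellin integrand at e = -1/2.\<close>

lemma logistic_pair_exp_finite:
  "(\<integral>\<^sup>+y. ennreal (logistic_pair Y y * exp (1/2 * \<bar>y\<bar>)) \<partial>lborel) < \<infinity>"
proof -
  have "(\<integral>\<^sup>+y. ennreal (logistic_pair Y y * exp (1/2 * \<bar>y\<bar>)) \<partial>lborel)
      \<le> (\<integral>\<^sup>+y. ennreal (1 + exp (- Y)) * ennreal (exp ((1 + (- 1/2)) * y) / (exp y + 1)) \<partial>lborel)"
  proof (rule nn_integral_mono)
    fix y :: real
    have p: "exp y + 1 > 0" "exp y + exp Y > 0" by (auto intro: add_pos_pos)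
    have a: "exp y / (exp y + exp Y) \<le> 1" using p by (simp add: field_simps)
    have b: "1 / (exp y + exp Y) \<le> exp (- Y)"
      using p by (simp add: exp_minus field_simps)
    have "exp y * exp (1/2 * \<bar>y\<bar>) / (exp y + exp Y) \<le> (1 + exp (- Y)) * exp (y / 2)"
    proof (cases "y \<ge> 0")
      case True
      have "exp y / (exp y + exp Y) * exp (y / 2) \<le> 1 * exp (y / 2)"
        using a by (intro mult_right_mono) auto
      also have "\<dots> \<le> (1 + exp (- Y)) * exp (y / 2)" by (intro mult_right_mono) auto
      finally show ?thesis using True by simp
    next
      case False
      have "exp y * exp (1/2 * \<bar>y\<bar>) = exp (y / 2)" using False by (simp add: exp_add[symmetric])
      moreover have "1 / (exp y + exp Y) * exp (y / 2) \<le> exp (- Y) * exp (y / 2)"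
        using b by (intro mult_right_mono) auto
      moreover have "exp (- Y) * exp (y / 2) \<le> (1 + exp (- Y)) * exp (y / 2)"
        by (intro mult_right_mono) auto
      ultimately show ?thesis
        by (metis (no_types, lifting) order_trans mult_1 times_divide_eq_left)
    qed
    then have "exp y * exp (1/2 * \<bar>y\<bar>) / (exp y + exp Y) / (exp y + 1) \<le> (1 + exp (- Y)) * exp (y / 2) / (exp y + 1)"
      using p by (intro divide_right_mono) auto
    then have "logistic_pair Y y * exp (1/2 * \<bar>y\<bar>) \<le> (1 + exp (- Y)) * (exp ((1 + (- 1/2)) * y) / (exp y + 1))"
      by (simp add: logistic_pair_altdef mult_ac add.commute)
    then show "ennreal (logistic_pair Y y * exp (1/2 * \<bar>y\<bar>))
        \<le> ennreal (1 + exp (- Y)) * ennreal (exp ((1 + (- 1/2)) * y) / (exp y + 1))"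
      using p by (subst ennreal_mult[symmetric]) (auto intro!: ennreal_leI add_nonneg_nonneg)
  qed
  also have "\<dots> = ennreal (1 + exp (- Y)) * (\<integral>\<^sup>+y. ennreal (exp ((1 + (- 1/2)) * y) / (exp y + 1)) \<partial>lborel)"
    by (rule nn_integral_cmult) measurable
  also have "\<dots> < \<infinity>"
    by (subst nn_integral_exp_over_exp_plus) (auto simp: ennreal_mult_less_top)
  finally show ?thesis .
qed

text \<open>Partial fractions in e^y: e^Y - 1 times the integrand is a difference of two Stieltjes
  kernels, with c = 1 and c = e^Y. Multiplying by the sine clears the denominator that vanishes at e
  = 0, so the formula can later be expanded there.\<close>

lemma integral_logistic_pair_exp:
  assumes e: "-1 < e" "e < 0"
  shows "sin (pi * e) * (exp Y - 1) * (\<integral>y. logistic_pair Y y * exp (e * y) \<partial>lborel) = pi * (exp (e * Y) - 1)"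
proof -
  have s: "sin (pi * e) \<noteq> 0"
    using sin_gt_zero[of "pi * (- e)"] e mult_strict_left_mono[of "- e" 1 pi] by (auto simp: mult_less_0_iff)
  have hb: "has_bochner_integral lborel (\<lambda>y. exp ((1 + e) * y) / (exp y + c)) (c powr e * (pi / sin (pi * (- e))))"
    if "c > 0" for c
  proof (rule has_bochner_integral_nn_integral)
    show "(\<integral>\<^sup>+y. ennreal (exp ((1 + e) * y) / (exp y + c)) \<partial>lborel) = ennreal (c powr e * (pi / sin (pi * (- e))))"
      using e that by (rule nn_integral_exp_over_exp_plus)
    have "sin (pi * (- e)) > 0"
      using sin_gt_zero[of "pi * (- e)"] e mult_strict_left_mono[of "- e" 1 pi] by (auto simp: mult_less_0_iff)
    then show "0 \<le> c powr e * (pi / sin (pi * - e))"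
      by (metis divide_nonneg_nonneg less_imp_le mult_nonneg_nonneg pi_ge_zero powr_ge_zero)
  qed (use that in \<open>auto intro!: add_nonneg_nonneg divide_nonneg_nonneg\<close>)
  have "has_bochner_integral lborel (\<lambda>y. exp ((1 + e) * y) / (exp y + 1) - exp ((1 + e) * y) / (exp y + exp Y))
      (1 powr e * (pi / sin (pi * (- e))) - exp Y powr e * (pi / sin (pi * (- e))))"
    by (intro has_bochner_integral_diff hb) auto
  also have "(\<lambda>y. exp ((1 + e) * y) / (exp y + 1) - exp ((1 + e) * y) / (exp y + exp Y))
     = (\<lambda>y. (exp Y - 1) * (logistic_pair Y y * exp (e * y)))"
  proof
    fix y :: real
    have p: "exp y + 1 > 0" "exp y + exp Y > 0" by (auto intro: add_pos_pos)
    have "exp ((1 + e) * y) = exp y * exp (e * y)" by (simp add: distrib_right exp_add)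
    moreover have "1 / (exp y + 1) - 1 / (exp y + exp Y) = (exp Y - 1) / ((1 + exp y) * (exp y + exp Y))"
      using p by (simp add: field_simps)
    moreover have "exp y * exp (e * y) / (exp y + 1) - exp y * exp (e * y) / (exp y + exp Y)
        = exp y * exp (e * y) * (1 / (exp y + 1) - 1 / (exp y + exp Y))"
      by (simp add: right_diff_distrib)
    ultimately have "exp ((1 + e) * y) / (exp y + 1) - exp ((1 + e) * y) / (exp y + exp Y)
        = exp y * exp (e * y) * ((exp Y - 1) / ((1 + exp y) * (exp y + exp Y)))" by (simp only:)
    then show "exp ((1 + e) * y) / (exp y + 1) - exp ((1 + e) * y) / (exp y + exp Y)
        = (exp Y - 1) * (logistic_pair Y y * exp (e * y))"
      by (simp add: logistic_pair_altdef mult_ac)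
  qed
  finally have "(exp Y - 1) * (\<integral>y. logistic_pair Y y * exp (e * y) \<partial>lborel)
      = 1 powr e * (pi / sin (pi * (- e))) - exp Y powr e * (pi / sin (pi * (- e)))"
    by (simp add: has_bochner_integral_iff)
  then show ?thesis
    using s by (simp add: powr_def field_simps)
qed

text \<open>The three moments come from the coefficients of e, e^2 and e^3 in
  \<open>integral_logistic_pair_exp\<close>; the shift by one is the simple zero of the sine. Its
  cubic coefficient - pi^3 / 6 brings pi^2 into the second moment.\<close>

lemma logistic_pair_moments:
  assumes Y: "Y \<noteq> 0"
  shows "(\<integral>y. logistic_pair Y y \<partial>lborel) = Y / (exp Y - 1)"
    and "(\<integral>y. logistic_pair Y y * y \<partial>lborel) = Y ^ 2 / 2 / (exp Y - 1)"
    and "(\<integral>y. logistic_pair Y y * y ^ 2 \<partial>lborel) = (Y ^ 3 + pi ^ 2 * Y) / 3 / (exp Y - 1)"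
proof -
  define c where "c = (\<lambda>m. (\<integral>y. logistic_pair Y y * y ^ m \<partial>lborel) / fact m)"
  define F where "F = Abs_fps (\<lambda>m. complex_of_real (c m))"
  have sums: "(\<lambda>m. c m * e ^ m) sums (\<integral>y. logistic_pair Y y * exp (e * y) \<partial>lborel)"
    if "- (1/2) < e" "e < 0" for e
    unfolding c_def using that
    by (intro exp_moment_series(4)[where d="1/2"] logistic_pair_nonneg logistic_pair_exp_finite) auto
  have rad: "fps_conv_radius F \<ge> ereal (1/2)"
    unfolding F_def using sums by (intro fps_conv_radius_of_real_summable) (auto simp: sums_iff)
  define D where "D = complex_of_real (exp Y - 1)"
  define L where "L = fps_sin (of_real pi) * fps_const D * F"
  define R where "R = fps_const (of_real pi) * (fps_exp (complex_of_real Y) - 1)"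
  have sub: "ball (0::complex) (1/2) \<subseteq> eball 0 (fps_conv_radius F)"
  proof
    fix x :: complex assume "x \<in> ball 0 (1/2)"
    then have "ereal (norm x) < ereal (1/2)" by simp
    from less_le_trans[OF this rad] show "x \<in> eball 0 (fps_conv_radius F)" by (simp add: in_eball_iff)
  qed
  have hol: "(\<lambda>e. sin (of_real pi * e) * D * eval_fps F e - of_real pi * (exp (of_real Y * e) - 1)) holomorphic_on ball 0 (1/2)"
    by (intro holomorphic_intros sub)
  have "sin (of_real pi * e) * D * eval_fps F e - of_real pi * (exp (of_real Y * e) - 1) = 0"
    if "e \<in> ball 0 (1/2)" for e
  proof (rule holomorphic_zero_of_real_zero[OF hol _ _ that])
    fix e :: real assume e: "- (1/2) < e" "e < 0"
    have "eval_fps F (of_real e) = of_real (\<integral>y. logistic_pair Y y * exp (e * y) \<partial>lborel)"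
      unfolding F_def using sums[OF e] by (rule eval_fps_of_real_sums)
    moreover have "sin (complex_of_real pi * of_real e) = of_real (sin (pi * e))"
      "exp (complex_of_real Y * of_real e) = of_real (exp (Y * e))"
      by (simp_all add: sin_of_real[symmetric] exp_of_real[symmetric])
    ultimately have "sin (of_real pi * of_real e) * D * eval_fps F (of_real e) - of_real pi * (exp (of_real Y * of_real e) - 1)
      = complex_of_real (sin (pi * e) * (exp Y - 1) * (\<integral>y. logistic_pair Y y * exp (e * y) \<partial>lborel) - pi * (exp (e * Y) - 1))"
      by (simp add: D_def mult.commute)
    also have "\<dots> = 0" using integral_logistic_pair_exp[of e Y] e by simp
    finally show "sin (of_real pi * of_real e) * D * eval_fps F (of_real e) - of_real pi * (exp (of_real Y * of_real e) - 1) = 0" .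
  qed simp
  then have ev: "\<forall>\<^sub>F e in nhds 0. sin (of_real pi * e) * D * eval_fps F e - of_real pi * (exp (of_real Y * e) - 1) = 0"
    unfolding eventually_nhds_metric by (intro exI[of _ "1/2"]) (auto simp: dist_norm)
  have Fexp: "eval_fps F has_fps_expansion F"
    using rad by (intro eval_fps_has_fps_expansion) (rule less_le_trans[of _ "ereal (1/2)"], auto)
  have "(\<lambda>e. sin (of_real pi * e) * D * eval_fps F e - of_real pi * (exp (of_real Y * e) - 1)) has_fps_expansion L - R"
    unfolding L_def R_def by (intro fps_expansion_intros Fexp)
  moreover have "(\<lambda>e. sin (of_real pi * e) * D * eval_fps F e - of_real pi * (exp (of_real Y * e) - 1)) has_fps_expansion 0"
    unfolding has_fps_expansion_0_iff by (rule ev)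
  ultimately have "L - R = 0" by (rule fps_expansion_unique_complex)
  then have LR: "L = R" by simp
  have D0: "exp Y - 1 \<noteq> 0" using Y by simp
  have nth: "fps_nth L n = D * (\<Sum>i\<le>n. fps_nth (fps_sin (of_real pi)) i * of_real (c (n - i)))" for n
  proof -
    have "L = fps_const D * (fps_sin (of_real pi) * F)" unfolding L_def by (simp add: mult_ac)
    then show ?thesis
      by (simp only: fps_mult_left_const_nth fps_mult_nth[of "fps_sin _"] F_def fps_nth_Abs_fps atMost_atLeast0)
  qed
  have Rn: "fps_nth R n = of_real (pi * Y ^ n / fact n)" if "n > 0" for n
    using that by (simp add: R_def)
  have sn: "fps_nth (fps_sin (complex_of_real pi)) 0 = 0" "fps_nth (fps_sin (complex_of_real pi)) 1 = of_real pi"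
     "fps_nth (fps_sin (complex_of_real pi)) 2 = 0" "fps_nth (fps_sin (complex_of_real pi)) 3 = of_real (- (pi ^ 3) / 6)"
    by (simp_all add: fps_sin_def fact_numeral)
  have "complex_of_real ((exp Y - 1) * (pi * c 0)) = of_real (pi * Y)"
    using nth[of 1] Rn[of 1] sn unfolding LR by (simp add: D_def)
  then have c0: "(exp Y - 1) * (pi * c 0) = pi * Y" by (simp only: of_real_eq_iff)
  have "complex_of_real ((exp Y - 1) * (pi * c 1)) = of_real (pi * Y ^ 2 / 2)"
    using nth[of 2] Rn[of 2] sn unfolding LR by (simp add: D_def numeral_2_eq_2)
  then have c1: "(exp Y - 1) * (pi * c 1) = pi * Y ^ 2 / 2" by (simp only: of_real_eq_iff)
  have "complex_of_real ((exp Y - 1) * (pi * c 2 - pi ^ 3 / 6 * c 0)) = of_real (pi * Y ^ 3 / 6)"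
    using nth[of 3] Rn[of 3] sn unfolding LR by (simp add: D_def numeral_3_eq_3 numeral_2_eq_2)
  then have c2: "(exp Y - 1) * (pi * c 2 - pi ^ 3 / 6 * c 0) = pi * Y ^ 3 / 6" by (simp only: of_real_eq_iff)
  have c0': "c 0 = Y / (exp Y - 1)" using c0 D0 by (simp add: eq_divide_eq mult.commute mult.left_commute)
  then show "(\<integral>y. logistic_pair Y y \<partial>lborel) = Y / (exp Y - 1)" by (simp add: c_def)
  have "c 1 * (exp Y - 1) = Y ^ 2 / 2" using c1 by (simp add: mult.commute mult.left_commute)
  then have "c 1 = Y ^ 2 / 2 / (exp Y - 1)" using D0 by (metis nonzero_mult_div_cancel_right)
  then show "(\<integral>y. logistic_pair Y y * y \<partial>lborel) = Y ^ 2 / 2 / (exp Y - 1)" by (simp add: c_def)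
  have "(exp Y - 1) * (pi * c 2) = pi * Y ^ 3 / 6 + pi ^ 3 / 6 * ((exp Y - 1) * c 0)"
  proof -
    have "(exp Y - 1) * (pi * c 2 - pi ^ 3 / 6 * c 0) = (exp Y - 1) * (pi * c 2) - pi ^ 3 / 6 * ((exp Y - 1) * c 0)"
      by (simp add: algebra_simps)
    then show ?thesis using c2 by linarith
  qed
  also have "(exp Y - 1) * c 0 = Y" using c0' D0 by simp
  finally have "pi * (c 2 * (exp Y - 1)) = pi * ((Y ^ 3 + pi ^ 2 * Y) / 6)"
    by (simp add: field_simps power3_eq_cube power2_eq_square)
  then have "c 2 * (exp Y - 1) = (Y ^ 3 + pi ^ 2 * Y) / 6"
    by (metis mult_left_cancel pi_neq_zero)
  then have "c 2 = (Y ^ 3 + pi ^ 2 * Y) / 6 / (exp Y - 1)"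
    using D0 by (metis nonzero_mult_div_cancel_right)
  moreover have "(\<integral>y. logistic_pair Y y * y ^ 2 \<partial>lborel) = 2 * c 2" by (simp add: c_def)
  moreover have "2 * (P / 6 / d) = P / 3 / d" for P d :: real by simp
  ultimately show "(\<integral>y. logistic_pair Y y * y ^ 2 \<partial>lborel) = (Y ^ 3 + pi ^ 2 * Y) / 3 / (exp Y - 1)"
    by (simp only:)
qed

definition log_ker :: "real \<Rightarrow> ennreal" where
  "log_ker = conv logistic logistic"

text \<open>A fourfold convolution power of \<open>logistic\<close>; the 3 is the degree in Y of the
  numerator of its closed form.\<close>

definition log_ker3 :: "real \<Rightarrow> ennreal" where
  "log_ker3 = conv log_ker log_ker"

lemma measurable_log_ker [measurable]:
  "log_ker \<in> borel_measurable borel" "log_ker3 \<in> borel_measurable borel"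
  unfolding log_ker_def log_ker3_def by measurable

lemma logistic_mult: "logistic y * logistic (Y - y) = ennreal (logistic_pair Y y)"
  by (simp add: logistic_def logistic_pair_def ennreal_mult[symmetric] add_nonneg_nonneg)

lemma integrable_logistic_pair_power: "integrable lborel (\<lambda>y. logistic_pair Y y * y ^ m)"
  by (rule exp_moment_series(2)[OF _ _ _ logistic_pair_exp_finite]) (auto simp: logistic_pair_nonneg)

text \<open>At Y = 0 the right-hand side would be 0 by division by zero, whereas the convolution has
  the value 1. Later uses therefore replace the kernel only almost everywhere.\<close>

lemma log_ker_eq:
  assumes "Y \<noteq> 0"
  shows "log_ker Y = ennreal (Y / (exp Y - 1))"
proof -
  have "log_ker Y = (\<integral>\<^sup>+y. ennreal (logistic_pair Y y) \<partial>lborel)"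
    by (simp add: log_ker_def conv_def logistic_mult)
  also have "\<dots> = ennreal (\<integral>y. logistic_pair Y y \<partial>lborel)"
    using integrable_logistic_pair_power[of Y 0] logistic_pair_nonneg
    by (intro nn_integral_eq_integral) auto
  finally show ?thesis using logistic_pair_moments(1)[OF assms] by simp
qed

lemma AE_log_ker: "AE y in lborel. log_ker y = ennreal (y / (exp y - 1))"
  using AE_lborel_singleton[of 0] by eventually_elim (rule log_ker_eq)

lemma log_ker_real_nonneg: "0 \<le> y / (exp y - 1)" for y :: real
  by (cases "y \<ge> 0") (auto simp: zero_le_divide_iff)

lemma nn_integral_logistic_exp_half:
  "(\<integral>\<^sup>+y. logistic y * ennreal (exp (1/2 * y)) \<partial>lborel) = ennreal pi"
proof -
  have "(\<integral>\<^sup>+y. logistic y * ennreal (exp (1/2 * y)) \<partial>lborel)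
      = (\<integral>\<^sup>+y. ennreal (exp ((1 + (- 1/2)) * y) / (exp y + 1)) \<partial>lborel)"
    by (intro nn_integral_cong) (simp add: logistic_def ennreal_mult[symmetric] add_nonneg_nonneg add.commute)
  also have "\<dots> = ennreal pi"
    by (subst nn_integral_exp_over_exp_plus) auto
  finally show ?thesis .
qed

text \<open>The moment formulas divide by e^Y - 1 and say nothing at Y = 0. Replacing y by y / 2
  turns the integrand into a constant times \<open>log_ker y\<close> e^(y/2), because (t - 1) (1 +
  t) = t^2 - 1 with t = e^(y/2). The integral of a convolution square against an exponential is a
  square, here pi^2.\<close>

lemma conv_log_ker_logistic_0: "conv log_ker logistic 0 = ennreal (pi ^ 2 / 4)"
proof -
  define f where "f = (\<lambda>y::real. ennreal (y / (exp y - 1) * (1 / (1 + exp (0 - y)))))"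
  have [measurable]: "f \<in> borel_measurable borel" unfolding f_def by measurable
  have "conv log_ker logistic 0 = conv (\<lambda>y. ennreal (y / (exp y - 1))) logistic 0"
    by (simp only: conv_cong_AE_left[OF AE_log_ker])
  also have "\<dots> = (\<integral>\<^sup>+y. f y \<partial>lborel)"
    unfolding conv_def logistic_def f_def
    by (intro nn_integral_cong ennreal_mult[symmetric] log_ker_real_nonneg) (simp add: add_nonneg_nonneg)
  also have "\<dots> = ennreal (1/2) * (\<integral>\<^sup>+y. f (1/2 * y) \<partial>lborel)"
    using nn_integral_real_affine[of f "1/2" 0] by simp
  also have "(\<integral>\<^sup>+y. f (1/2 * y) \<partial>lborel) = (\<integral>\<^sup>+y. ennreal (1/2) * (log_ker y * ennreal (exp (1/2 * y))) \<partial>lborel)"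
  proof (rule nn_integral_cong_AE)
    show "AE y in lborel. f (1/2 * y) = ennreal (1/2) * (log_ker y * ennreal (exp (1/2 * y)))"
      using AE_log_ker AE_lborel_singleton[of 0]
    proof eventually_elim
      case (elim y)
      define t where "t = exp (y / 2)"
      have t: "t > 0" "t \<noteq> 1" using elim(2) by (auto simp: t_def)
      have ey: "exp y = t * t" by (simp add: t_def exp_add[symmetric])
      have "t * t - 1 \<noteq> 0" using t by (metis abs_of_pos eq_iff_diff_eq_0 power2_eq_square power2_eq_1_iff less_minus_one_simps(1) less_asym)
      then have "y / 2 / (t - 1) * (1 / (1 + 1 / t)) = 1/2 * (y / (t * t - 1) * t)"
        using t by (simp add: divide_simps) (simp add: algebra_simps)
      moreover have "f (1/2 * y) = ennreal (y / 2 / (t - 1) * (1 / (1 + 1 / t)))"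
      proof -
        have e: "exp (1/2 * y) = t" "exp (0 - 1/2 * y) = 1 / t"
          by (simp_all add: t_def exp_minus inverse_eq_divide)
        show ?thesis unfolding f_def e by simp
      qed
      moreover have "1/2 * (y / (exp y - 1) * exp (1/2 * y)) = 1/2 * (y / (t * t - 1) * t)"
        by (simp add: ey t_def)
      ultimately have "f (1/2 * y) = ennreal (1/2 * (y / (exp y - 1) * exp (1/2 * y)))"
        by (simp only:)
      also have "\<dots> = ennreal (1/2) * (log_ker y * ennreal (exp (1/2 * y)))"
        unfolding elim(1) using log_ker_real_nonneg[of y]
        by (simp only: ennreal_mult[symmetric] mult_nonneg_nonneg exp_ge_zero zero_le_divide_1_iff zero_le_numeral)
      finally show ?case .
    qed
  qed
  also have "\<dots> = ennreal (1/2) * (ennreal pi * ennreal pi)"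
  proof -
    have "(\<integral>\<^sup>+y. log_ker y * ennreal (exp (1/2 * y)) \<partial>lborel) = ennreal pi * ennreal pi"
      unfolding log_ker_def
      by (subst nn_integral_conv_exp) (simp_all only: measurable_kernels nn_integral_logistic_exp_half)
    then show ?thesis by (subst nn_integral_cmult) (auto simp only:, measurable)
  qed
  also have "ennreal (1/2) * (ennreal (1/2) * (ennreal pi * ennreal pi)) = ennreal (1/2 * (1/2 * (pi * pi)))"
    by (simp only: ennreal_mult[symmetric] mult_nonneg_nonneg pi_ge_zero zero_le_divide_1_iff zero_le_numeral)
  finally show ?thesis by (simp add: power2_eq_square)
qed

text \<open>Partial fractions reduce general Y to Y = 0: the integrand at Y, multiplied by 1 + e^Y,
  is twice the integrand at 0 plus (e^Y - 1) y times \<open>logistic_pair Y y\<close>. The value at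
  0 contributes pi^2, the first moment contributes Y^2.\<close>

lemma conv_log_ker_logistic: "conv log_ker logistic Y = ennreal ((Y ^ 2 + pi ^ 2) / (2 * (1 + exp Y)))"
proof -
  define f where "f = (\<lambda>Y y::real. y / (exp y - 1) * (1 / (1 + exp (Y - y))))"
  have f0: "f Y y \<ge> 0" for Y y
    unfolding f_def by (intro mult_nonneg_nonneg log_ker_real_nonneg) (simp add: add_nonneg_nonneg)
  have [measurable]: "f Y \<in> borel_measurable borel" for Y unfolding f_def by measurable
  have conv: "conv log_ker logistic Y = (\<integral>\<^sup>+y. ennreal (f Y y) \<partial>lborel)" for Y
  proof -
    have "conv log_ker logistic Y = conv (\<lambda>y. ennreal (y / (exp y - 1))) logistic Y"
      by (simp only: conv_cong_AE_left[OF AE_log_ker])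
    also have "\<dots> = (\<integral>\<^sup>+y. ennreal (f Y y) \<partial>lborel)"
      unfolding conv_def logistic_def f_def
      by (intro nn_integral_cong ennreal_mult[symmetric] log_ker_real_nonneg) (simp add: add_nonneg_nonneg)
    finally show ?thesis .
  qed
  show ?thesis
  proof (cases "Y = 0")
    case True
    then show ?thesis using conv_log_ker_logistic_0 by simp
  next
    case False
    have D0: "exp Y - 1 \<noteq> 0" using False by simp
    have h0: "has_bochner_integral lborel (f 0) (pi ^ 2 / 4)"
      using conv[of 0] conv_log_ker_logistic_0 f0
      by (intro has_bochner_integral_nn_integral) auto
    have h1: "has_bochner_integral lborel (\<lambda>y. logistic_pair Y y * y) (Y ^ 2 / 2 / (exp Y - 1))"
      using integrable_logistic_pair_power[of Y 1] logistic_pair_moments(2)[OF False]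
      by (simp add: has_bochner_integral_iff)
    have "has_bochner_integral lborel (\<lambda>y. (2 * f 0 y + (exp Y - 1) * (logistic_pair Y y * y)) / (1 + exp Y))
        ((2 * (pi ^ 2 / 4) + (exp Y - 1) * (Y ^ 2 / 2 / (exp Y - 1))) / (1 + exp Y))"
      by (intro has_bochner_integral_divide_zero has_bochner_integral_add has_bochner_integral_mult_right h0 h1)
    also have "(\<lambda>y. (2 * f 0 y + (exp Y - 1) * (logistic_pair Y y * y)) / (1 + exp Y)) = f Y"
    proof
      fix y :: real
      define t where "t = exp y"
      define v where "v = exp Y"
      have tv: "t > 0" "v > 0" by (auto simp: t_def v_def)
      have p: "1 + t > 0" "t + v > 0" "1 + v > 0" using tv by auto
      have l: "logistic_pair Y y = t / ((1 + t) * (t + v))"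
        by (simp add: logistic_pair_altdef t_def v_def)
      have f: "f 0 y = y / (t - 1) * (t / (1 + t))" "f Y y = y / (t - 1) * (t / (t + v))"
        using tv p by (simp_all add: f_def exp_diff exp_minus t_def v_def field_simps)
      show "(2 * f 0 y + (exp Y - 1) * (logistic_pair Y y * y)) / (1 + exp Y) = f Y y"
      proof (cases "t = 1")
        case True
        then have "y = 0" by (simp add: t_def)
        then show ?thesis by (simp add: f_def)
      next
        case False
        then have t1: "t - 1 \<noteq> 0" by simp
        have "2 * f 0 y + (v - 1) * (logistic_pair Y y * y)
            = y * t / ((t - 1) * (1 + t) * (t + v)) * (2 * (t + v) + (v - 1) * (t - 1))"
          unfolding f l using t1 p by (simp add: divide_simps) (simp add: algebra_simps)
        also have "2 * (t + v) + (v - 1) * (t - 1) = (1 + v) * (1 + t)" by (simp add: algebra_simps)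
        also have "y * t / ((t - 1) * (1 + t) * (t + v)) * ((1 + v) * (1 + t)) = f Y y * (1 + v)"
          unfolding f using p t1 by (simp add: divide_simps)
        finally show ?thesis using p by (simp add: v_def)
      qed
    qed
    also have "(exp Y - 1) * (Y ^ 2 / 2 / (exp Y - 1)) = Y ^ 2 / 2"
      using D0 by (metis nonzero_mult_div_cancel_left times_divide_eq_right)
    also have "(2 * (pi ^ 2 / 4) + Y ^ 2 / 2) / (1 + exp Y) = (Y ^ 2 + pi ^ 2) / (2 * (1 + exp Y))"
      by (simp add: add_divide_distrib)
    finally have "has_bochner_integral lborel (f Y) ((Y ^ 2 + pi ^ 2) / (2 * (1 + exp Y)))" .
    then show ?thesis
      unfolding conv using f0 by (subst nn_integral_eq_integral) (auto simp: has_bochner_integral_iff)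
  qed
qed

text \<open>Attaching the four logistic factors as \<open>log_ker\<close>, \<open>logistic\<close>,
  \<open>logistic\<close> makes the inner convolution elementary, and the outer one needs only the
  moments of order 0 and 2.\<close>

lemma log_ker3_eq:
  assumes "Y \<noteq> 0"
  shows "log_ker3 Y = ennreal ((Y ^ 3 / 6 + 2 * pi ^ 2 / 3 * Y) / (exp Y - 1))"
proof -
  have "log_ker3 = conv log_ker (conv logistic logistic)" by (simp add: log_ker3_def log_ker_def)
  also have "\<dots> = conv (conv log_ker logistic) logistic" by (simp add: conv_assoc)
  finally have "log_ker3 Y = conv (conv log_ker logistic) logistic Y" by (simp only:)
  also have "\<dots> = (\<integral>\<^sup>+y. conv log_ker logistic y * logistic (Y - y) \<partial>lborel)"
    by (rule conv_def)
  also have "\<dots> = (\<integral>\<^sup>+y. ennreal (1/2 * (logistic_pair Y y * y ^ 2) + pi ^ 2 / 2 * logistic_pair Y y) \<partial>lborel)"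
  proof (rule nn_integral_cong)
    fix y :: real
    have p: "1 + exp y > 0" "1 + exp (Y - y) > 0" by (auto intro: add_pos_pos)
    have "conv log_ker logistic y * logistic (Y - y)
        = ennreal ((y ^ 2 + pi ^ 2) / (2 * (1 + exp y)) * (1 / (1 + exp (Y - y))))"
      unfolding conv_log_ker_logistic logistic_def using p by (subst ennreal_mult) auto
    also have "(y ^ 2 + pi ^ 2) / (2 * (1 + exp y)) * (1 / (1 + exp (Y - y)))
        = (y ^ 2 + pi ^ 2) / 2 * logistic_pair Y y"
      by (simp add: logistic_pair_def)
    finally show "conv log_ker logistic y * logistic (Y - y)
      = ennreal (1/2 * (logistic_pair Y y * y ^ 2) + pi ^ 2 / 2 * logistic_pair Y y)"
      by (simp add: field_simps)
  qed
  also have "\<dots> = ennreal (\<integral>y. 1/2 * (logistic_pair Y y * y ^ 2) + pi ^ 2 / 2 * logistic_pair Y y \<partial>lborel)"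
    using integrable_logistic_pair_power[of Y 2] integrable_logistic_pair_power[of Y 0] logistic_pair_nonneg[of Y]
    by (intro nn_integral_eq_integral) auto
  also have "(\<integral>y. 1/2 * (logistic_pair Y y * y ^ 2) + pi ^ 2 / 2 * logistic_pair Y y \<partial>lborel)
     = 1/2 * ((Y ^ 3 + pi ^ 2 * Y) / 3 / (exp Y - 1)) + pi ^ 2 / 2 * (Y / (exp Y - 1))"
    using integrable_logistic_pair_power[of Y 2] integrable_logistic_pair_power[of Y 0]
    by (subst Bochner_Integration.integral_add) (auto simp: logistic_pair_moments[OF assms])
  also have "1/2 * ((Y ^ 3 + pi ^ 2 * Y) / 3 / D) + pi ^ 2 / 2 * (Y / D) = (Y ^ 3 / 6 + 2 * pi ^ 2 / 3 * Y) / D"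
    for D by (cases "D = 0") (simp_all add: field_simps)
  finally show ?thesis .
qed

subsection \<open>Periods of order two\<close>

text \<open>
  \<open>period_pos a\<close> is the density with Laplace transform \<open>\<Gamma>(s+a) \<Gamma>(s+1-a) / \<Gamma>(s+1)\<^sup>2\<close>, supported on
  \<open>(0, \<infinity>)\<close>, and \<open>period a\<close> is its analytic continuation to the whole line.
\<close>

definition period_pos :: "real \<Rightarrow> real \<Rightarrow> ennreal" where
  "period_pos a y = ennreal (sin (pi * a) / pi) * conv (beta_ker a) (beta_ker (1 - a)) y"

definition period :: "real \<Rightarrow> real \<Rightarrow> ennreal" where
  "period a y = ennreal ((sin (pi * a) / pi) ^ 2) * conv (period_pos a) log_ker y"

lemma measurable_period [measurable]:
  "period_pos a \<in> borel_measurable borel" "period a \<in> borel_measurable borel"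
  unfolding period_pos_def period_def by measurable

lemma sin_pi_pos: "0 < a \<Longrightarrow> a < 1 \<Longrightarrow> sin (pi * a) > 0"
  by (intro sin_gt_zero) auto

text \<open>After regrouping, each Beta kernel meets one logistic factor and both Stieltjes
  transforms are elementary. What remains is an Euler integral for a hypergeometric function of
  order two, in which Y = 0 is no longer special.\<close>

lemma period_eq_integral:
  assumes a: "0 < a" "a < 1"
  shows "period a Y = ennreal (sin (pi * a) / pi) *
     (\<integral>\<^sup>+y. ennreal ((1 + exp y) powr (- a) * (1 + exp (Y - y)) powr (a - 1)) \<partial>lborel)"
proof -
  define s where "s = sin (pi * a)"
  have s: "s > 0" using sin_pi_pos[OF a] by (simp add: s_def)
  have s': "sin (pi * (1 - a)) = s" by (simp add: s_def right_diff_distrib sin_diff)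
  have "conv (period_pos a) log_ker Y
      = ennreal (s / pi) * conv (conv (beta_ker a) (beta_ker (1 - a))) (conv logistic logistic) Y"
    unfolding period_pos_def log_ker_def s_def by (rule conv_cmult_left) measurable
  also have "conv (conv (beta_ker a) (beta_ker (1 - a))) (conv logistic logistic)
      = conv (conv (beta_ker a) logistic) (conv (beta_ker (1 - a)) logistic)"
    by (rule conv_conv_swap) measurable
  also have "conv (conv (beta_ker a) logistic) (conv (beta_ker (1 - a)) logistic) Y
      = (\<integral>\<^sup>+y. ennreal ((pi / s) ^ 2) * ennreal ((1 + exp y) powr (- a) * (1 + exp (Y - y)) powr (a - 1)) \<partial>lborel)"
    unfolding conv_def[of "conv _ _"] using a s s'
    by (intro nn_integral_cong)
       (simp add: conv_beta_logistic s_def[symmetric] ennreal_mult[symmetric] power2_eq_square mult_ac)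
  also have "\<dots> = ennreal ((pi / s) ^ 2) * (\<integral>\<^sup>+y. ennreal ((1 + exp y) powr (- a) * (1 + exp (Y - y)) powr (a - 1)) \<partial>lborel)"
    by (rule nn_integral_cmult) measurable
  finally have "period a Y = ennreal ((s / pi) ^ 2) * ennreal (s / pi) * ennreal ((pi / s) ^ 2) *
      (\<integral>\<^sup>+y. ennreal ((1 + exp y) powr (- a) * (1 + exp (Y - y)) powr (a - 1)) \<partial>lborel)"
    by (simp add: period_def s_def mult.assoc)
  also have "ennreal ((s / pi) ^ 2) * ennreal (s / pi) * ennreal ((pi / s) ^ 2) = ennreal (s / pi)"
    using s by (simp add: ennreal_mult[symmetric] power2_eq_square field_simps)
  finally show ?thesis by (simp add: s_def)
qed

text \<open>The reproducing property: convolution with \<open>log_ker\<close>, suitably scaled,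
  returns the density on its own support. For x = e^Y > 1 the substitution v = ln ((e^y + x) / (e^y
  + 1)) carries the Euler integral over the line to the convolution of the two Beta kernels over (0,
  Y).\<close>

lemma period_eq_period_pos:
  assumes a: "0 < a" "a < 1" and Y: "Y > 0"
  shows "period a Y = period_pos a Y"
proof -
  define x where "x = exp Y"
  have x: "x > 1" using Y by (simp add: x_def)
  let ?f = "\<lambda>y. (1 + exp y) powr (- a) * (1 + exp (Y - y)) powr (a - 1)"
  let ?g = "\<lambda>v. ln ((x - exp v) / (exp v - 1))"
  let ?g' = "\<lambda>v. - (exp v * (x - 1)) / ((x - exp v) * (exp v - 1))"
  have rng: "0 < v \<and> v < Y \<longleftrightarrow> 1 < exp v \<and> exp v < x" for v by (simp add: x_def)
  have "(\<integral>\<^sup>+y. ennreal (?f y) \<partial>lborel) = (\<integral>\<^sup>+y. ennreal (indicator UNIV y * ?f y) \<partial>lborel)" by simp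
  also have "\<dots> = (\<integral>\<^sup>+v. ennreal (indicator {0<..<Y} v * (\<bar>?g' v\<bar> * ?f (?g v))) \<partial>lborel)"
  proof (rule nn_integral_substitution_bij[where h = "\<lambda>y. ln ((exp y + x) / (exp y + 1))" and g="?g"])
    fix v assume "v \<in> {0<..<Y}"
    then have v: "1 < exp v" "exp v < x" using rng[of v] by auto
    show "(?g has_field_derivative ?g' v) (at v within {0<..<Y})"
      using v by (auto intro!: derivative_eq_intros simp: divide_simps) (simp add: algebra_simps)
    have "exp (?g v) = (x - exp v) / (exp v - 1)" using v by simp
    moreover have "(x - exp v) / (exp v - 1) + x = exp v * (x - 1) / (exp v - 1)"
      "(x - exp v) / (exp v - 1) + 1 = (x - 1) / (exp v - 1)"
      using v by (simp_all add: field_simps)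
    ultimately show "ln ((exp (?g v) + x) / (exp (?g v) + 1)) = v" using v x by simp
  next
    fix y :: real
    define E where "E = exp y"
    have E: "E > 0" by (simp add: E_def)
    have "1 < (E + x) / (E + 1)" "(E + x) / (E + 1) < x"
      using E x by (simp_all add: divide_simps) (simp add: algebra_simps)
    moreover from this have e: "exp (ln ((E + x) / (E + 1))) = (E + x) / (E + 1)" by simp
    ultimately show "ln ((exp y + x) / (exp y + 1)) \<in> {0<..<Y}"
      using rng[of "ln ((E + x) / (E + 1))"] by (simp add: E_def)
    have "x - (E + x) / (E + 1) = E * (x - 1) / (E + 1)" "(E + x) / (E + 1) - 1 = (x - 1) / (E + 1)"
      using E by (simp_all add: field_simps)
    then show "ln ((x - exp (ln ((exp y + x) / (exp y + 1)))) / (exp (ln ((exp y + x) / (exp y + 1))) - 1)) = y"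
      using e E x add_pos_pos[OF E, of 1] by (simp add: E_def)
  qed auto
  also have "\<dots> = (\<integral>\<^sup>+v. beta_ker (1 - a) v * beta_ker a (Y - v) \<partial>lborel)"
  proof (rule nn_integral_cong)
    fix v :: real
    show "ennreal (indicator {0<..<Y} v * (\<bar>?g' v\<bar> * ?f (?g v))) = beta_ker (1 - a) v * beta_ker a (Y - v)"
    proof (cases "v \<in> {0<..<Y}")
      case True
      define w where "w = exp v"
      have w: "1 < w" "w < x" using True rng[of v] by (auto simp: w_def)
      have eg: "exp (?g v) = (x - w) / (w - 1)" using w by (simp add: w_def)
      have 1: "1 + exp (?g v) = (x - 1) / (w - 1)" unfolding eg using w by (simp add: field_simps)
      have 2: "1 + exp (Y - ?g v) = w * (x - 1) / (x - w)"
        unfolding exp_diff eg x_def[symmetric] using w by (simp add: field_simps)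
      have 3: "\<bar>?g' v\<bar> = w * (x - 1) / ((x - w) * (w - 1))"
        using w x by (simp add: w_def abs_mult)
      have 4: "((x - 1) / (w - 1)) powr (- a) = (x - 1) powr (- a) * (w - 1) powr a"
        using w by (simp add: powr_divide powr_minus divide_simps)
      have 5: "(w * (x - 1) / (x - w)) powr (a - 1)
          = (w powr (a - 1) * (x - 1) powr (a - 1)) * (x - w) powr (1 - a)"
        using w powr_minus[of "x - w" "1 - a"] by (simp add: powr_divide powr_mult divide_simps mult.commute)
      have 6: "(x - 1) powr (- a) * (x - 1) powr (a - 1) = 1 / (x - 1)"
        using w x powr_add[of "x - 1" "- a" "a - 1"] powr_minus_divide[of "x - 1" 1] by simp
      have 7: "(w - 1) powr a / (w - 1) = (w - 1) powr (a - 1)" "(x - w) powr (1 - a) / (x - w) = (x - w) powr (- a)"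
        using w by (simp_all add: powr_diff powr_minus_divide)
      have 8: "exp (Y - v) - 1 = (x - w) / w" unfolding exp_diff using w by (simp add: x_def w_def field_simps)
      have 9: "((x - w) / w) powr (- a) = (x - w) powr (- a) * w powr a"
        using w by (simp add: powr_divide powr_minus divide_simps)
      have 10: "w * w powr (a - 1) = w powr a" using w by (simp add: powr_diff)
      have "\<bar>?g' v\<bar> * ?f (?g v) = (w * w powr (a - 1)) * ((x - 1) * ((x - 1) powr (- a) * (x - 1) powr (a - 1))) *
          ((w - 1) powr a / (w - 1)) * ((x - w) powr (1 - a) / (x - w))"
        unfolding 1 2 3 4 5 by (simp add: mult_ac)
      also have "\<dots> = (w - 1) powr (- (1 - a)) * (exp (Y - v) - 1) powr (- a)"
        unfolding 6 7 8 9 10 using w by simp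
      finally show ?thesis
        using True by (simp add: beta_ker_def ennreal_mult[symmetric] w_def)
    next
      case False
      then show ?thesis by (auto simp: beta_ker_def)
    qed
  qed
  also have "\<dots> = conv (beta_ker a) (beta_ker (1 - a)) Y"
    by (simp add: conv_commute[of "beta_ker a"] conv_def)
  finally show ?thesis
    unfolding period_eq_integral[OF a] period_pos_def by simp
qed

subsection \<open>Constants of the fourteen operators\<close>

lemma sum_over_residues:
  fixes g :: "nat \<Rightarrow> real"
  assumes "m > 0"
  shows "(\<Sum>j=1..m. \<Sum>n<N. g (j + m * n)) = (\<Sum>k<m * N. g (Suc k))"
proof -
  have "(\<Sum>j=1..m. \<Sum>n<N. g (j + m * n)) = (\<Sum>n<N. \<Sum>j=1..m. g (j + m * n))" by (rule sum.swap)
  also have "\<dots> = (\<Sum>n<N. sum (\<lambda>k. g (Suc k)) {n * m..<n * m + m})"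
  proof (rule sum.cong)
    fix n
    show "(\<Sum>j=1..m. g (j + m * n)) = sum (\<lambda>k. g (Suc k)) {n * m..<n * m + m}"
      by (rule sum.reindex_bij_witness[of _ "\<lambda>k. Suc k - m * n" "\<lambda>j. j - 1 + m * n"]) (auto simp: mult.commute)
  qed simp
  also have "\<dots> = (\<Sum>k<N * m. g (Suc k))" by (rule sum.nat_group)
  finally show ?thesis by (simp add: mult.commute)
qed

lemma filterlim_mult_const_nat: "m > 0 \<Longrightarrow> filterlim (\<lambda>N. m * N) at_top (sequentially :: nat filter)"
  by (rule filterlim_subseq) (auto simp: strict_mono_def)

text \<open>Gauss's multiplication formula at 1, read off from the limit definition: the numbers j /
  m + n with j = 1..m and n < N are exactly k / m with k = 1..m N, so the inner sums add up to m
  times a harmonic number. The term ln m is the gap between ln (m N) and ln N.\<close>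

lemma sum_Digamma_div:
  assumes "m > 0"
  shows "(\<Sum>j=1..m. Digamma (real j / real m)) = - real m * euler_mascheroni - real m * ln (real m)"
proof (rule LIMSEQ_unique)
  show "(\<lambda>N. \<Sum>j=1..m. ln (real N) - (\<Sum>n<N. inverse (real j / real m + real n)))
     \<longlonglongrightarrow> (\<Sum>j=1..m. Digamma (real j / real m))"
    using Digamma_LIMSEQ[of "real j / real m" for j] assms by (intro tendsto_sum) simp
  have "(\<lambda>N. - real m * (harm (m * N) - ln (real (m * N))) - real m * ln (real m))
     \<longlonglongrightarrow> - real m * euler_mascheroni - real m * ln (real m)"
    using filterlim_compose[OF euler_mascheroni_LIMSEQ filterlim_mult_const_nat[OF assms]]
    by (intro tendsto_intros) simp
  moreover have "\<forall>\<^sub>F N in sequentially. - real m * (harm (m * N) - ln (real (m * N))) - real m * ln (real m)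
      = (\<Sum>j=1..m. ln (real N) - (\<Sum>n<N. inverse (real j / real m + real n)))"
    using eventually_gt_at_top[of 0]
  proof eventually_elim
    case (elim N)
    have "inverse (real j / real m + real n) = real m * inverse (real (j + m * n))" for j n
      using assms by (simp add: field_simps)
    then have "(\<Sum>j=1..m. \<Sum>n<N. inverse (real j / real m + real n)) = real m * (\<Sum>j=1..m. \<Sum>n<N. inverse (real (j + m * n)))"
      by (simp add: sum_distrib_left)
    also have "(\<Sum>j=1..m. \<Sum>n<N. inverse (real (j + m * n))) = harm (m * N)"
      using assms sum_over_residues[where g="\<lambda>k. inverse (real k)" and m=m and N=N]
      by (simp add: harm_altdef)
    finally have "(\<Sum>j=1..m. \<Sum>n<N. inverse (real j / real m + real n)) = real m * harm (m * N)" .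
    then show ?case
      using elim assms by (simp add: sum_subtractf ln_mult algebra_simps)
  qed
  ultimately show "(\<lambda>N. \<Sum>j=1..m. ln (real N) - (\<Sum>n<N. inverse (real j / real m + real n)))
     \<longlonglongrightarrow> - real m * euler_mascheroni - real m * ln (real m)"
    by (rule Lim_transform_eventually)
qed

text \<open>The same regrouping of residues as for Digamma; now the series converges and every
  summand scales by m^3.\<close>

lemma sum_Polygamma_2_div:
  assumes "m > 0"
  shows "(\<Sum>j=1..m. Polygamma 2 (real j / real m)) = real m ^ 3 * Polygamma 2 1"
proof -
  have P: "(\<lambda>N. \<Sum>n<N. inverse ((z + real n) ^ 3)) \<longlonglongrightarrow> - Polygamma 2 z / 2" if "z > 0" for z :: real
    using Polygamma_LIMSEQ[of z 2] that by (simp add: sums_def numeral_3_eq_3 fact_numeral)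
  have "(\<lambda>N. \<Sum>j=1..m. \<Sum>n<N. inverse ((real j / real m + real n) ^ 3))
     \<longlonglongrightarrow> (\<Sum>j=1..m. - Polygamma 2 (real j / real m) / 2)"
    using assms by (intro tendsto_sum P) auto
  moreover have "(\<Sum>j=1..m. \<Sum>n<N. inverse ((real j / real m + real n) ^ 3))
      = real m ^ 3 * (\<Sum>n<m * N. inverse ((1 + real n) ^ 3))" for N
  proof -
    have "inverse ((real j / real m + real n) ^ 3) = real m ^ 3 * inverse (real (j + m * n) ^ 3)" for j n
    proof -
      have "real j / real m + real n = real (j + m * n) / real m" using assms by (simp add: field_simps)
      then show ?thesis by (simp only: power_divide inverse_divide) (simp add: divide_inverse)
    qed
    then have "(\<Sum>j=1..m. \<Sum>n<N. inverse ((real j / real m + real n) ^ 3))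
        = real m ^ 3 * (\<Sum>j=1..m. \<Sum>n<N. inverse (real (j + m * n) ^ 3))"
      by (simp add: sum_distrib_left)
    also have "(\<Sum>j=1..m. \<Sum>n<N. inverse (real (j + m * n) ^ 3)) = (\<Sum>n<m * N. inverse ((1 + real n) ^ 3))"
      using sum_over_residues[OF assms, where g="\<lambda>k. inverse (real k ^ 3)" and N=N] by simp
    finally show ?thesis .
  qed
  moreover have "(\<lambda>N. real m ^ 3 * (\<Sum>n<m * N. inverse ((1 + real n) ^ 3))) \<longlonglongrightarrow> real m ^ 3 * (- Polygamma 2 1 / 2)"
    using filterlim_compose[OF P[of 1] filterlim_mult_const_nat[OF assms]]
    by (intro tendsto_mult_left) simp
  ultimately have "(\<Sum>j=1..m. - Polygamma 2 (real j / real m) / 2) = real m ^ 3 * (- Polygamma 2 1 / 2)"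
    using LIMSEQ_unique by auto
  then show ?thesis by (simp add: sum_divide_distrib[symmetric] sum_negf)
qed

lemma Polygamma_2_1: "Polygamma 2 (1::real) = - 2 * zeta_nat 3"
proof -
  have "(\<lambda>k. inverse ((1 + real k) ^ 3)) sums (- Polygamma 2 1 / 2)"
    using Polygamma_LIMSEQ[of "1::real" 2] by (simp add: numeral_3_eq_3 fact_numeral)
  then show ?thesis by (simp add: zeta_nat_def sums_iff inverse_eq_divide)
qed

text \<open>Moebius inversion over the divisors of the denominator, leaving sums over reduced
  fractions. In every row of the table A, 1 - A, B, 1 - B form, with repetition, full sets of
  reduced fractions of one denominator, so no single value of f is ever needed beyond these
  sums.\<close>

lemma sum_primitive_fractions:
  fixes f :: "real \<Rightarrow> real"
  assumes S: "\<And>m::nat. m > 0 \<Longrightarrow> (\<Sum>j=1..m. f (real j / real m)) = S m"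
  shows "f (1/2) = S 2 - S 1"
    and "f (1/3) + f (2/3) = S 3 - S 1"
    and "f (1/4) + f (3/4) = S 4 - S 2"
    and "f (1/6) + f (5/6) = S 6 - S 3 - S 2 + S 1"
    and "f (1/5) + f (4/5) + (f (2/5) + f (3/5)) = S 5 - S 1"
    and "f (1/8) + f (7/8) + (f (3/8) + f (5/8)) = S 8 - S 4"
    and "f (1/10) + f (9/10) + (f (3/10) + f (7/10)) = S 10 - S 5 - S 2 + S 1"
    and "f (1/12) + f (11/12) + (f (5/12) + f (7/12)) = S 12 - S 6 - S 4 + S 2"
proof -
  have s: "{1..2::nat} = {1,2}" "{1..3::nat} = {1,2,3}" "{1..4::nat} = {1,2,3,4}" "{1..5::nat} = {1,2,3,4,5}"
    "{1..6::nat} = {1,2,3,4,5,6}" "{1..8::nat} = {1,2,3,4,5,6,7,8}" "{1..10::nat} = {1,2,3,4,5,6,7,8,9,10}"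
    "{1..12::nat} = {1,2,3,4,5,6,7,8,9,10,11,12}"
    by (auto; presburger)+
  have 1: "f 1 = S 1" using S[of 1] by simp
  have 2: "f (1/2) + f 1 = S 2" using S[of 2, unfolded s] by simp
  have 3: "f (1/3) + f (2/3) + f 1 = S 3" using S[of 3, unfolded s] by simp
  have 4: "f (1/4) + f (1/2) + f (3/4) + f 1 = S 4" using S[of 4, unfolded s] by simp
  have 5: "f (1/5) + f (2/5) + f (3/5) + f (4/5) + f 1 = S 5" using S[of 5, unfolded s] by simp
  have 6: "f (1/6) + f (1/3) + f (1/2) + f (2/3) + f (5/6) + f 1 = S 6" using S[of 6, unfolded s] by simp
  have 8: "f (1/8) + f (1/4) + f (3/8) + f (1/2) + f (5/8) + f (3/4) + f (7/8) + f 1 = S 8"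
    using S[of 8, unfolded s] by simp
  have 10: "f (1/10) + f (1/5) + f (3/10) + f (2/5) + f (1/2) + f (3/5) + f (7/10) + f (4/5) + f (9/10) + f 1 = S 10"
    using S[of 10, unfolded s] by simp
  have 12: "f (1/12) + f (1/6) + f (1/4) + f (1/3) + f (5/12) + f (1/2) + f (7/12) + f (2/3) + f (3/4) + f (5/6) + f (11/12) + f 1 = S 12"
    using S[of 12, unfolded s] by simp
  show "f (1/2) = S 2 - S 1" "f (1/3) + f (2/3) = S 3 - S 1" "f (1/4) + f (3/4) = S 4 - S 2"
    "f (1/6) + f (5/6) = S 6 - S 3 - S 2 + S 1" "f (1/5) + f (4/5) + (f (2/5) + f (3/5)) = S 5 - S 1"
    "f (1/8) + f (7/8) + (f (3/8) + f (5/8)) = S 8 - S 4"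
    "f (1/10) + f (9/10) + (f (3/10) + f (7/10)) = S 10 - S 5 - S 2 + S 1"
    "f (1/12) + f (11/12) + (f (5/12) + f (7/12)) = S 12 - S 6 - S 4 + S 2"
    using 1 2 3 4 5 6 8 10 12 by linarith+
qed

text \<open>Only the primes 2, 3 and 5 occur; written in their logarithms, the Digamma identity of
  each row is a linear check.\<close>

lemma ln_prime_powers:
  "ln (3125::real) = 5 * ln 5" "ln (800000::real) = 8 * ln 2 + 5 * ln 5" "ln (256::real) = 8 * ln 2"
  "ln (729::real) = 6 * ln 3" "ln (432::real) = 4 * ln 2 + 3 * ln 3" "ln (1024::real) = 10 * ln 2"
  "ln (65536::real) = 16 * ln 2" "ln (11664::real) = 4 * ln 2 + 6 * ln 3"
  "ln (2985984::real) = 12 * ln 2 + 6 * ln 3" "ln (4096::real) = 12 * ln 2"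
  "ln (1728::real) = 6 * ln 2 + 3 * ln 3" "ln (27648::real) = 10 * ln 2 + 3 * ln 3"
  "ln (186624::real) = 8 * ln 2 + 6 * ln 3" "ln (6912::real) = 8 * ln 2 + 3 * ln 3"
  "ln (4::real) = 2 * ln 2" "ln (6::real) = ln 2 + ln 3" "ln (8::real) = 3 * ln 2"
  "ln (10::real) = ln 2 + ln 5" "ln (12::real) = 2 * ln 2 + ln 3"
proof -
  have *: "ln (2 ^ a * 3 ^ b * 5 ^ c :: real) = real a * ln 2 + real b * ln 3 + real c * ln 5" for a b c
    by (simp add: ln_mult ln_realpow)
  show "ln (3125::real) = 5 * ln 5" using *[of 0 0 5] by simp
  show "ln (800000::real) = 8 * ln 2 + 5 * ln 5" using *[of 8 0 5] by simp
  show "ln (256::real) = 8 * ln 2" using *[of 8 0 0] by simp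
  show "ln (729::real) = 6 * ln 3" using *[of 0 6 0] by simp
  show "ln (432::real) = 4 * ln 2 + 3 * ln 3" using *[of 4 3 0] by simp
  show "ln (1024::real) = 10 * ln 2" using *[of 10 0 0] by simp
  show "ln (65536::real) = 16 * ln 2" using *[of 16 0 0] by simp
  show "ln (11664::real) = 4 * ln 2 + 6 * ln 3" using *[of 4 6 0] by simp
  show "ln (2985984::real) = 12 * ln 2 + 6 * ln 3" using *[of 12 6 0] by simp
  show "ln (4096::real) = 12 * ln 2" using *[of 12 0 0] by simp
  show "ln (1728::real) = 6 * ln 2 + 3 * ln 3" using *[of 6 3 0] by simp
  show "ln (27648::real) = 10 * ln 2 + 3 * ln 3" using *[of 10 3 0] by simp
  show "ln (186624::real) = 8 * ln 2 + 6 * ln 3" using *[of 8 6 0] by simp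
  show "ln (6912::real) = 8 * ln 2 + 3 * ln 3" using *[of 8 3 0] by simp
  show "ln (4::real) = 2 * ln 2" using *[of 2 0 0] by simp
  show "ln (6::real) = ln 2 + ln 3" using *[of 1 1 0] by simp
  show "ln (8::real) = 3 * ln 2" using *[of 3 0 0] by simp
  show "ln (10::real) = ln 2 + ln 5" using *[of 1 0 1] by simp
  show "ln (12::real) = 2 * ln 2 + ln 3" using *[of 2 1 0] by simp
qed

lemma cy_table_bounds:
  assumes "(A, B, C, H3, c2H, c3) \<in> cy_table"
  shows "0 < A" "A < 1" "0 < B" "B < 1" "0 < C" "0 < H3"
  using assms unfolding cy_table_def by auto

text \<open>This identity explains the constants C: it says that the logarithmic derivative of
  \<open>gamma_fun\<close> vanishes at 0, so the change from the series of moments to the Frobenius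
  basis has no term linear in epsilon.\<close>

lemma cy_table_Digamma:
  assumes "(A, B, C, H3, c2H, c3) \<in> cy_table"
  shows "ln (real C) + Digamma A + Digamma (1 - A) + Digamma B + Digamma (1 - B) - 4 * Digamma 1 = 0"
proof -
  note f = sum_primitive_fractions[OF sum_Digamma_div, simplified, unfolded ln_prime_powers]
  show ?thesis
    using assms unfolding cy_table_def
    by (elim insertE emptyE Pair_inject; hypsubst) (use f in \<open>simp_all add: ln_prime_powers\<close>)
qed

text \<open>The left-hand side is six times the cubic Taylor coefficient at 0 of the logarithm of
  \<open>gamma_fun\<close>. It is a rational multiple of zeta(3), and this is where c_3
  enters.\<close>

lemma cy_table_Polygamma_2:
  assumes "(A, B, C, H3, c2H, c3) \<in> cy_table"
  shows "Polygamma 2 A + Polygamma 2 (1 - A) + Polygamma 2 B + Polygamma 2 (1 - B) - 4 * Polygamma 2 1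
    = 6 * (of_int c3 / real H3 * zeta_nat 3)"
proof -
  note f = sum_primitive_fractions[OF sum_Polygamma_2_div, simplified]
  show ?thesis
    using assms unfolding cy_table_def Polygamma_2_1
    by (elim insertE emptyE Pair_inject; hypsubst) (use f[unfolded Polygamma_2_1] in \<open>simp_all\<close>)
qed

section \<open>Trigonometric constants of the table\<close>

text \<open>For 5 x = 2 pi one has cos (3 x) = cos (2 x), a cubic equation for cos x; removing the
  factor cos x - 1 leaves this quadratic one.\<close>

lemma cos_2_pi_fifth: "4 * cos (2 * pi / 5) ^ 2 + 2 * cos (2 * pi / 5) - (1::real) = 0"
proof -
  define x where "x = 2 * pi / 5"
  have "cos (3 * x) = cos (2 * pi - 2 * x)" by (simp add: x_def field_simps)
  then have "cos (3 * x) = cos (2 * x)" by (simp add: cos_diff)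
  then have "4 * cos x ^ 3 - 3 * cos x = 2 * cos x ^ 2 - 1"
    by (simp add: cos_treble_cos cos_double_cos)
  then have "(cos x - 1) * (4 * cos x ^ 2 + 2 * cos x - 1) = 0"
    by (simp add: algebra_simps power2_eq_square power3_eq_cube)
  moreover have "cos x \<noteq> 1"
  proof
    assume "cos x = 1"
    then have "sin x = 0" using sin_cos_squared_add[of x] by simp
    moreover have "sin x > 0" unfolding x_def by (intro sin_gt_zero) auto
    ultimately show False by simp
  qed
  ultimately show ?thesis by (simp add: x_def)
qed

text \<open>For the denominators 5, 8, 10 and 12 the single squares are irrational, but the two
  squares in a row are conjugate, so their sum and product are rational. For 8 and 12 the two angles
  are complementary, so one sine is the cosine of the other angle.\<close>

lemma sin_squared_pairs:
  "sin (pi * (1/5)) ^ 2 + sin (pi * (2/5)) ^ 2 = (5/4::real)"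
  "sin (pi * (1/5)) ^ 2 * sin (pi * (2/5)) ^ 2 = (5/16::real)"
  "sin (pi * (1/10)) ^ 2 + sin (pi * (3/10)) ^ 2 = (3/4::real)"
  "sin (pi * (1/10)) ^ 2 * sin (pi * (3/10)) ^ 2 = (1/16::real)"
  "sin (pi * (1/8)) ^ 2 + sin (pi * (3/8)) ^ 2 = (1::real)"
  "sin (pi * (1/8)) ^ 2 * sin (pi * (3/8)) ^ 2 = (1/8::real)"
  "sin (pi * (1/12)) ^ 2 + sin (pi * (5/12)) ^ 2 = (1::real)"
  "sin (pi * (1/12)) ^ 2 * sin (pi * (5/12)) ^ 2 = (1/16::real)"
proof -
  define c where "c = cos (2 * pi / 5)"
  have c: "c ^ 2 = (1 - 2 * c) / 4" using cos_2_pi_fifth by (simp add: c_def)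
  have s5: "sin (pi * (1/5)) ^ 2 = (1 - c) / 2" "sin (pi * (2/5)) ^ 2 = 1 - c ^ 2"
    using cos_double_sin[of "pi * (1/5)"] sin_cos_squared_add[of "pi * (2/5)"]
    by (simp_all add: c_def mult.commute)
  have s1: "sin (pi * (1/10)) = c" and s3: "sin (pi * (3/10)) = 1 - 2 * c ^ 2"
  proof -
    show "sin (pi * (1/10)) = c"
      unfolding c_def by (subst cos_sin_eq) (simp add: field_simps)
    have "sin (pi * (3/10)) = cos (pi - 2 * (2 * pi / 5))"
      by (subst cos_sin_eq) (simp add: field_simps)
    also have "\<dots> = 1 - 2 * c ^ 2" by (simp only: cos_pi_minus cos_double_cos c_def)
    finally show "sin (pi * (3/10)) = 1 - 2 * c ^ 2" .
  qed
  have q: "(1 - 2 * c ^ 2) ^ 2 = (1 + c) / 2"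
  proof -
    have h: "1 - 2 * c ^ 2 = (1 + 2 * c) / 2" using c by (simp add: field_simps)
    have "(1 - 2 * c ^ 2) ^ 2 = ((1 + 2 * c) / 2) ^ 2" by (simp only: h)
    also have "\<dots> = (1 + 4 * c + 4 * c ^ 2) / 4" by (simp add: power2_eq_square field_simps)
    also have "\<dots> = (1 + c) / 2" using c by (simp add: field_simps)
    finally show ?thesis .
  qed
  have s10: "sin (pi * (1/10)) ^ 2 = (1 - 2 * c) / 4" "sin (pi * (3/10)) ^ 2 = (1 + c) / 2"
    unfolding s1 s3 q by (rule c) (rule refl)
  have comp: "sin x ^ 2 + sin y ^ 2 = 1 \<and> sin x ^ 2 * sin y ^ 2 = sin (2 * x) ^ 2 / 4" if "x + y = pi / 2" for x y :: real
  proof -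
    have "y = pi / 2 - x" using that by linarith
    then have "sin y = cos x" by (simp add: cos_sin_eq)
    then show ?thesis by (simp add: sin_double power_mult_distrib)
  qed
  show "sin (pi * (1/8)) ^ 2 + sin (pi * (3/8)) ^ 2 = (1::real)" "sin (pi * (1/8)) ^ 2 * sin (pi * (3/8)) ^ 2 = (1/8::real)"
    using comp[of "pi * (1/8)" "pi * (3/8)"] sin_45 by (simp_all add: power_divide)
  show "sin (pi * (1/12)) ^ 2 + sin (pi * (5/12)) ^ 2 = (1::real)" "sin (pi * (1/12)) ^ 2 * sin (pi * (5/12)) ^ 2 = (1/16::real)"
    using comp[of "pi * (1/12)" "pi * (5/12)"] sin_30 by (simp_all add: power_divide)
  show "sin (pi * (1/5)) ^ 2 + sin (pi * (2/5)) ^ 2 = (5/4::real)" "sin (pi * (1/5)) ^ 2 * sin (pi * (2/5)) ^ 2 = (5/16::real)"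
  proof -
    show "sin (pi * (1/5)) ^ 2 + sin (pi * (2/5)) ^ 2 = (5/4::real)"
      unfolding s5 c by (simp add: field_simps)
    have "(1 - c) / 2 * (1 - (1 - 2 * c) / 4) = (3 - c - 2 * c ^ 2) / 8"
      by (simp add: power2_eq_square field_simps)
    also have "\<dots> = 5/16" using c by (simp add: field_simps)
    finally show "sin (pi * (1/5)) ^ 2 * sin (pi * (2/5)) ^ 2 = (5/16::real)"
      unfolding s5 c .
  qed
  show "sin (pi * (1/10)) ^ 2 + sin (pi * (3/10)) ^ 2 = (3/4::real)" "sin (pi * (1/10)) ^ 2 * sin (pi * (3/10)) ^ 2 = (1/16::real)"
    unfolding s10 using c by (simp_all add: power2_eq_square field_simps)
qed

lemma sin_squared_values:
  "sin (pi * (1/2)) ^ 2 = (1::real)" "sin (pi * (1/3)) ^ 2 = (3/4::real)"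
  "sin (pi * (1/4)) ^ 2 = (1/2::real)" "sin (pi * (1/6)) ^ 2 = (1/4::real)"
  by (simp_all add: sin_60 sin_45 sin_30 power_divide)

text \<open>Both claims depend only on the sum and the product of the two squared sines. The product
  will give the coefficient of y_3 in \<open>W\<close>, the sum of reciprocals the coefficient of
  y_1.\<close>

lemma cy_table_sin:
  assumes "(A, B, C, H3, c2H, c3) \<in> cy_table"
  shows "16 * (sin (pi * A) ^ 2 * sin (pi * B) ^ 2) = real H3"
    and "3 * (1 / sin (pi * A) ^ 2 + 1 / sin (pi * B) ^ 2) - 2 = real c2H / real H3"
proof -
  define a where "a = sin (pi * A) ^ 2"
  define b where "b = sin (pi * B) ^ 2"
  have ab: "16 * (a * b) = real H3 \<and> 48 * (a + b) = real c2H + 2 * real H3"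
    using assms unfolding cy_table_def a_def b_def
    by (elim insertE emptyE Pair_inject; hypsubst; simp only: sin_squared_values sin_squared_pairs) simp_all
  have H: "real H3 > 0" using cy_table_bounds[OF assms] by simp
  then have nz: "a \<noteq> 0" "b \<noteq> 0" using ab by auto
  have "1 / a + 1 / b = (a + b) / (a * b)" using nz by (simp add: field_simps)
  also have "\<dots> = (48 * (a + b)) / (48 * (a * b))" by (rule mult_divide_mult_cancel_left[symmetric]) simp
  also have "\<dots> = (48 * (a + b)) / (3 * (16 * (a * b)))" by simp
  also have "\<dots> = (real c2H + 2 * real H3) / (3 * real H3)" using ab by simp
  finally have "3 * (1 / a + 1 / b) - 2 = real c2H / real H3" using H by (simp add: field_simps)
  then show "16 * (sin (pi * A) ^ 2 * sin (pi * B) ^ 2) = real H3"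
    "3 * (1 / sin (pi * A) ^ 2 + 1 / sin (pi * B) ^ 2) - 2 = real c2H / real H3"
    using ab by (simp_all add: a_def b_def)
qed

subsection \<open>Logarithmic Stieltjes transforms\<close>

abbreviation slit_plane :: "complex set" where
  "slit_plane \<equiv> - \<real>\<^sub>\<le>\<^sub>0"

lemma open_slit_plane: "open slit_plane"
  by (simp add: open_Compl closed_nonpos_Reals_complex)

lemma exp_in_slit_plane: "\<bar>Im w\<bar> < pi \<Longrightarrow> exp w \<in> slit_plane"
proof -
  assume w: "\<bar>Im w\<bar> < pi"
  show "exp w \<in> slit_plane"
  proof
    assume "exp w \<in> \<real>\<^sub>\<le>\<^sub>0"
    then have *: "cos (Im w) \<le> 0" "sin (Im w) = 0"
      by (auto simp: complex_nonpos_Reals_iff Re_exp Im_exp mult_le_0_iff)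
    then have "Im w = 0"
      using w sin_gt_zero[of "Im w"] sin_gt_zero[of "- Im w"] by (cases "Im w" "0::real" rule: linorder_cases) auto
    then show False using * by simp
  qed
qed

lemma of_real_exp_in_slit_plane: "of_real (exp y) \<in> slit_plane"
  by (simp add: complex_nonpos_Reals_iff not_le)

text \<open>The exponential moment makes all polynomial moments finite and puts s = 0 into the
  interior of the domain of the Laplace transform, where it can be expanded. The values may be
  infinite on a null set, hence the passages through \<open>enn2real\<close> almost
  everywhere.\<close>

definition tempered :: "(real \<Rightarrow> ennreal) \<Rightarrow> bool" where
  "tempered f \<longleftrightarrow> f \<in> borel_measurable borel \<and> (\<forall>y\<le>0. f y = 0) \<and>
     (\<exists>d>0. (\<integral>\<^sup>+y. f y * ennreal (exp (d * y)) \<partial>lborel) < \<infinity>)"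

lemma tempered_measurable [dest]: "tempered f \<Longrightarrow> f \<in> borel_measurable borel"
  by (simp add: tempered_def)

lemma tempered_AE:
  assumes "tempered f"
  shows "AE y in lborel. f y = ennreal (enn2real (f y))"
proof -
  from assms obtain d where d: "d > 0" "(\<integral>\<^sup>+y. f y * ennreal (exp (d * y)) \<partial>lborel) < \<infinity>"
    and [measurable]: "f \<in> borel_measurable borel" unfolding tempered_def by auto
  have "AE y in lborel. f y * ennreal (exp (d * y)) \<noteq> \<infinity>"
    using d(2) by (intro nn_integral_PInf_AE) auto
  then show ?thesis
    by eventually_elim (auto simp: ennreal_mult_eq_top_iff less_top intro!: ennreal_enn2real[symmetric])
qed

lemma tempered_exp_finite:
  assumes "tempered f"
  obtains d where "d > 0" "(\<integral>\<^sup>+y. ennreal (enn2real (f y) * exp (d * \<bar>y\<bar>)) \<partial>lborel) < \<infinity>"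
proof -
  from assms obtain d where d: "d > 0" "(\<integral>\<^sup>+y. f y * ennreal (exp (d * y)) \<partial>lborel) < \<infinity>"
    and f0: "\<And>y. y \<le> 0 \<Longrightarrow> f y = 0" unfolding tempered_def by auto
  have "(\<integral>\<^sup>+y. ennreal (enn2real (f y) * exp (d * \<bar>y\<bar>)) \<partial>lborel)
      = (\<integral>\<^sup>+y. f y * ennreal (exp (d * y)) \<partial>lborel)"
  proof (rule nn_integral_cong_AE)
    show "AE y in lborel. ennreal (enn2real (f y) * exp (d * \<bar>y\<bar>)) = f y * ennreal (exp (d * y))"
      using tempered_AE[OF assms]
    proof eventually_elim
      case (elim y)
      show ?case
      proof (cases "y \<le> 0")
        case False
        have "ennreal (enn2real (f y) * exp (d * \<bar>y\<bar>)) = ennreal (enn2real (f y)) * ennreal (exp (d * y))"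
          using False by (simp add: ennreal_mult)
        then show ?thesis using elim by simp
      qed (simp add: f0)
    qed
  qed
  with d that show thesis by simp
qed

lemma integrable_tempered_poly:
  assumes "tempered f"
  shows "integrable lborel (\<lambda>y. enn2real (f y) * (M + \<bar>y\<bar>) ^ k)"
proof -
  have [measurable]: "f \<in> borel_measurable borel" using assms by auto
  obtain d where d: "d > 0" "(\<integral>\<^sup>+y. ennreal (enn2real (f y) * exp (d * \<bar>y\<bar>)) \<partial>lborel) < \<infinity>"
    using assms by (rule tempered_exp_finite)
  have I: "integrable lborel (\<lambda>y. enn2real (f y) * exp (d * \<bar>y\<bar>))"
    by (rule exp_moment_series(1)[OF _ _ d]) auto
  show ?thesis
  proof (rule Bochner_Integration.integrable_bound)
    show "integrable lborel (\<lambda>y. fact k / d ^ k * exp (d * \<bar>M\<bar>) * (enn2real (f y) * exp (d * \<bar>y\<bar>)))"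
      using I by simp
    show "AE y in lborel. norm (enn2real (f y) * (M + \<bar>y\<bar>) ^ k)
        \<le> norm (fact k / d ^ k * exp (d * \<bar>M\<bar>) * (enn2real (f y) * exp (d * \<bar>y\<bar>)))"
    proof (rule AE_I2)
      fix y :: real
      have "\<bar>M + \<bar>y\<bar>\<bar> ^ k \<le> (\<bar>M\<bar> + \<bar>y\<bar>) ^ k" by (intro power_mono) auto
      also have "(d * (\<bar>M\<bar> + \<bar>y\<bar>)) ^ k \<le> fact k * exp (d * (\<bar>M\<bar> + \<bar>y\<bar>))"
        using d(1) by (intro power_le_fact_mult_exp) auto
      then have "d ^ k * (\<bar>M\<bar> + \<bar>y\<bar>) ^ k \<le> fact k * (exp (d * \<bar>M\<bar>) * exp (d * \<bar>y\<bar>))"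
        by (metis power_mult_distrib distrib_left exp_add)
      then have "(\<bar>M\<bar> + \<bar>y\<bar>) ^ k \<le> fact k / d ^ k * (exp (d * \<bar>M\<bar>) * exp (d * \<bar>y\<bar>))"
        using d(1) by (simp add: field_simps)
      finally have "enn2real (f y) * \<bar>M + \<bar>y\<bar>\<bar> ^ k \<le> enn2real (f y) * (fact k / d ^ k * (exp (d * \<bar>M\<bar>) * exp (d * \<bar>y\<bar>)))"
        by (intro mult_left_mono) auto
      then show "norm (enn2real (f y) * (M + \<bar>y\<bar>) ^ k)
        \<le> norm (fact k / d ^ k * exp (d * \<bar>M\<bar>) * (enn2real (f y) * exp (d * \<bar>y\<bar>)))"
        using d(1) by (simp add: abs_mult power_abs mult_ac)
    qed
  qed measurable
qed

text \<open>At \<open>x = e\<^sup>y\<close> division by zero makes the integrand \<open>0\<close>; this is a null set of \<open>y\<close>.\<close>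

definition log_stieltjes :: "(real \<Rightarrow> ennreal) \<Rightarrow> nat \<Rightarrow> complex \<Rightarrow> complex" where
  "log_stieltjes f k x =
     (\<integral>y. of_real (enn2real (f y) * exp y) * (Ln x - of_real y) ^ k / (x - of_real (exp y)) \<partial>lborel)"

lemma AE_exp_neq: "AE y in lborel. complex_of_real (exp y) \<noteq> x"
proof -
  have "AE y in lborel. y \<noteq> ln (Re x)" by (rule AE_lborel_singleton)
  then show ?thesis by eventually_elim auto
qed

lemma holomorphic_on_log_stieltjes:
  assumes f: "tempered f" and k: "k > 0"
  shows "log_stieltjes f k holomorphic_on slit_plane"
proof -
  have [measurable]: "f \<in> borel_measurable borel" using f by auto
  show ?thesis
    unfolding log_stieltjes_def
  proof (rule holomorphic_on_removable_integral[OF open_slit_plane])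
    fix t
    show "(\<lambda>x. of_real (enn2real (f t) * exp t) * (Ln x - of_real t) ^ k) holomorphic_on slit_plane"
      by (intro holomorphic_intros) auto
    show "of_real (enn2real (f t) * exp t) * (Ln (of_real (exp t)) - of_real t) ^ k = (0::complex)"
      using k by (simp add: Ln_of_real)
  next
    fix x0 :: complex assume "x0 \<in> slit_plane"
    then obtain r where r: "r > 0" "cball x0 r \<subseteq> slit_plane"
      using open_slit_plane open_contains_cball by blast
    have "compact (Ln ` cball x0 r)"
      using r(2) by (intro compact_continuous_image continuous_intros) auto
    then obtain M where M: "\<And>x. x \<in> cball x0 r \<Longrightarrow> norm (Ln x) \<le> M"
      by (meson bounded_iff compact_imp_bounded imageI)
    have "norm (of_real (enn2real (f t) * exp t) * (Ln x - of_real t) ^ k)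
        \<le> enn2real (f t) * (M + \<bar>t\<bar>) ^ k * (1 + norm (complex_of_real (exp t)))" if "x \<in> cball x0 r" for x t
    proof -
      have "norm (Ln x - of_real t) \<le> M + \<bar>t\<bar>"
        using M[OF that] norm_triangle_ineq4[of "Ln x" "of_real t"] by simp
      then have "norm (Ln x - of_real t) ^ k \<le> (M + \<bar>t\<bar>) ^ k" by (intro power_mono) auto
      then have "(enn2real (f t) * norm (Ln x - of_real t) ^ k) * exp t \<le> (enn2real (f t) * (M + \<bar>t\<bar>) ^ k) * (1 + exp t)"
        using order_trans[OF zero_le_power[OF norm_ge_zero]] by (intro mult_mono mult_left_mono mult_nonneg_nonneg) auto
      then show ?thesis by (simp add: norm_mult norm_power mult_ac)
    qed
    then show "\<exists>r>0. \<exists>G. cball x0 r \<subseteq> slit_plane \<and> integrable lborel G \<and>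
        (\<forall>x\<in>cball x0 r. \<forall>t\<in>space lborel. norm (of_real (enn2real (f t) * exp t) * (Ln x - of_real t) ^ k)
           \<le> G t * (1 + norm (complex_of_real (exp t))))"
      using r integrable_tempered_poly[OF f, of M k] by blast
  qed (auto intro: AE_exp_neq)
qed

lemma log_ker_real_le: "y / (exp y - 1) \<le> 1 + \<bar>y::real\<bar>"
proof (cases "y = 0")
  case False
  show ?thesis
  proof (cases "y > 0")
    case True
    have "exp y - 1 \<ge> y" using exp_ge_add_one_self[of y] by linarith
    then have "y / (exp y - 1) \<le> 1" using True by (simp add: divide_le_eq)
    then show ?thesis using True by linarith
  next
    case False
    with \<open>y \<noteq> 0\<close> have y: "y < 0" by simp
    have "(1 - y) * exp y \<le> 1"
      using exp_ge_add_one_self[of "- y"] by (simp add: exp_minus field_simps)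
    then have "- y \<le> (1 + \<bar>y\<bar>) * (1 - exp y)" using y by (simp add: algebra_simps)
    then have "(- y) / (1 - exp y) \<le> 1 + \<bar>y\<bar>" using y by (subst pos_divide_le_eq) auto
    moreover have "y / (exp y - 1) = (- y) / (1 - exp y)"
      using minus_divide_divide[of y "exp y - 1"] by (simp del: minus_divide_left)
    ultimately show ?thesis by (simp only:)
  qed
qed simp

text \<open>On the positive reals the transforms of positive index are convolutions: one factor Y -
  y cancels the pole and leaves the kernel of \<open>log_ker\<close>, the other k factors remain. So
  \<open>\<Phi>\<^sub>1\<close> is convolution with \<open>log_ker\<close>, and
  \<open>log_ker3\<close> yields a combination of \<open>\<Phi>\<^sub>3\<close> and
  \<open>\<Phi>\<^sub>1\<close>.\<close>

lemma log_stieltjes_integrand: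
  "of_real (g * exp y) * (Ln (of_real (exp Y)) - of_real y) ^ Suc k / (of_real (exp Y) - of_real (exp y))
     = complex_of_real (g * ((Y - y) / (exp (Y - y) - 1) * (Y - y) ^ k))"
proof -
  have e: "(exp Y - exp y) = exp y * (exp (Y - y) - 1)" by (simp add: exp_diff field_simps)
  have "of_real (g * exp y) * (Ln (of_real (exp Y)) - of_real y) ^ Suc k / (of_real (exp Y) - of_real (exp y))
     = complex_of_real (g * exp y * (Y - y) ^ Suc k / (exp Y - exp y))"
    by (simp add: Ln_of_real)
  also have "g * exp y * (Y - y) ^ Suc k / (exp Y - exp y) = g * ((Y - y) / (exp (Y - y) - 1) * (Y - y) ^ k)"
    unfolding e by simp
  finally show ?thesis .
qed

lemma integrable_log_stieltjes_real:
  assumes f: "tempered f"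
  shows "integrable lborel (\<lambda>y. enn2real (f y) * ((Y - y) / (exp (Y - y) - 1) * (Y - y) ^ k))"
proof (rule Bochner_Integration.integrable_bound[OF integrable_tempered_poly[OF f, of "1 + \<bar>Y\<bar>" "Suc k"]])
  have [measurable]: "f \<in> borel_measurable borel" using f by auto
  show "(\<lambda>y. enn2real (f y) * ((Y - y) / (exp (Y - y) - 1) * (Y - y) ^ k)) \<in> borel_measurable lborel" by measurable
  show "AE y in lborel. norm (enn2real (f y) * ((Y - y) / (exp (Y - y) - 1) * (Y - y) ^ k))
      \<le> norm (enn2real (f y) * (1 + \<bar>Y\<bar> + \<bar>y\<bar>) ^ Suc k)"
  proof (rule AE_I2)
    fix y :: real
    define Z where "Z = Y - y"
    have Z: "\<bar>Z\<bar> \<le> \<bar>Y\<bar> + \<bar>y\<bar>" by (auto simp: Z_def)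
    have "\<bar>Z / (exp Z - 1)\<bar> \<le> 1 + \<bar>Y\<bar> + \<bar>y\<bar>"
      unfolding abs_of_nonneg[OF log_ker_real_nonneg] using log_ker_real_le[of Z] Z by linarith
    moreover have "\<bar>Z ^ k\<bar> \<le> (1 + \<bar>Y\<bar> + \<bar>y\<bar>) ^ k"
      unfolding power_abs using Z by (intro power_mono) auto
    ultimately have "\<bar>Z / (exp Z - 1)\<bar> * \<bar>Z ^ k\<bar> \<le> (1 + \<bar>Y\<bar> + \<bar>y\<bar>) * (1 + \<bar>Y\<bar> + \<bar>y\<bar>) ^ k"
      by (intro mult_mono) auto
    then show "norm (enn2real (f y) * ((Y - y) / (exp (Y - y) - 1) * (Y - y) ^ k))
      \<le> norm (enn2real (f y) * (1 + \<bar>Y\<bar> + \<bar>y\<bar>) ^ Suc k)"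
      unfolding Z_def[symmetric] real_norm_def power_Suc abs_mult[of "enn2real (f y)"]
      by (intro mult_left_mono) (simp_all add: abs_mult power_abs)
  qed
qed

lemma log_stieltjes_of_real:
  "log_stieltjes f (Suc k) (of_real (exp Y))
     = of_real (\<integral>y. enn2real (f y) * ((Y - y) / (exp (Y - y) - 1) * (Y - y) ^ k) \<partial>lborel)"
  unfolding log_stieltjes_def log_stieltjes_integrand by (rule integral_complex_of_real)

lemma AE_reflect_neq: "AE y in lborel. Y - y \<noteq> (0::real)"
  using AE_lborel_singleton[of Y] by eventually_elim auto

lemma conv_tempered_log_ker:
  assumes f: "tempered f"
  shows "conv f log_ker Y < \<infinity>"
    and "of_real (enn2real (conv f log_ker Y)) = log_stieltjes f 1 (of_real (exp Y))"
proof -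
  let ?g = "\<lambda>y. enn2real (f y) * ((Y - y) / (exp (Y - y) - 1))"
  have nn: "?g y \<ge> 0" for y by (intro mult_nonneg_nonneg log_ker_real_nonneg) auto
  have "conv f log_ker Y = (\<integral>\<^sup>+y. ennreal (?g y) \<partial>lborel)"
    unfolding conv_def
  proof (rule nn_integral_cong_AE)
    show "AE y in lborel. f y * log_ker (Y - y) = ennreal (?g y)"
      using tempered_AE[OF f] AE_reflect_neq[of Y]
    proof eventually_elim
      case (elim y)
      have "ennreal (?g y) = ennreal (enn2real (f y)) * ennreal ((Y - y) / (exp (Y - y) - 1))"
        by (intro ennreal_mult log_ker_real_nonneg) auto
      then show ?case by (simp only: log_ker_eq[OF elim(2)] elim(1)[symmetric])
    qed
  qed
  also have "\<dots> = ennreal (\<integral>y. ?g y \<partial>lborel)"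
    using integrable_log_stieltjes_real[OF f, of Y 0] nn by (intro nn_integral_eq_integral) auto
  finally have *: "conv f log_ker Y = ennreal (\<integral>y. ?g y \<partial>lborel)" .
  then show "conv f log_ker Y < \<infinity>" by simp
  have "(\<integral>y. ?g y \<partial>lborel) \<ge> 0" using nn by (intro integral_nonneg_AE) auto
  then show "of_real (enn2real (conv f log_ker Y)) = log_stieltjes f 1 (of_real (exp Y))"
    using log_stieltjes_of_real[of f 0 Y] * by simp
qed

lemma conv_tempered_log_ker3:
  assumes f: "tempered f"
  shows "conv f log_ker3 Y < \<infinity>"
    and "of_real (enn2real (conv f log_ker3 Y)) =
      log_stieltjes f 3 (of_real (exp Y)) / 6 + 2 * of_real pi ^ 2 / 3 * log_stieltjes f 1 (of_real (exp Y))"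
proof -
  let ?a = "\<lambda>k y. enn2real (f y) * ((Y - y) / (exp (Y - y) - 1) * (Y - y) ^ k)"
  let ?g = "\<lambda>y. ?a 2 y / 6 + 2 * pi ^ 2 / 3 * ?a 0 y"
  have nn: "?g y \<ge> 0" for y
  proof -
    have "?a 2 y \<ge> 0" "?a 0 y \<ge> 0"
      using log_ker_real_nonneg[of "Y - y"] by (simp_all only: mult_nonneg_nonneg enn2real_nonneg zero_le_power2 power_0 mult_1_right)
    then show ?thesis by (simp only: add_nonneg_nonneg divide_nonneg_nonneg mult_nonneg_nonneg zero_le_numeral zero_le_power2)
  qed
  have i1: "integrable lborel (\<lambda>y. ?a 2 y / 6)"
    by (rule integrable_divide_zero) (intro impI integrable_log_stieltjes_real f)
  have i2: "integrable lborel (\<lambda>y. 2 * pi ^ 2 / 3 * ?a 0 y)"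
    by (rule integrable_mult_right) (intro impI integrable_log_stieltjes_real f)
  have i: "integrable lborel ?g"
    using i1 i2 by (rule Bochner_Integration.integrable_add)
  have "conv f log_ker3 Y = (\<integral>\<^sup>+y. ennreal (?g y) \<partial>lborel)"
    unfolding conv_def
  proof (rule nn_integral_cong_AE)
    show "AE y in lborel. f y * log_ker3 (Y - y) = ennreal (?g y)"
      using tempered_AE[OF f] AE_reflect_neq[of Y]
    proof eventually_elim
      case (elim y)
      define Z where "Z = Y - y"
      have e: "(Z ^ 3 / 6 + 2 * pi ^ 2 / 3 * Z) / (exp Z - 1) = (Z / (exp Z - 1)) * (Z ^ 2 / 6 + 2 * pi ^ 2 / 3)"
        by (simp add: power3_eq_cube power2_eq_square algebra_simps add_divide_distrib)
      have "?g y = enn2real (f y) * ((Z ^ 3 / 6 + 2 * pi ^ 2 / 3 * Z) / (exp Z - 1))"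
        unfolding e Z_def[symmetric] by (simp add: algebra_simps)
      moreover have "(Z ^ 3 / 6 + 2 * pi ^ 2 / 3 * Z) / (exp Z - 1) \<ge> 0"
        unfolding e by (intro mult_nonneg_nonneg log_ker_real_nonneg) auto
      ultimately have "ennreal (?g y) = ennreal (enn2real (f y)) * ennreal ((Z ^ 3 / 6 + 2 * pi ^ 2 / 3 * Z) / (exp Z - 1))"
        by (simp only: ennreal_mult enn2real_nonneg)
      then show ?case by (simp only: log_ker3_eq[OF elim(2)] Z_def elim(1)[symmetric])
    qed
  qed
  also have "\<dots> = ennreal (\<integral>y. ?g y \<partial>lborel)"
    by (rule nn_integral_eq_integral[OF i AE_I2[OF nn]])
  finally have *: "conv f log_ker3 Y = ennreal (\<integral>y. ?g y \<partial>lborel)" .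
  then show "conv f log_ker3 Y < \<infinity>" by simp
  have "(\<integral>y. ?g y \<partial>lborel) \<ge> 0" using nn by (intro integral_nonneg_AE) auto
  then have "enn2real (conv f log_ker3 Y) = (\<integral>y. ?g y \<partial>lborel)" using * by simp
  also have "\<dots> = (\<integral>y. ?a 2 y \<partial>lborel) / 6 + 2 * pi ^ 2 / 3 * (\<integral>y. ?a 0 y \<partial>lborel)"
    unfolding Bochner_Integration.integral_add[OF i1 i2]
    by (simp only: integral_divide_zero integral_mult_right_zero)
  finally show "of_real (enn2real (conv f log_ker3 Y)) =
      log_stieltjes f 3 (of_real (exp Y)) / 6 + 2 * of_real pi ^ 2 / 3 * log_stieltjes f 1 (of_real (exp Y))"
    using log_stieltjes_of_real[of f 0 Y] log_stieltjes_of_real[of f 2 Y] by (simp add: numeral_3_eq_3 numeral_2_eq_2)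
qed

section \<open>The density \<open>X\<close> and its Laplace transform\<close>

lemma conv_beta_ker_nonpos: "Y \<le> 0 \<Longrightarrow> conv (beta_ker a) (beta_ker b) Y = 0"
proof -
  assume Y: "Y \<le> 0"
  have "conv (beta_ker a) (beta_ker b) Y = (\<integral>\<^sup>+y. 0 \<partial>(lborel :: real measure))"
    unfolding conv_def using Y by (intro nn_integral_cong) (auto simp: beta_ker_def indicator_def)
  then show ?thesis by simp
qed

lemma period_pos_nonpos: "Y \<le> 0 \<Longrightarrow> period_pos a Y = 0"
  by (simp add: period_pos_def conv_beta_ker_nonpos)

text \<open>The two Beta kernels contribute Beta values with parameters (1 - a, s + a) and (a, s + 1
  - a). The prefactor sin (pi a) / pi in \<open>period_pos\<close> is there to cancel Gamma (a)
  Gamma (1 - a).\<close>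

lemma nn_integral_period_pos_exp:
  assumes a: "0 < a" "a < 1" and s: "s + a > 0" "s + 1 - a > 0"
  shows "(\<integral>\<^sup>+y. period_pos a y * ennreal (exp (- s * y)) \<partial>lborel)
       = ennreal (Gamma (s + a) * Gamma (s + 1 - a) / Gamma (s + 1) ^ 2)"
proof -
  have g: "Gamma (1 - a) > 0" "Gamma a > 0" "Gamma (s + a) > 0" "Gamma (s + 1 - a) > 0" "Gamma (s + 1) > 0"
    using a s by (auto intro!: Gamma_real_pos)
  have B: "Beta (1 - a) (s + a) \<ge> 0" "Beta (1 - (1 - a)) (s + (1 - a)) \<ge> 0"
    using g by (auto simp: Beta_def add_diff_eq add.commute less_imp_le intro!: divide_nonneg_nonneg mult_nonneg_nonneg)
  have sg: "sin (pi * a) > 0" using a by (rule sin_pi_pos)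
  have "(\<integral>\<^sup>+y. period_pos a y * ennreal (exp (- s * y)) \<partial>lborel)
     = ennreal (sin (pi * a) / pi) * (\<integral>\<^sup>+y. conv (beta_ker a) (beta_ker (1 - a)) y * ennreal (exp (- s * y)) \<partial>lborel)"
    unfolding period_pos_def mult.assoc by (rule nn_integral_cmult) measurable
  also have "(\<integral>\<^sup>+y. conv (beta_ker a) (beta_ker (1 - a)) y * ennreal (exp (- s * y)) \<partial>lborel)
     = ennreal (Beta (1 - a) (s + a)) * ennreal (Beta (1 - (1 - a)) (s + (1 - a)))"
  proof -
    have "(\<integral>\<^sup>+y. beta_ker a y * ennreal (exp (- s * y)) \<partial>lborel) = ennreal (Beta (1 - a) (s + a))"
      "(\<integral>\<^sup>+y. beta_ker (1 - a) y * ennreal (exp (- s * y)) \<partial>lborel) = ennreal (Beta (1 - (1 - a)) (s + (1 - a)))"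
      using a s by (intro nn_integral_beta_ker_exp; simp)+
    then show ?thesis by (simp only: nn_integral_conv_exp[OF measurable_kernels(1) measurable_kernels(1)])
  qed
  also have "ennreal (sin (pi * a) / pi) * (ennreal (Beta (1 - a) (s + a)) * ennreal (Beta (1 - (1 - a)) (s + (1 - a))))
     = ennreal (sin (pi * a) / pi * (Beta (1 - a) (s + a) * Beta (1 - (1 - a)) (s + (1 - a))))"
    using sg B by (simp only: ennreal_mult[symmetric] mult_nonneg_nonneg divide_nonneg_nonneg less_imp_le pi_ge_zero)
  also have "sin (pi * a) / pi * (Beta (1 - a) (s + a) * Beta (1 - (1 - a)) (s + (1 - a)))
     = (sin (pi * a) / pi * (Gamma (1 - a) * Gamma a)) * (Gamma (s + a) * Gamma (s + 1 - a) / Gamma (s + 1) ^ 2)"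
    by (simp add: Beta_def power2_eq_square add.commute add_diff_eq)
  also have "Gamma (1 - a) * Gamma a = pi / sin (pi * a)"
    using Beta_reflection[OF a] by (simp add: Beta_def)
  finally show ?thesis using sg by simp
qed

lemma tempered_period_pos:
  assumes a: "0 < a" "a < 1"
  shows "tempered (period_pos a)"
  unfolding tempered_def
proof (intro conjI)
  \<comment> \<open>Half the distance to the nearest pole: at s = - d both Gamma arguments are still
    positive.\<close>
  define d where "d = min a (1 - a) / 2"
  have "d > 0" "d \<le> a / 2" "d \<le> (1 - a) / 2" using a by (auto simp: d_def)
  then have "d > 0" "- d + a > 0" "- d + 1 - a > 0" using a by auto
  then show "\<exists>d>0. (\<integral>\<^sup>+y. period_pos a y * ennreal (exp (d * y)) \<partial>lborel) < \<infinity>"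
    using nn_integral_period_pos_exp[OF a, of "- d"] by (intro exI[of _ d]) simp
qed (auto simp: period_pos_nonpos)

definition period_conv :: "real \<Rightarrow> real \<Rightarrow> real \<Rightarrow> ennreal" where
  "period_conv A B = conv (period_pos A) (period_pos B)"

definition gamma_ratio :: "real \<Rightarrow> real \<Rightarrow> real \<Rightarrow> real" where
  "gamma_ratio A B s = Gamma (s + A) * Gamma (s + 1 - A) * Gamma (s + B) * Gamma (s + 1 - B) / Gamma (s + 1) ^ 4"

lemma measurable_period_conv [measurable]: "period_conv A B \<in> borel_measurable borel"
  unfolding period_conv_def by measurable

lemma period_conv_nonpos: "Y \<le> 0 \<Longrightarrow> period_conv A B Y = 0"
proof -
  assume Y: "Y \<le> 0"
  have "period_pos A y * period_pos B (Y - y) = 0" for y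
    using Y by (cases "y \<le> 0") (auto simp: period_pos_nonpos)
  then show ?thesis unfolding period_conv_def conv_def by (simp only:) simp
qed

lemma nn_integral_period_conv_exp:
  assumes "0 < A" "A < 1" "0 < B" "B < 1"
    and s: "s + A > 0" "s + 1 - A > 0" "s + B > 0" "s + 1 - B > 0"
  shows "(\<integral>\<^sup>+y. period_conv A B y * ennreal (exp (- s * y)) \<partial>lborel) = ennreal (gamma_ratio A B s)"
proof -
  have g: "Gamma (s + A) > 0" "Gamma (s + 1 - A) > 0" "Gamma (s + B) > 0" "Gamma (s + 1 - B) > 0"
    using s by (auto intro!: Gamma_real_pos)
  have "(\<integral>\<^sup>+y. period_conv A B y * ennreal (exp (- s * y)) \<partial>lborel)
    = ennreal (Gamma (s + A) * Gamma (s + 1 - A) / Gamma (s + 1) ^ 2) *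
      ennreal (Gamma (s + B) * Gamma (s + 1 - B) / Gamma (s + 1) ^ 2)"
    unfolding period_conv_def nn_integral_conv_exp[OF measurable_period(1) measurable_period(1)]
    using assms by (simp only: nn_integral_period_pos_exp)
  also have "\<dots> = ennreal (gamma_ratio A B s)"
    using g by (subst ennreal_mult[symmetric]) (auto simp: gamma_ratio_def intro!: arg_cong[where f=ennreal])
  finally show ?thesis .
qed

lemma tempered_period_conv:
  assumes "0 < A" "A < 1" "0 < B" "B < 1"
  shows "tempered (period_conv A B)"
  unfolding tempered_def
proof (intro conjI)
  define d where "d = min (min A (1 - A)) (min B (1 - B)) / 2"
  have "d > 0" "d \<le> A / 2" "d \<le> (1 - A) / 2" "d \<le> B / 2" "d \<le> (1 - B) / 2"
    using assms by (auto simp: d_def)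
  then have "d > 0" "- d + A > 0" "- d + 1 - A > 0" "- d + B > 0" "- d + 1 - B > 0"
    using assms by auto
  then show "\<exists>d>0. (\<integral>\<^sup>+y. period_conv A B y * ennreal (exp (d * y)) \<partial>lborel) < \<infinity>"
    using nn_integral_period_conv_exp[OF assms, of "- d"] by (intro exI[of _ d]) simp
qed (auto simp: period_conv_nonpos)

section \<open>Continuation of the periods to the slit plane\<close>

text \<open>The continuation of \<open>period a\<close> in the variable x = e^Y; it is holomorphic
  because it is a transform of index 1 of a tempered density.\<close>

definition period_fun :: "real \<Rightarrow> complex \<Rightarrow> complex" where
  "period_fun a x = of_real ((sin (pi * a) / pi) ^ 2) * log_stieltjes (period_pos a) 1 x"

lemma holomorphic_on_period_fun:
  assumes "0 < a" "a < 1"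
  shows "period_fun a holomorphic_on slit_plane"
  unfolding period_fun_def
  by (intro holomorphic_intros holomorphic_on_log_stieltjes tempered_period_pos assms) simp

lemma period_finite:
  assumes "0 < a" "a < 1"
  shows "period a Y < \<infinity>" and "of_real (enn2real (period a Y)) = period_fun a (of_real (exp Y))"
  using conv_tempered_log_ker[OF tempered_period_pos[OF assms], of Y]
  by (auto simp: period_def period_fun_def enn2real_mult ennreal_mult_less_top)

lemma continuous_on_period_real:
  assumes "0 < a" "a < 1"
  shows "continuous_on UNIV (\<lambda>Y. enn2real (period a Y))"
proof -
  have "continuous_on UNIV (\<lambda>Y. Re (period_fun a (of_real (exp Y))))"
    by (intro continuous_intros continuous_on_compose2[OF holomorphic_on_imp_continuous_on[OF holomorphic_on_period_fun[OF assms]]])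
      (use of_real_exp_in_slit_plane in auto)
  then show ?thesis by (simp add: period_finite(2)[OF assms, symmetric])
qed

text \<open>
  The convolution of \<open>period A\<close> and \<open>period B\<close> over the segment from \<open>0\<close> to \<open>Ln x\<close>, parametrised by
  \<open>y = \<tau> Ln x\<close>. For \<open>x > 1\<close> it is \<open>period_conv A B (ln x)\<close>.
\<close>

definition vanishing_period :: "real \<Rightarrow> real \<Rightarrow> complex \<Rightarrow> complex" where
  "vanishing_period A B x = Ln x * (\<integral>\<tau>. indicator {0..1} \<tau> *\<^sub>R
     (period_fun A (exp (of_real \<tau> * Ln x)) * period_fun B (exp (of_real (1 - \<tau>) * Ln x))) \<partial>lborel)"

lemma abs_Im_Ln_less_pi: "x \<in> slit_plane \<Longrightarrow> \<bar>Im (Ln x)\<bar> < pi"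
proof -
  assume x: "x \<in> slit_plane"
  then have x0: "x \<noteq> 0" by auto
  have "Im (Ln x) \<noteq> pi"
  proof
    assume "Im (Ln x) = pi"
    then have "exp (Ln x) \<in> \<real>\<^sub>\<le>\<^sub>0" by (simp add: complex_nonpos_Reals_iff Re_exp Im_exp del: exp_Ln)
    then show False using x x0 by simp
  qed
  then show ?thesis using mpi_less_Im_Ln[OF x0] Im_Ln_le_pi[OF x0] by auto
qed

lemma exp_mult_Ln_in_slit_plane:
  assumes "x \<in> slit_plane" "0 \<le> \<tau>" "\<tau> \<le> 1"
  shows "exp (of_real \<tau> * Ln x) \<in> slit_plane"
proof (rule exp_in_slit_plane)
  have "\<bar>Im (of_real \<tau> * Ln x)\<bar> = \<tau> * \<bar>Im (Ln x)\<bar>" using assms by (simp add: abs_mult)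
  also have "\<dots> \<le> 1 * \<bar>Im (Ln x)\<bar>" using assms by (intro mult_right_mono) auto
  finally show "\<bar>Im (of_real \<tau> * Ln x)\<bar> < pi" using abs_Im_Ln_less_pi[OF assms(1)] by simp
qed

text \<open>For x in the slit plane the points tau Ln x and (1 - tau) Ln x stay in the strip |Im| <
  pi, so both factors are evaluated inside the slit plane. The dominating constant comes from
  compactness of a closed disc times [0, 1].\<close>

lemma holomorphic_on_vanishing_period:
  assumes "0 < A" "A < 1" "0 < B" "B < 1"
  shows "vanishing_period A B holomorphic_on slit_plane"
proof -
  let ?g = "\<lambda>x \<tau>. period_fun A (exp (of_real \<tau> * Ln x)) * period_fun B (exp (of_real (1 - \<tau>) * Ln x))"
  have hA: "period_fun A holomorphic_on slit_plane" and hB: "period_fun B holomorphic_on slit_plane"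
    using assms by (auto intro: holomorphic_on_period_fun)
  have cont: "continuous_on (S \<times> {0..1}) (\<lambda>(x, \<tau>). ?g x \<tau>)" if "S \<subseteq> slit_plane" for S
    unfolding case_prod_unfold
    by (intro continuous_intros continuous_on_compose2[OF holomorphic_on_imp_continuous_on[OF hA]]
        continuous_on_compose2[OF holomorphic_on_imp_continuous_on[OF hB]])
      (use that in \<open>auto simp del: of_real_diff simp: exp_mult_Ln_in_slit_plane[simplified] subset_iff\<close>)
  have "(\<lambda>x. \<integral>\<tau>. indicator {0..1} \<tau> *\<^sub>R ?g x \<tau> \<partial>lborel) holomorphic_on slit_plane"
  proof (rule holomorphic_on_lebesgue_integral[OF open_slit_plane])
    fix \<tau> :: real
    show "(\<lambda>x. indicator {0..1} \<tau> *\<^sub>R ?g x \<tau>) holomorphic_on slit_plane"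
    proof (cases "\<tau> \<in> {0..1}")
      case True
      have "(\<lambda>x. ?g x \<tau>) holomorphic_on slit_plane"
        by (intro holomorphic_on_mult holomorphic_on_compose_gen[OF _ hA, unfolded o_def]
          holomorphic_on_compose_gen[OF _ hB, unfolded o_def] holomorphic_intros image_subsetI exp_mult_Ln_in_slit_plane)
          (use True in auto)
      then show ?thesis using True by simp
    qed simp
  next
    fix x assume x: "x \<in> slit_plane"
    have "continuous_on {0..1} (\<lambda>\<tau>. (\<lambda>(x, \<tau>). ?g x \<tau>) (x, \<tau>))"
      by (rule continuous_on_compose2[OF cont[of slit_plane]]) (use x in \<open>auto intro!: continuous_intros\<close>)
    then have "continuous_on {0..1} (?g x)" by simp
    then show "(\<lambda>\<tau>. indicator {0..1} \<tau> *\<^sub>R ?g x \<tau>) \<in> borel_measurable lborel"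
      by (simp add: borel_measurable_continuous_on_indicator)
  next
    fix x0 assume "x0 \<in> slit_plane"
    then obtain r where r: "r > 0" "cball x0 r \<subseteq> slit_plane"
      using open_slit_plane open_contains_cball by blast
    have "compact ((\<lambda>(x, \<tau>). ?g x \<tau>) ` (cball x0 r \<times> {0..1}))"
      by (intro compact_continuous_image cont r compact_Times) auto
    from compact_imp_bounded[OF this]
    obtain M where M': "\<forall>z\<in>(\<lambda>(x, \<tau>). ?g x \<tau>) ` (cball x0 r \<times> {0..1}). norm z \<le> M"
      unfolding bounded_iff by (elim exE)
    have M: "norm (?g x \<tau>) \<le> M" if "x \<in> cball x0 r" "\<tau> \<in> {0..1}" for x \<tau>
      by (rule bspec[OF M'], rule image_eqI[where x="(x, \<tau>)"]) (use that in simp_all)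
    have "norm (indicator {0..1} \<tau> *\<^sub>R ?g x \<tau>) \<le> indicator {0..1} \<tau> * M" if "x \<in> cball x0 r" for x \<tau>
    proof (cases "\<tau> \<in> {0..1}")
      case True
      then show ?thesis using M[OF that True] by (simp only: indicator_simps scaleR_one mult_1)
    next
      case False
      then show ?thesis by (simp only: indicator_simps simp_thms scaleR_zero_left mult_zero_left norm_zero order_refl)
    qed
    moreover have "integrable lborel (\<lambda>\<tau>. indicator {0..1::real} \<tau> * M)" by simp
    ultimately show "\<exists>r>0. \<exists>G. cball x0 r \<subseteq> slit_plane \<and> integrable lborel G \<and>
        (\<forall>x\<in>cball x0 r. \<forall>\<tau>\<in>space lborel. norm (indicator {0..1} \<tau> *\<^sub>R ?g x \<tau>) \<le> G \<tau>)"
      using r by blast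
  qed
  then show ?thesis unfolding vanishing_period_def by (intro holomorphic_intros) auto
qed

definition period_segment :: "real \<Rightarrow> real \<Rightarrow> real \<Rightarrow> real" where
  "period_segment A B Y = (\<integral>\<tau>. indicator {0..1} \<tau> * (enn2real (period A (\<tau> * Y)) * enn2real (period B ((1 - \<tau>) * Y))) \<partial>lborel)"

lemma vanishing_period_of_real:
  assumes "0 < A" "A < 1" "0 < B" "B < 1"
  shows "vanishing_period A B (of_real (exp Y)) = of_real (Y * period_segment A B Y)"
proof -
  have e: "exp (complex_of_real \<tau> * of_real Y) = of_real (exp (\<tau> * Y))" for \<tau>
    by (simp add: exp_of_real[symmetric])
  have "vanishing_period A B (of_real (exp Y)) = of_real Y * (\<integral>\<tau>. of_real (indicator {0..1} \<tau> *
       (enn2real (period A (\<tau> * Y)) * enn2real (period B ((1 - \<tau>) * Y)))) \<partial>lborel)"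
    unfolding vanishing_period_def using assms
    by (simp only: Ln_of_real exp_gt_zero ln_exp e period_finite(2)[symmetric] scaleR_conv_of_real of_real_mult)
  also have "\<dots> = of_real (Y * period_segment A B Y)"
    unfolding integral_complex_of_real period_segment_def by (simp only: of_real_mult)
  finally show ?thesis .
qed

text \<open>The condition 0 < y / Y < 1 describes the open segment between 0 and Y for either sign
  of Y, so the substitution y = Y tau treats both half lines at once.\<close>

lemma nn_integral_period_segment:
  assumes "0 < A" "A < 1" "0 < B" "B < 1" and Y: "Y \<noteq> 0"
  shows "(\<integral>\<^sup>+y. indicator {y. 0 < y / Y \<and> y / Y < 1} y * (period A y * period B (Y - y)) \<partial>lborel)
    = ennreal (\<bar>Y\<bar> * period_segment A B Y)"
proof -
  let ?h = "\<lambda>\<tau>. enn2real (period A (\<tau> * Y)) * enn2real (period B ((1 - \<tau>) * Y))"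
  have [measurable]: "{y. 0 < y / Y \<and> y / Y < 1} \<in> sets borel" by measurable
  have "(\<integral>\<^sup>+y. indicator {y. 0 < y / Y \<and> y / Y < 1} y * (period A y * period B (Y - y)) \<partial>lborel)
    = ennreal \<bar>Y\<bar> * (\<integral>\<^sup>+\<tau>. indicator {y. 0 < y / Y \<and> y / Y < 1} (0 + Y * \<tau>) * (period A (0 + Y * \<tau>) * period B (Y - (0 + Y * \<tau>))) \<partial>lborel)"
    by (rule nn_integral_real_affine) (use Y in measurable)
  also have "(\<integral>\<^sup>+\<tau>. indicator {y. 0 < y / Y \<and> y / Y < 1} (0 + Y * \<tau>) * (period A (0 + Y * \<tau>) * period B (Y - (0 + Y * \<tau>))) \<partial>lborel)
    = (\<integral>\<^sup>+\<tau>. ennreal (indicator {0..1} \<tau> * ?h \<tau>) \<partial>lborel)"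
  proof (rule nn_integral_cong_AE)
    show "AE \<tau> in lborel. indicator {y. 0 < y / Y \<and> y / Y < 1} (0 + Y * \<tau>) * (period A (0 + Y * \<tau>) * period B (Y - (0 + Y * \<tau>)))
      = ennreal (indicator {0..1} \<tau> * ?h \<tau>)"
      using AE_lborel_singleton[of "0::real"] AE_lborel_singleton[of "1::real"]
    proof eventually_elim
      case (elim \<tau>)
      have fin: "period A (\<tau> * Y) = ennreal (enn2real (period A (\<tau> * Y)))"
        "period B ((1 - \<tau>) * Y) = ennreal (enn2real (period B ((1 - \<tau>) * Y)))"
        using period_finite(1)[of A] period_finite(1)[of B] assms by (simp_all add: less_top)
      have "period A (Y * \<tau>) * period B (Y - Y * \<tau>) = ennreal (?h \<tau>)"
        using fin by (simp add: ennreal_mult algebra_simps)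
      then show ?case using elim Y by (auto simp: indicator_def)
    qed
  qed
  also have "\<dots> = ennreal (period_segment A B Y)"
    unfolding period_segment_def
  proof (rule nn_integral_eq_integral)
    have "continuous_on {0..1} ?h"
      by (intro continuous_intros continuous_on_compose2[OF continuous_on_period_real]) (use assms in auto)
    then have "set_integrable lborel {0..1} ?h"
      by (rule borel_integrable_atLeastAtMost'[OF])
    then show "integrable lborel (\<lambda>\<tau>. indicator {0..1} \<tau> * ?h \<tau>)"
      by (simp add: set_integrable_def)
  qed auto
  also have "ennreal \<bar>Y\<bar> * ennreal (period_segment A B Y) = ennreal (\<bar>Y\<bar> * period_segment A B Y)"
    by (rule ennreal_mult'[symmetric]) simp
  finally show ?thesis .
qed

text \<open>For Y > 0 the supports restrict the convolution to 0 < y < Y, and there both densities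
  equal their continuations; hence \<open>vanishing_period\<close> does continue
  \<open>X\<close>.\<close>

lemma period_conv_pos:
  assumes "0 < A" "A < 1" "0 < B" "B < 1" and Y: "Y > 0"
  shows "period_conv A B Y = ennreal (Y * period_segment A B Y)"
proof -
  have "period_conv A B Y = (\<integral>\<^sup>+y. indicator {y. 0 < y / Y \<and> y / Y < 1} y * (period A y * period B (Y - y)) \<partial>lborel)"
    unfolding period_conv_def conv_def
  proof (rule nn_integral_cong)
    fix y :: real
    show "period_pos A y * period_pos B (Y - y) = indicator {y. 0 < y / Y \<and> y / Y < 1} y * (period A y * period B (Y - y))"
      using Y assms period_eq_period_pos[of A y] period_eq_period_pos[of B "Y - y"]
      by (cases "0 < y"; cases "y < Y") (auto simp: indicator_def period_pos_nonpos zero_less_divide_iff)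
  qed
  then show ?thesis using nn_integral_period_segment[of A B Y] assms by simp
qed

section \<open>The convolution identity for the vanishing period\<close>

definition period_neg :: "real \<Rightarrow> real \<Rightarrow> ennreal" where
  "period_neg a y = indicator {..<0} y * period a y"

lemma measurable_period_neg [measurable]: "period_neg a \<in> borel_measurable borel"
  unfolding period_neg_def by measurable

text \<open>Here the segment is traversed from 0 down to Y, which produces the minus sign: the
  convolution of the negative parts is minus the continuation of \<open>X\<close>.\<close>

lemma conv_period_neg:
  assumes "0 < A" "A < 1" "0 < B" "B < 1" and Y: "Y < 0"
  shows "conv (period_neg A) (period_neg B) Y = ennreal (- Y * period_segment A B Y)"
proof -
  have "conv (period_neg A) (period_neg B) Y = (\<integral>\<^sup>+y. indicator {y. 0 < y / Y \<and> y / Y < 1} y * (period A y * period B (Y - y)) \<partial>lborel)"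
    unfolding conv_def period_neg_def
    by (intro nn_integral_cong) (use Y in \<open>auto simp: indicator_def zero_less_divide_iff divide_less_eq\<close>)
  then show ?thesis using nn_integral_period_segment[of A B Y] assms by simp
qed

text \<open>The expansion of (p - P) * (q - Q) for the convolution product, with the negative terms
  moved to the other side, because infinite values would not cancel.\<close>

lemma conv_add_mult:
  assumes [measurable]: "P \<in> borel_measurable borel" "Q \<in> borel_measurable borel"
    "m \<in> borel_measurable borel" "n \<in> borel_measurable borel"
    "p \<in> borel_measurable borel" "q \<in> borel_measurable borel"
    and p: "AE y in lborel. p y = P y + m y" and q: "AE y in lborel. q y = Q y + n y"
  shows "conv p Q Y + conv P q Y + conv m n Y = conv P Q Y + conv p q Y"
proof -
  have 1: "conv p g Y = conv P g Y + conv m g Y" if [measurable]: "g \<in> borel_measurable borel" for g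
    by (simp add: conv_cong_AE_left[OF p] conv_add_left)
  have 2: "conv g q Y = conv g Q Y + conv g n Y" if [measurable]: "g \<in> borel_measurable borel" for g
  proof -
    have "conv g q Y = conv q g Y" by (simp add: conv_commute[of g])
    also have "\<dots> = conv Q g Y + conv n g Y" by (simp add: conv_cong_AE_left[OF q] conv_add_left)
    finally show ?thesis by (simp add: conv_commute[of g])
  qed
  show ?thesis by (simp add: 1 2 add_ac)
qed

lemma AE_period: "0 < a \<Longrightarrow> a < 1 \<Longrightarrow> AE y in lborel. period a y = period_pos a y + period_neg a y"
  using AE_lborel_singleton[of "0::real"]
proof eventually_elim
  case (elim y)
  then show ?case
    by (cases "y < 0") (auto simp: period_neg_def period_pos_nonpos period_eq_period_pos)
qed

text \<open>
  Write \<open>period a = P\<^sub>a + N\<^sub>a\<close> for the parts on the two half lines. Then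
  \<open>period A * P\<^sub>B + P\<^sub>A * period B + N\<^sub>A * N\<^sub>B = P\<^sub>A * P\<^sub>B + period A * period B\<close>, and each
  \<open>period a\<close> is a multiple of \<open>P\<^sub>a * log_ker\<close>.
\<close>

lemma period_conv_identity:
  assumes A: "0 < A" "A < 1" and B: "0 < B" "B < 1"
  shows "ennreal ((sin (pi * A) / pi) ^ 2) * conv (period_conv A B) log_ker Y
      + ennreal ((sin (pi * B) / pi) ^ 2) * conv (period_conv A B) log_ker Y
      + conv (period_neg A) (period_neg B) Y
    = period_conv A B Y + ennreal ((sin (pi * A) / pi) ^ 2) * ennreal ((sin (pi * B) / pi) ^ 2)
        * conv (period_conv A B) log_ker3 Y"
proof -
  define kA where "kA = ennreal ((sin (pi * A) / pi) ^ 2)"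
  define kB where "kB = ennreal ((sin (pi * B) / pi) ^ 2)"
  have pA: "period A = (\<lambda>y. kA * conv (period_pos A) log_ker y)"
    and pB: "period B = (\<lambda>y. kB * conv (period_pos B) log_ker y)"
    by (auto simp: period_def kA_def kB_def)
  have 1: "conv (period A) (period_pos B) Y = kA * conv (period_conv A B) log_ker Y"
  proof -
    have "conv (period A) (period_pos B) Y = kA * conv (conv (period_pos A) log_ker) (period_pos B) Y"
      unfolding pA by (rule conv_cmult_left) measurable
    also have "conv (conv (period_pos A) log_ker) (period_pos B) = conv (conv (period_pos A) (period_pos B)) log_ker"
      by (simp add: conv_assoc conv_commute[of log_ker])
    finally show ?thesis by (simp add: period_conv_def)
  qed
  have 2: "conv (period_pos A) (period B) Y = kB * conv (period_conv A B) log_ker Y"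
  proof -
    have "conv (period_pos A) (period B) Y = conv (period B) (period_pos A) Y"
      by (simp add: conv_commute[of "period_pos A"])
    also have "\<dots> = kB * conv (conv (period_pos B) log_ker) (period_pos A) Y"
      unfolding pB by (rule conv_cmult_left) measurable
    also have "conv (conv (period_pos B) log_ker) (period_pos A) = conv (period_conv A B) log_ker"
      unfolding period_conv_def
      by (simp add: conv_commute[of _ "period_pos A"] conv_assoc)
    finally show ?thesis .
  qed
  have 3: "conv (period A) (period B) Y = kA * kB * conv (period_conv A B) log_ker3 Y"
  proof -
    have "conv (period A) (period B) Y = kA * conv (conv (period_pos A) log_ker) (period B) Y"
      unfolding pA by (rule conv_cmult_left) measurable
    also have "conv (conv (period_pos A) log_ker) (period B) Y = conv (period B) (conv (period_pos A) log_ker) Y"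
      by (simp add: conv_commute[of "period B"])
    also have "\<dots> = kB * conv (conv (period_pos B) log_ker) (conv (period_pos A) log_ker) Y"
      unfolding pB by (rule conv_cmult_left) measurable
    also have "conv (conv (period_pos B) log_ker) (conv (period_pos A) log_ker)
        = conv (conv (period_pos B) (period_pos A)) log_ker3"
      unfolding log_ker3_def by (rule conv_conv_swap) measurable
    also have "conv (period_pos B) (period_pos A) = period_conv A B"
      by (simp add: period_conv_def conv_commute[of "period_pos B"])
    finally show ?thesis by (simp add: mult.assoc)
  qed
  show ?thesis
    using conv_add_mult[OF measurable_period(1) measurable_period(1) measurable_period_neg measurable_period_neg
        measurable_period(2) measurable_period(2) AE_period[OF A] AE_period[OF B], of Y]
    unfolding 1 2 3 by (simp add: kA_def kB_def period_conv_def)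
qed

lemma connected_slit_plane: "connected slit_plane"
proof -
  have "\<real>\<^sub>\<le>\<^sub>0 = complex_of_real ` {..0}" by (auto simp: nonpos_Reals_def)
  then show ?thesis
    using starlike_imp_connected[OF starlike_slotted_complex_plane_left[of 0]] by simp
qed

lemma unit_interval_islimpt: "complex_of_real (1/2) islimpt of_real ` {0<..<1}"
proof -
  have "(1/2::real) islimpt {0<..<1}" by (intro interior_limit_point) auto
  then show ?thesis
    by (rule islimpt_isCont_image) (auto simp: eventually_at_filter simp del: of_real_divide)
qed

lemma holomorphic_eq_of_unit_interval:
  assumes "f holomorphic_on S" "g holomorphic_on S" "open S" "connected S"
    and "complex_of_real ` {0<..<1} \<subseteq> S"
    and "\<And>x. 0 < x \<Longrightarrow> x < 1 \<Longrightarrow> f (of_real x) = g (of_real x)" and "z \<in> S"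
  shows "f z = g z"
proof -
  have "f z - g z = 0"
  proof (rule analytic_continuation[where f="\<lambda>z. f z - g z" and S=S and U="of_real ` {0<..<1}" and \<xi>="of_real (1/2)"])
    show "complex_of_real (1/2) \<in> S" using assms(5) by (rule subsetD) (rule imageI, simp)
  qed (use assms unit_interval_islimpt in \<open>auto intro!: holomorphic_intros simp del: of_real_divide\<close>)
  then show ?thesis by simp
qed

lemma of_real_unit_interval_subset: "complex_of_real ` {0<..<1} \<subseteq> slit_plane"
  by (auto simp: complex_nonpos_Reals_iff)

text \<open>The convolution identity is read at Y < 0. There \<open>period_conv\<close> is zero and
  the convolution of the negative parts is minus the left-hand side, so the identity can be solved
  for it. All terms are finite, so subtraction is legitimate, and the identity theorem extends the
  result from 0 < x < 1.\<close>

lemma vanishing_period_eq: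
  assumes A: "0 < A" "A < 1" and B: "0 < B" "B < 1" and x: "x \<in> slit_plane"
  defines "\<kappa>A \<equiv> (sin (pi * A) / pi) ^ 2" and "\<kappa>B \<equiv> (sin (pi * B) / pi) ^ 2"
  shows "vanishing_period A B x =
     of_real (\<kappa>A + \<kappa>B) * log_stieltjes (period_conv A B) 1 x
     - of_real (\<kappa>A * \<kappa>B) * (log_stieltjes (period_conv A B) 3 x / 6
         + 2 * of_real pi ^ 2 / 3 * log_stieltjes (period_conv A B) 1 x)"
proof (rule holomorphic_eq_of_unit_interval[OF _ _ open_slit_plane connected_slit_plane of_real_unit_interval_subset _ x])
  note T = tempered_period_conv[OF A B]
  show "vanishing_period A B holomorphic_on slit_plane"
    using A B by (rule holomorphic_on_vanishing_period)
  show "(\<lambda>x. of_real (\<kappa>A + \<kappa>B) * log_stieltjes (period_conv A B) 1 x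
     - of_real (\<kappa>A * \<kappa>B) * (log_stieltjes (period_conv A B) 3 x / 6
         + 2 * of_real pi ^ 2 / 3 * log_stieltjes (period_conv A B) 1 x)) holomorphic_on slit_plane"
    by (intro holomorphic_intros holomorphic_on_log_stieltjes T) auto
  fix x :: real assume x: "0 < x" "x < 1"
  define Y where "Y = ln x"
  have Y: "Y < 0" "exp Y = x" using x by (auto simp: Y_def)
  define u where "u = enn2real (conv (period_conv A B) log_ker Y)"
  define v where "v = enn2real (conv (period_conv A B) log_ker3 Y)"
  have u: "conv (period_conv A B) log_ker Y = ennreal u"
    using conv_tempered_log_ker(1)[OF T, of Y] by (simp add: u_def)
  have v: "conv (period_conv A B) log_ker3 Y = ennreal v"
    using conv_tempered_log_ker3(1)[OF T, of Y] by (simp add: v_def)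
  have nn: "u \<ge> 0" "v \<ge> 0" "\<kappa>A \<ge> 0" "\<kappa>B \<ge> 0" by (auto simp: u_def v_def \<kappa>A_def \<kappa>B_def)
  have J: "period_segment A B Y \<ge> 0"
    unfolding period_segment_def by (intro integral_nonneg_AE) auto
  then have J': "- Y * period_segment A B Y \<ge> 0" using Y by (intro mult_nonneg_nonneg) auto
  have "ennreal \<kappa>A * ennreal u + ennreal \<kappa>B * ennreal u + ennreal (- Y * period_segment A B Y)
      = ennreal \<kappa>A * ennreal \<kappa>B * ennreal v"
    using period_conv_identity[OF A B, of Y] period_conv_nonpos[of Y A B] Y(1)
    unfolding u v conv_period_neg[OF A B Y(1)] \<kappa>A_def \<kappa>B_def by simp
  then have "ennreal (\<kappa>A * u + \<kappa>B * u + - Y * period_segment A B Y) = ennreal (\<kappa>A * \<kappa>B * v)"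
    using nn J' by (simp only: ennreal_mult ennreal_plus mult_nonneg_nonneg add_nonneg_nonneg)
  then have "\<kappa>A * u + \<kappa>B * u + - Y * period_segment A B Y = \<kappa>A * \<kappa>B * v"
    by (rule ennreal_inj[THEN iffD1, rotated -1]) (intro add_nonneg_nonneg mult_nonneg_nonneg nn J')+
  then have "Y * period_segment A B Y = (\<kappa>A + \<kappa>B) * u - \<kappa>A * \<kappa>B * v" by (simp add: algebra_simps)
  then have "vanishing_period A B (of_real (exp Y)) = of_real (\<kappa>A + \<kappa>B) * of_real u - of_real (\<kappa>A * \<kappa>B) * of_real v"
    unfolding vanishing_period_of_real[OF A B] by (simp only: of_real_mult of_real_diff)
  then show "vanishing_period A B (of_real x) =
     of_real (\<kappa>A + \<kappa>B) * log_stieltjes (period_conv A B) 1 (of_real x)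
     - of_real (\<kappa>A * \<kappa>B) * (log_stieltjes (period_conv A B) 3 (of_real x) / 6
         + 2 * of_real pi ^ 2 / 3 * log_stieltjes (period_conv A B) 1 (of_real x))"
    unfolding u_def v_def conv_tempered_log_ker(2)[OF T] conv_tempered_log_ker3(2)[OF T] Y(2) .
qed

section \<open>The logarithmic singularity at x = 1\<close>

lemma integrable_exp_minus_indicator: "integrable lborel (\<lambda>y. indicator {0..} y * exp (- y) :: real)"
proof (rule integrableI_nn_integral_finite[where x=1])
  have "(\<integral>\<^sup>+y. ennreal (exp (- y)) * indicator {0..} y \<partial>lborel) = ennreal (0 - (- exp (- 0)))"
  proof (rule nn_integral_FTC_atLeast)
    show "((\<lambda>y::real. - exp (- y)) \<longlongrightarrow> 0) at_top"
      using tendsto_minus[OF filterlim_compose[OF exp_at_bot filterlim_uminus_at_bot_at_top]] by simp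
  qed (auto intro!: derivative_eq_intros)
  then show "(\<integral>\<^sup>+y. ennreal (indicator {0..} y * exp (- y)) \<partial>lborel) = ennreal 1"
    by (simp add: ennreal_mult' ennreal_indicator mult.commute)
qed auto

text \<open>
  What is left of the Stieltjes transform after subtracting the value at the pole from the density,
  with the kernel \<open>e\<^sup>y / (x - e\<^sup>y) = (x + 1) e\<^sup>y / ((e\<^sup>y + 1) (x - e\<^sup>y)) - e\<^sup>y / (e\<^sup>y + 1)\<close> split so that the
  subtracted term is integrable at infinity.
\<close>

definition stieltjes_regular :: "real \<Rightarrow> real \<Rightarrow> complex \<Rightarrow> complex" where
  "stieltjes_regular A B x =
     (\<integral>y. indicator {0<..} y *\<^sub>R ((of_real (enn2real (period_conv A B y)) - vanishing_period A B x)
        * (x + 1) * of_real (exp y / (exp y + 1))) / (x - of_real (exp y)) \<partial>lborel)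
     - of_real (\<integral>y. enn2real (period_conv A B y) * (exp y / (exp y + 1)) \<partial>lborel)
     - of_real (ln 2) * vanishing_period A B x"

lemma holomorphic_on_stieltjes_regular:
  assumes A: "0 < A" "A < 1" and B: "0 < B" "B < 1"
  shows "stieltjes_regular A B holomorphic_on slit_plane"
proof -
  note T = tempered_period_conv[OF A B]
  note hol = holomorphic_on_vanishing_period[OF A B]
  have "(\<lambda>x. \<integral>y. indicator {0<..} y *\<^sub>R ((of_real (enn2real (period_conv A B y)) - vanishing_period A B x)
        * (x + 1) * of_real (exp y / (exp y + 1))) / (x - of_real (exp y)) \<partial>lborel) holomorphic_on slit_plane"
  proof (rule holomorphic_on_removable_integral[OF open_slit_plane])
    fix y :: real
    show "(\<lambda>x. indicator {0<..} y *\<^sub>R ((of_real (enn2real (period_conv A B y)) - vanishing_period A B x)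
        * (x + 1) * of_real (exp y / (exp y + 1)))) holomorphic_on slit_plane"
      by (intro holomorphic_intros hol)
    \<comment> \<open>The subtracted term is the density itself at the pole x = e^y, so the
      numerator vanishes there; for y \<le> 0 the indicator does the same.\<close>
    have "vanishing_period A B (of_real (exp y)) = of_real (enn2real (period_conv A B y))" if "y > 0"
    proof -
      have "period_segment A B y \<ge> 0"
        unfolding period_segment_def by (intro integral_nonneg_AE) auto
      then show ?thesis
        unfolding vanishing_period_of_real[OF A B] period_conv_pos[OF A B that] using that by simp
    qed
    then show "indicator {0<..} y *\<^sub>R ((of_real (enn2real (period_conv A B y)) - vanishing_period A B (of_real (exp y)))
        * (of_real (exp y) + 1) * of_real (exp y / (exp y + 1))) = (0 :: complex)"
      by (auto simp: indicator_def simp del: of_real_exp)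
  next
    fix x0 :: complex assume "x0 \<in> slit_plane"
    then obtain r where r: "r > 0" "cball x0 r \<subseteq> slit_plane"
      using open_slit_plane open_contains_cball by blast
    have "compact (vanishing_period A B ` cball x0 r)"
      using r(2) by (intro compact_continuous_image holomorphic_on_imp_continuous_on holomorphic_on_subset[OF hol]) auto
    then obtain M where M: "\<And>x. x \<in> cball x0 r \<Longrightarrow> norm (vanishing_period A B x) \<le> M"
      by (meson bounded_iff compact_imp_bounded imageI)
    define K where "K = norm x0 + r + 1"
    \<comment> \<open>The second summand pays for the part of the numerator that does not decay in
      y: e^(-y) times the permitted factor 1 + e^y is at least 1.\<close>
    define G where "G = (\<lambda>y. K * (enn2real (period_conv A B y) * (1 + \<bar>y\<bar>) ^ 0) + K * M * (indicator {0..} y * exp (- y)))"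
    have M0: "M \<ge> 0" using M[of x0] r(1) by (auto intro: order_trans[OF norm_ge_zero])
    have K0: "K \<ge> 0" using r(1) by (simp add: K_def add_nonneg_nonneg)
    have Gi: "integrable lborel G"
      unfolding G_def
      by (intro Bochner_Integration.integrable_add integrable_mult_right impI
          integrable_tempered_poly[OF T] integrable_exp_minus_indicator)
    have "norm (indicator {0<..} y *\<^sub>R ((of_real (enn2real (period_conv A B y)) - vanishing_period A B x)
        * (x + 1) * of_real (exp y / (exp y + 1)))) \<le> G y * (1 + norm (complex_of_real (exp y)))"
      if x: "x \<in> cball x0 r" for x y
    proof (cases "y > 0")
      case True
      have "norm (x + 1) \<le> K"
        using x norm_triangle_ineq[of x 1] norm_triangle_ineq2[of x x0]
        by (simp add: K_def dist_norm norm_minus_commute)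
      moreover have "norm (of_real (enn2real (period_conv A B y)) - vanishing_period A B x) \<le> enn2real (period_conv A B y) + M"
        using M[OF x] norm_triangle_ineq4[of "of_real (enn2real (period_conv A B y))" "vanishing_period A B x"] by simp
      moreover have "norm (complex_of_real (exp y / (exp y + 1))) \<le> 1"
        unfolding norm_of_real by (simp add: add_pos_pos divide_le_eq abs_of_pos)
      ultimately have "norm ((of_real (enn2real (period_conv A B y)) - vanishing_period A B x) * (x + 1) * of_real (exp y / (exp y + 1)))
          \<le> (enn2real (period_conv A B y) + M) * K * 1"
        unfolding norm_mult using K0 M0 by (intro mult_mono) auto
      also have "\<dots> = K * enn2real (period_conv A B y) + K * M" by (simp add: algebra_simps)
      also have "\<dots> \<le> K * enn2real (period_conv A B y) * (1 + exp y) + K * M * exp (- y) * (1 + exp y)"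
      proof (rule add_mono)
        show "K * enn2real (period_conv A B y) \<le> K * enn2real (period_conv A B y) * (1 + exp y)"
          using K0 mult_left_mono[of 1 "1 + exp y" "K * enn2real (period_conv A B y)"] by simp
        have "1 \<le> exp (- y) * (1 + exp y)" by (simp add: distrib_left exp_minus)
        from mult_left_mono[OF this, of "K * M"] show "K * M \<le> K * M * exp (- y) * (1 + exp y)"
          using K0 M0 by (simp add: mult.assoc)
      qed
      finally show ?thesis using True by (simp add: G_def algebra_simps)
    next
      case False
      then show ?thesis using K0 M0 by (simp add: G_def)
    qed
    then show "\<exists>r>0. \<exists>G. cball x0 r \<subseteq> slit_plane \<and> integrable lborel G \<and>
        (\<forall>x\<in>cball x0 r. \<forall>y\<in>space lborel. norm (indicator {0<..} y *\<^sub>R ((of_real (enn2real (period_conv A B y)) - vanishing_period A B x)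
        * (x + 1) * of_real (exp y / (exp y + 1)))) \<le> G y * (1 + norm (complex_of_real (exp y))))"
      using r Gi by blast
  qed (auto intro: AE_exp_neq)
  then show ?thesis
    unfolding stieltjes_regular_def by (intro holomorphic_intros hol)
qed

text \<open>An antiderivative is ln ((e^y - x) / (e^y + 1)), running from ln ((1 - x) / 2) to 0. The
  term ln (1 - x) is the singular part sought, and ln 2 is the correction built into
  \<open>stieltjes_regular\<close>.\<close>

lemma has_bochner_integral_cauchy_kernel:
  assumes x: "0 < x" "x < 1"
  shows "has_bochner_integral lborel
    (\<lambda>y. indicator {0<..} y * ((x + 1) * (exp y / (exp y + 1)) / (exp y - x))) (ln 2 - ln (1 - x :: real))"
proof (rule has_bochner_integral_nn_integral)
  let ?f = "\<lambda>y. (x + 1) * (exp y / (exp y + 1)) / (exp y - x)"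
  let ?F = "\<lambda>y. ln (1 - (x + 1) / (exp y + 1))"
  have pos: "exp y - x > 0" if "y \<ge> 0" for y :: real
    using one_le_exp_iff[of y] that x by linarith
  have "(\<integral>\<^sup>+y. ennreal (?f y) * indicator {0..} y \<partial>lborel) = ennreal (0 - ?F 0)"
  proof (rule nn_integral_FTC_atLeast)
    fix y :: real assume y: "0 \<le> y"
    have p: "exp y + 1 > 0" by (simp add: add_pos_pos)
    have e: "1 - (x + 1) / (exp y + 1) = (exp y - x) / (exp y + 1)" using p by (simp add: field_simps)
    have q: "1 - (x + 1) / (exp y + 1) > 0" unfolding e using pos[OF y] p by simp
    have "(?F has_real_derivative ((x + 1) * exp y / (exp y + 1) ^ 2) / (1 - (x + 1) / (exp y + 1))) (at y)"
      using p q by (auto intro!: derivative_eq_intros simp: power2_eq_square)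
    also have "((x + 1) * exp y / (exp y + 1) ^ 2) / (1 - (x + 1) / (exp y + 1)) = ?f y"
      unfolding e using p pos[OF y] by (simp add: power2_eq_square)
    finally show "(?F has_real_derivative ?f y) (at y)" .
    show "0 \<le> ?f y" using pos[OF y] p x by simp
  next
    have "filterlim (\<lambda>y::real. exp y + 1) at_top at_top"
      using filterlim_tendsto_add_at_top[OF tendsto_const[of 1] exp_at_top] by (simp add: add.commute)
    then have "((\<lambda>y::real. (x + 1) / (exp y + 1)) \<longlongrightarrow> 0) at_top"
      by (intro real_tendsto_divide_at_top[OF tendsto_const])
    then have "((\<lambda>y::real. 1 - (x + 1) / (exp y + 1)) \<longlongrightarrow> 1 - 0) at_top"
      by (intro tendsto_diff tendsto_const)
    then have "(?F \<longlongrightarrow> ln (1 - 0)) at_top" by (rule tendsto_ln) simp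
    then show "(?F \<longlongrightarrow> 0) at_top" by simp
  qed measurable
  moreover have "(\<integral>\<^sup>+y. ennreal (indicator {0<..} y * ?f y) \<partial>lborel) = (\<integral>\<^sup>+y. ennreal (?f y) * indicator {0..} y \<partial>lborel)"
    by (rule nn_integral_cong_AE, rule eventually_mono[OF AE_lborel_singleton[of "0::real"]]) (auto simp: indicator_def)
  moreover have "0 - ?F 0 = ln 2 - ln (1 - x)"
  proof -
    have e: "1 - (x + 1) / (exp 0 + 1) = (1 - x) / 2" by (simp add: field_simps)
    have "ln ((1 - x) / 2) = ln (1 - x) - ln 2" using x by (simp add: ln_div)
    then show ?thesis unfolding e by simp
  qed
  ultimately show "(\<integral>\<^sup>+y. ennreal (indicator {0<..} y * ?f y) \<partial>lborel) = ennreal (ln 2 - ln (1 - x))" by simp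
  show "AE y in lborel. 0 \<le> indicator {0<..} y * ?f y"
    using pos x by (intro AE_I2) (auto simp: indicator_def intro!: divide_nonneg_nonneg mult_nonneg_nonneg add_nonneg_nonneg less_imp_le[OF pos])
  show "0 \<le> ln 2 - ln (1 - x)" using x by simp
qed measurable

text \<open>For 0 < x < 1 the pole y = ln x lies outside the support y > 0, so the pieces of the
  split kernel are separately integrable and can be recombined.\<close>

lemma log_stieltjes_0_eq:
  assumes A: "0 < A" "A < 1" and B: "0 < B" "B < 1" and x: "0 < x" "x < 1"
  shows "log_stieltjes (period_conv A B) 0 (of_real x)
     = stieltjes_regular A B (of_real x) + vanishing_period A B (of_real x) * Ln (1 - of_real x)"
proof -
  note T = tempered_period_conv[OF A B]
  define g where "g = (\<lambda>y. enn2real (period_conv A B y))"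
  have [measurable]: "g \<in> borel_measurable borel" unfolding g_def by measurable
  define w where "w = vanishing_period A B (of_real x)"
  have g0: "g y = 0" if "y \<le> 0" for y using that by (simp add: g_def period_conv_nonpos)
  have gi: "integrable lborel g" using integrable_tempered_poly[OF T, of 0 0] by (simp add: g_def)
  let ?k = "\<lambda>y. (x + 1) * (exp y / (exp y + 1)) / (exp y - x)"
  have pos: "exp y - x \<ge> (1 - x) * exp y" "exp y - x > 0" if "y \<ge> 0" for y :: real
  proof -
    have "exp y \<ge> 1" using that by simp
    then have "x * exp y \<ge> x * 1" using x by (intro mult_left_mono) auto
    then show "exp y - x \<ge> (1 - x) * exp y" by (simp add: algebra_simps)
    show "exp y - x > 0" using \<open>exp y \<ge> 1\<close> x by linarith
  qed
  have i1: "integrable lborel (\<lambda>y. g y * exp y / (x - exp y))"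
  proof (rule Bochner_Integration.integrable_bound)
    show "integrable lborel (\<lambda>y. g y * (1 / (1 - x)))" using gi by simp
    show "AE y in lborel. norm (g y * exp y / (x - exp y)) \<le> norm (g y * (1 / (1 - x)))"
    proof (rule AE_I2)
      fix y :: real
      show "norm (g y * exp y / (x - exp y)) \<le> norm (g y * (1 / (1 - x)))"
      proof (cases "y \<le> 0")
        case False
        then have p: "exp y - x \<ge> (1 - x) * exp y" "exp y - x > 0" using pos[of y] by auto
        have "exp y / (exp y - x) \<le> 1 / (1 - x)"
          using p x by (simp add: divide_simps mult.commute)
        then have "\<bar>g y\<bar> * (exp y / (exp y - x)) \<le> \<bar>g y\<bar> * (1 / (1 - x))" by (intro mult_left_mono) auto
        moreover have "\<bar>x - exp y\<bar> = exp y - x" using p by simp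
        ultimately show ?thesis using x by (simp add: abs_mult)
      qed (simp add: g0)
    qed
  qed measurable
  have i2: "integrable lborel (\<lambda>y. g y * (exp y / (exp y + 1)))"
  proof (rule Bochner_Integration.integrable_bound[OF gi])
    show "AE y in lborel. norm (g y * (exp y / (exp y + 1))) \<le> norm (g y)"
    proof (rule AE_I2)
      fix y :: real
      have "\<bar>exp y / (exp y + 1)\<bar> \<le> 1" by (simp add: add_pos_pos divide_le_eq abs_of_pos)
      then show "norm (g y * (exp y / (exp y + 1))) \<le> norm (g y)"
        using mult_left_mono[of _ 1 "\<bar>g y\<bar>"] by (fastforce simp: abs_mult)
    qed
  qed measurable
  note i3 = has_bochner_integral_cauchy_kernel[OF x]
  have h1: "has_bochner_integral lborel (\<lambda>y. complex_of_real (g y * exp y / (x - exp y))) (log_stieltjes (period_conv A B) 0 (of_real x))"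
  proof -
    have "log_stieltjes (period_conv A B) 0 (of_real x) = of_real (\<integral>y. g y * exp y / (x - exp y) \<partial>lborel)"
      unfolding log_stieltjes_def g_def[symmetric] integral_complex_of_real[symmetric]
      by (intro Bochner_Integration.integral_cong) (simp_all only: power_0 mult_1_right of_real_mult of_real_divide of_real_diff g_def)
    moreover have "has_bochner_integral lborel (\<lambda>y. complex_of_real (g y * exp y / (x - exp y)))
        (complex_of_real (\<integral>y. g y * exp y / (x - exp y) \<partial>lborel))"
      by (rule has_bochner_integral_of_real[OF has_bochner_integral_integrable[OF i1]])
    ultimately show ?thesis by (simp only:)
  qed
  have h2: "has_bochner_integral lborel (\<lambda>y. complex_of_real (g y * (exp y / (exp y + 1))))
      (of_real (\<integral>y. g y * (exp y / (exp y + 1)) \<partial>lborel))"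
    by (rule has_bochner_integral_of_real[OF has_bochner_integral_integrable[OF i2]])
  have h3: "has_bochner_integral lborel (\<lambda>y. w * complex_of_real (indicator {0<..} y * ?k y)) (w * of_real (ln 2 - ln (1 - x)))"
    by (intro has_bochner_integral_mult_right has_bochner_integral_of_real i3)
  have "has_bochner_integral lborel (\<lambda>y. complex_of_real (g y * exp y / (x - exp y)) + complex_of_real (g y * (exp y / (exp y + 1)))
       + w * complex_of_real (indicator {0<..} y * ?k y))
     (log_stieltjes (period_conv A B) 0 (of_real x) + of_real (\<integral>y. g y * (exp y / (exp y + 1)) \<partial>lborel) + w * of_real (ln 2 - ln (1 - x)))"
    by (intro has_bochner_integral_add h1 h2 h3)
  also have "(\<lambda>y. complex_of_real (g y * exp y / (x - exp y)) + complex_of_real (g y * (exp y / (exp y + 1)))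
       + w * complex_of_real (indicator {0<..} y * ?k y))
    = (\<lambda>y. indicator {0<..} y *\<^sub>R ((of_real (g y) - w) * (of_real x + 1) * of_real (exp y / (exp y + 1))) / (of_real x - of_real (exp y)))"
  proof
    fix y :: real
    show "complex_of_real (g y * exp y / (x - exp y)) + complex_of_real (g y * (exp y / (exp y + 1)))
       + w * complex_of_real (indicator {0<..} y * ?k y)
     = indicator {0<..} y *\<^sub>R ((of_real (g y) - w) * (of_real x + 1) * of_real (exp y / (exp y + 1))) / (of_real x - of_real (exp y))"
    proof (cases "y > 0")
      case True
      define t where "t = exp y"
      have t: "t + 1 \<noteq> 0" "x - t \<noteq> 0" "t - x \<noteq> 0" using pos[of y] True by (auto simp: t_def add_pos_pos less_imp_neq[symmetric] dest: less_imp_neq)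
      have "g y * t / (x - t) + g y * (t / (t + 1)) = g y * ((x + 1) * (t / (t + 1)) / (x - t))"
        using t by (simp add: divide_simps) (simp add: algebra_simps)
      moreover have "(x + 1) * (t / (t + 1)) / (t - x) = - ((x + 1) * (t / (t + 1)) / (x - t))"
        using minus_divide_right[of "(x + 1) * (t / (t + 1))" "t - x"] by simp
      ultimately have "complex_of_real (g y * t / (x - t)) + complex_of_real (g y * (t / (t + 1)))
         + w * complex_of_real ((x + 1) * (t / (t + 1)) / (t - x))
        = (of_real (g y) - w) * of_real ((x + 1) * (t / (t + 1)) / (x - t))"
        unfolding of_real_add[symmetric] by (simp only: of_real_mult of_real_minus left_diff_distrib mult_minus_right add_uminus_conv_diff)
      then show ?thesis using True by (simp add: t_def[symmetric])
    qed (simp add: g0)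
  qed
  finally have I: "(\<integral>y. indicator {0<..} y *\<^sub>R ((of_real (g y) - w) * (of_real x + 1) * of_real (exp y / (exp y + 1))) / (of_real x - of_real (exp y)) \<partial>lborel)
    = log_stieltjes (period_conv A B) 0 (of_real x) + of_real (\<integral>y. g y * (exp y / (exp y + 1)) \<partial>lborel) + w * of_real (ln 2 - ln (1 - x))"
    by (rule has_bochner_integral_integral_eq)
  have gy: "enn2real (period_conv A B y) = g y" for y by (simp add: g_def)
  have "stieltjes_regular A B (of_real x) = log_stieltjes (period_conv A B) 0 (of_real x) - w * of_real (ln (1 - x))"
    unfolding stieltjes_regular_def gy w_def[symmetric] I by (simp add: algebra_simps)
  moreover have "Ln (1 - of_real x) = of_real (ln (1 - x))"
    using x Ln_of_real[of "1 - x"] by simp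
  ultimately show ?thesis by (simp add: w_def)
qed

subsection \<open>The Frobenius basis from moments\<close>

locale period_data =
  fixes A B :: real and C :: nat
  assumes A: "0 < A" "A < 1" and B: "0 < B" "B < 1" and C: "0 < C"
begin

lemma tempered_period_density: "tempered (period_conv A B)"
  using A B by (rule tempered_period_conv)

definition log_moment :: "nat \<Rightarrow> nat \<Rightarrow> real" where
  "log_moment j n = (\<integral>y. enn2real (period_conv A B y) * exp (- (real n * y)) * (ln (real C) - y) ^ j \<partial>lborel)"

text \<open>Row n of this sequence is the expansion in epsilon of C^(n + epsilon) times the Laplace
  transform of \<open>X\<close> at n + epsilon; \<open>gamma_fun_has_fps_expansion\<close> makes
  this precise.\<close>

definition period_series :: "nat \<Rightarrow> complex fps" where
  "period_series j = Abs_fps (\<lambda>n. of_real (real C ^ n * log_moment j n / fact j))"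

lemma integrable_log_moment:
  "integrable lborel (\<lambda>y. enn2real (period_conv A B y) * exp (- (real n * y)) * (ln (real C) - y) ^ j)"
  and abs_log_moment_le:
  "\<bar>log_moment j n\<bar> \<le> (\<integral>y. enn2real (period_conv A B y) * (\<bar>ln (real C)\<bar> + \<bar>y\<bar>) ^ j \<partial>lborel)"
proof -
  let ?f = "\<lambda>y. enn2real (period_conv A B y) * exp (- (real n * y)) * (ln (real C) - y) ^ j"
  let ?g = "\<lambda>y. enn2real (period_conv A B y) * (\<bar>ln (real C)\<bar> + \<bar>y\<bar>) ^ j"
  have gi: "integrable lborel ?g" by (rule integrable_tempered_poly[OF tempered_period_density])
  have le: "norm (?f y) \<le> ?g y" for y
  proof (cases "y \<le> 0")
    case False
    have "exp (- (real n * y)) \<le> 1" using False by simp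
    moreover have "\<bar>ln (real C) - y\<bar> ^ j \<le> (\<bar>ln (real C)\<bar> + \<bar>y\<bar>) ^ j" by (intro power_mono) auto
    ultimately have "exp (- (real n * y)) * \<bar>ln (real C) - y\<bar> ^ j \<le> 1 * (\<bar>ln (real C)\<bar> + \<bar>y\<bar>) ^ j"
      by (intro mult_mono) auto
    then have "enn2real (period_conv A B y) * (exp (- (real n * y)) * \<bar>ln (real C) - y\<bar> ^ j)
        \<le> enn2real (period_conv A B y) * (1 * (\<bar>ln (real C)\<bar> + \<bar>y\<bar>) ^ j)"
      by (intro mult_left_mono) auto
    then show ?thesis by (simp add: abs_mult power_abs mult.assoc)
  qed (simp add: period_conv_nonpos)
  show fi: "integrable lborel ?f"
    by (rule Bochner_Integration.integrable_bound[OF gi]) (use le in \<open>auto intro!: AE_I2 intro: order_trans[OF _ abs_ge_self]\<close>)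
  show "\<bar>log_moment j n\<bar> \<le> (\<integral>y. ?g y \<partial>lborel)"
    unfolding log_moment_def
    using order_trans[OF integral_norm_bound integral_mono[OF integrable_norm[OF fi] gi le]]
    by (simp only: real_norm_def)
qed

text \<open>On the support e^(-n y) \<le> 1, so the log moments are bounded in n and the
  coefficients grow at most like C^n.\<close>

lemma conv_radius_period_series: "fps_conv_radius (period_series j) \<ge> ereal (1 / real C)"
  unfolding fps_conv_radius_def
proof (rule conv_radius_geI_ex')
  fix r :: real assume r: "0 < r" "ereal r < ereal (1 / real C)"
  define K where "K = (\<integral>y. enn2real (period_conv A B y) * (\<bar>ln (real C)\<bar> + \<bar>y\<bar>) ^ j \<partial>lborel)"
  have Cr: "real C * r < 1" "0 \<le> real C * r" using r C by (auto simp: field_simps)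
  show "summable (\<lambda>n. fps_nth (period_series j) n * of_real r ^ n)"
  proof (rule summable_comparison_test')
    show "summable (\<lambda>n. K * (real C * r) ^ n)" using Cr by (intro summable_mult summable_geometric) auto
    fix n :: nat
    have "\<bar>log_moment j n\<bar> / fact j \<le> K / 1"
      using abs_log_moment_le[of j n] fact_ge_1[of j, where 'a=real] unfolding K_def by (intro frac_le) (auto intro: order_trans[OF abs_ge_zero])
    then have "real C ^ n * r ^ n * (\<bar>log_moment j n\<bar> / fact j) \<le> real C ^ n * r ^ n * K"
      using r by (intro mult_left_mono) auto
    moreover have "norm (fps_nth (period_series j) n * of_real r ^ n) = real C ^ n * r ^ n * (\<bar>log_moment j n\<bar> / fact j)"
      using r unfolding period_series_def fps_nth_Abs_fps norm_mult norm_power norm_of_real by (simp add: abs_mult)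
    ultimately show "norm (fps_nth (period_series j) n * of_real r ^ n) \<le> K * (real C * r) ^ n"
      by (simp add: power_mult_distrib mult_ac)
  qed
qed

lemma slit_disc_eq: "slit_disc C = slit_ball (1 / real C)"
  by (simp add: slit_disc_def)

lemma eval_period_series_sums:
  assumes "norm z < 1 / real C"
  shows "(\<lambda>n. of_real (real C ^ n * log_moment j n / fact j) * z ^ n) sums eval_fps (period_series j) z"
proof -
  have "ereal (norm z) < fps_conv_radius (period_series j)"
    using assms conv_radius_period_series[of j] by (meson ereal_less(3) less_ereal.simps(1) less_le_trans)
  then have "summable (\<lambda>n. fps_nth (period_series j) n * z ^ n)"
    unfolding fps_conv_radius_def by (rule summable_in_conv_radius)
  then show ?thesis by (simp add: eval_fps_def period_series_def summable_sums del: of_real_mult of_real_divide of_real_power)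
qed

lemma binomial_exp_term:
  "(a + b :: complex) ^ k / fact k = (\<Sum>i\<le>k. b ^ i / fact i * (a ^ (k - i) / fact (k - i)))"
proof -
  have "(b + a) ^ k / fact k = (\<Sum>i\<le>k. of_nat (k choose i) * b ^ i * a ^ (k - i) / fact k)"
    unfolding binomial_ring by (simp add: sum_divide_distrib)
  also have "\<dots> = (\<Sum>i\<le>k. b ^ i / fact i * (a ^ (k - i) / fact (k - i)))"
    by (intro sum.cong) (auto simp: binomial_fact)
  finally show ?thesis by (simp add: add.commute)
qed

text \<open>With x = C z the kernel e^y / (x - e^y) is - 1 / (1 - x e^(-y)), a geometric series for
  |x| < 1 and y > 0. The power of Ln x - y = Ln z + (ln C - y) is expanded binomially, which
  separates the powers of Ln z from the log moments.\<close>

lemma log_stieltjes_eq_frob: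
  assumes z: "z \<in> slit_disc C"
  shows "- log_stieltjes (period_conv A B) k (of_nat C * z) / fact k = frob period_series k z"
proof -
  define g where "g = (\<lambda>y. enn2real (period_conv A B y))"
  have [measurable]: "g \<in> borel_measurable borel" unfolding g_def by measurable
  define x where "x = of_nat C * z"
  define l where "l = Ln z"
  define L where "L = complex_of_real (ln (real C))"
  have z0: "z \<noteq> 0" and nz: "norm z < 1 / real C" using z by (auto simp: slit_disc_def)
  have nx: "norm x < 1" using nz C by (simp add: x_def norm_mult field_simps)
  have lx: "Ln x = l + L"
    using Ln_times_of_real[of "real C" z] z0 C by (simp add: x_def l_def L_def add.commute)
  let ?t = "\<lambda>n y. of_real (g y) * of_real (exp (- (real n * y))) * ((l + L - of_real y) ^ k / fact k) * x ^ n"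
  let ?c = "\<lambda>n. \<Sum>i\<le>k. of_real (real C ^ n * log_moment i n / fact i) * z ^ n * (l ^ (k - i) / fact (k - i))"
  have xe: "norm (x * of_real (exp (- y))) \<le> norm x" if "y \<ge> 0" for y
    unfolding norm_mult norm_of_real using that by (intro mult_left_le) auto
  have term_eq: "?t n y = of_real (g y) * ((l + L - of_real y) ^ k / fact k) * (x * of_real (exp (- y))) ^ n" for n y
    by (simp add: power_mult_distrib exp_of_nat_mult[symmetric] of_real_power[symmetric] exp_minus power_inverse)
  have integral_t: "has_bochner_integral lborel (?t n) (?c n)" for n
  proof -
    have "has_bochner_integral lborel (\<lambda>y. \<Sum>i\<le>k. of_real (g y * exp (- (real n * y)) * (ln (real C) - y) ^ i) * (x ^ n / fact i * (l ^ (k - i) / fact (k - i))))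
       (\<Sum>i\<le>k. of_real (log_moment i n) * (x ^ n / fact i * (l ^ (k - i) / fact (k - i))))"
    proof (intro has_bochner_integral_sum has_bochner_integral_mult_left impI)
      fix i
      show "has_bochner_integral lborel (\<lambda>y. complex_of_real (g y * exp (- (real n * y)) * (ln (real C) - y) ^ i)) (of_real (log_moment i n))"
        unfolding log_moment_def g_def
        by (intro has_bochner_integral_of_real has_bochner_integral_integrable integrable_log_moment)
    qed
    also have "(\<lambda>y. \<Sum>i\<le>k. of_real (g y * exp (- (real n * y)) * (ln (real C) - y) ^ i) * (x ^ n / fact i * (l ^ (k - i) / fact (k - i)))) = ?t n"
    proof
      fix y
      have "(l + L - of_real y) ^ k / fact k = (\<Sum>i\<le>k. (of_real (ln (real C) - y)) ^ i / fact i * (l ^ (k - i) / fact (k - i)))"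
        using binomial_exp_term[of l "of_real (ln (real C) - y)" k] by (simp add: L_def add_diff_eq)
      then show "(\<Sum>i\<le>k. of_real (g y * exp (- (real n * y)) * (ln (real C) - y) ^ i) * (x ^ n / fact i * (l ^ (k - i) / fact (k - i)))) = ?t n y"
        by (simp add: sum_distrib_left sum_distrib_right mult_ac)
    qed
    also have "(\<Sum>i\<le>k. of_real (log_moment i n) * (x ^ n / fact i * (l ^ (k - i) / fact (k - i)))) = ?c n"
      by (simp add: x_def power_mult_distrib mult_ac)
    finally show ?thesis .
  qed
  have "?c sums frob period_series k z"
    unfolding frob_def l_def
    using eval_period_series_sums[OF nz] by (intro sums_sum) (simp only: times_divide_eq_right[symmetric] sums_mult2)
  moreover have "?c sums (- log_stieltjes (period_conv A B) k x / fact k)"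
    unfolding sums_def
  proof -
    define h where "h = (\<lambda>y. of_real (g y) * ((l + L - of_real y) ^ k / fact k))"
    have [measurable]: "h \<in> borel_measurable borel" unfolding h_def by measurable
    have "(\<lambda>N. \<integral>y. (\<Sum>n<N. ?t n y) \<partial>lborel) \<longlonglongrightarrow> (\<integral>y. h y / (1 - x * of_real (exp (- y))) \<partial>lborel)"
    \<comment> \<open>All partial sums of the geometric series are bounded by 2 / (1 - |x|),
      uniformly in y > 0.\<close>
    proof (rule integral_dominated_convergence[where w="\<lambda>y. g y * (norm (l + L) + \<bar>y\<bar>) ^ k * (2 / (1 - norm x))"])
      show "integrable lborel (\<lambda>y. g y * (norm (l + L) + \<bar>y\<bar>) ^ k * (2 / (1 - norm x)))"
        unfolding g_def by (intro integrable_mult_left integrable_tempered_poly tempered_period_density impI)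
      have geom: "(\<Sum>n<N. ?t n y) = h y * ((1 - (x * of_real (exp (- y))) ^ N) / (1 - x * of_real (exp (- y))))" if "y > 0" for N y
      proof -
        have "norm (x * of_real (exp (- y))) < 1" using xe[of y] that nx by simp
        then have ne: "x * of_real (exp (- y)) \<noteq> 1" by (metis less_irrefl norm_one)
        then show ?thesis
        proof -
          have "(\<Sum>n<N. ?t n y) = h y * (\<Sum>n<N. (x * of_real (exp (- y))) ^ n)"
            by (simp only: term_eq h_def sum_distrib_left)
          then show ?thesis using ne by (simp add: sum_gp_strict)
        qed
      qed
      show "AE y in lborel. (\<lambda>N. \<Sum>n<N. ?t n y) \<longlonglongrightarrow> h y / (1 - x * of_real (exp (- y)))"
      proof (rule AE_I2)
        fix y :: real
        show "(\<lambda>N. \<Sum>n<N. ?t n y) \<longlonglongrightarrow> h y / (1 - x * of_real (exp (- y)))"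
        proof (cases "y > 0")
          case True
          have "norm (x * of_real (exp (- y))) < 1" using xe[of y] True nx by simp
          then have "(\<lambda>N. h y * ((1 - (x * of_real (exp (- y))) ^ N) / (1 - x * of_real (exp (- y))))) \<longlonglongrightarrow>
             h y * ((1 - 0) / (1 - x * of_real (exp (- y))))"
            by (intro tendsto_intros LIMSEQ_power_zero) (auto simp: right_minus_eq dest: arg_cong[where f=norm])
          then show ?thesis using geom[OF True] by simp
        qed (simp add: h_def g_def period_conv_nonpos)
      qed
      show "AE y in lborel. norm (\<Sum>n<N. ?t n y) \<le> g y * (norm (l + L) + \<bar>y\<bar>) ^ k * (2 / (1 - norm x))" for N
      proof (rule AE_I2)
        fix y :: real
        show "norm (\<Sum>n<N. ?t n y) \<le> g y * (norm (l + L) + \<bar>y\<bar>) ^ k * (2 / (1 - norm x))"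
        proof (cases "y > 0")
          case True
          define q where "q = x * of_real (exp (- y))"
          have q: "norm q \<le> norm x" "norm q < 1" using xe[of y] True nx by (auto simp: q_def)
          have "norm (1 - q ^ N) \<le> 2"
            using norm_triangle_ineq4[of 1 "q ^ N"] power_le_one[of "norm q" N] q by (simp add: norm_power)
          moreover have "norm (1 - q) \<ge> 1 - norm x" using norm_triangle_ineq2[of 1 q] q by simp
          ultimately have 1: "norm ((1 - q ^ N) / (1 - q)) \<le> 2 / (1 - norm x)"
            using nx by (simp add: norm_divide frac_le)
          have "norm (l + L - of_real y) \<le> norm (l + L) + \<bar>y\<bar>"
            using norm_triangle_ineq4[of "l + L" "of_real y"] by simp
          then have "norm ((l + L - of_real y) ^ k / fact k) \<le> (norm (l + L) + \<bar>y\<bar>) ^ k / 1"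
            unfolding norm_divide norm_power by (intro frac_le power_mono) auto
          then have "norm (h y) \<le> g y * (norm (l + L) + \<bar>y\<bar>) ^ k"
            unfolding h_def norm_mult by (simp add: g_def mult_left_mono)
          then have "norm (h y) * norm ((1 - q ^ N) / (1 - q)) \<le> g y * (norm (l + L) + \<bar>y\<bar>) ^ k * (2 / (1 - norm x))"
            using 1 by (intro mult_mono) (auto simp: g_def)
          then show ?thesis unfolding geom[OF True] norm_mult q_def .
        qed (simp add: g_def period_conv_nonpos)
      qed
    qed measurable
    also have "(\<integral>y. h y / (1 - x * of_real (exp (- y))) \<partial>lborel) = - log_stieltjes (period_conv A B) k x / fact k"
    proof -
      have "h y / (1 - x * of_real (exp (- y))) =
         of_real (g y * exp y) * (Ln x - of_real y) ^ k / (x - of_real (exp y)) * (- 1 / fact k)" for y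
      proof -
        have "of_real (exp y) * (1 - x * of_real (exp (- y))) = of_real (exp y) - x"
          by (simp add: right_diff_distrib exp_minus)
        then have "h y / (1 - x * of_real (exp (- y))) = (of_real (exp y) * h y) / (of_real (exp y) - x)"
          by (metis exp_not_eq_zero mult_divide_mult_cancel_left of_real_eq_0_iff)
        also have "\<dots> = - ((of_real (exp y) * h y) / (x - of_real (exp y)))"
          by (metis minus_diff_eq minus_divide_right)
        finally show ?thesis by (simp add: h_def lx mult_ac)
      qed
      then have "(\<integral>y. h y / (1 - x * of_real (exp (- y))) \<partial>lborel)
          = (\<integral>y. of_real (g y * exp y) * (Ln x - of_real y) ^ k / (x - of_real (exp y)) \<partial>lborel) * (- 1 / fact k)"
        by (simp only: integral_mult_left_zero)
      also have "(\<integral>y. of_real (g y * exp y) * (Ln x - of_real y) ^ k / (x - of_real (exp y)) \<partial>lborel)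
          = log_stieltjes (period_conv A B) k x"
        by (simp only: log_stieltjes_def g_def)
      finally show ?thesis by simp
    qed
    also have "(\<lambda>N. \<integral>y. (\<Sum>n<N. ?t n y) \<partial>lborel) = (\<lambda>N. \<Sum>n<N. ?c n)"
      using integral_t by (intro ext has_bochner_integral_integral_eq has_bochner_integral_sum)
    finally show "(\<lambda>N. \<Sum>n<N. ?c n) \<longlonglongrightarrow> - log_stieltjes (period_conv A B) k x / fact k" .
  qed
  ultimately show ?thesis unfolding x_def by (rule sums_unique2[symmetric])
qed

section \<open>The Gamma quotient and its Taylor coefficients\<close>

text \<open>Half the distance from 0 to the nearest pole of the Gamma factors in the numerator; the
  half plane Re s > - margin contains a disc around each n = 0, 1, 2, ...\<close>

definition margin :: real where
  "margin = min (min A (1 - A)) (min B (1 - B)) / 2"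

lemma margin: "0 < margin" "margin < A" "margin < 1 - A" "margin < B" "margin < 1 - B"
  using A B by (auto simp: margin_def)

lemma integral_period_conv_exp:
  assumes "- margin < s"
  shows "(\<integral>y. enn2real (period_conv A B y) * exp (- s * y) \<partial>lborel) = gamma_ratio A B s"
proof -
  have s: "s + A > 0" "s + 1 - A > 0" "s + B > 0" "s + 1 - B > 0" using margin assms by linarith+
  have "(\<integral>\<^sup>+y. ennreal (enn2real (period_conv A B y) * exp (- s * y)) \<partial>lborel)
      = (\<integral>\<^sup>+y. period_conv A B y * ennreal (exp (- s * y)) \<partial>lborel)"
  proof (rule nn_integral_cong_AE)
    show "AE y in lborel. ennreal (enn2real (period_conv A B y) * exp (- s * y)) = period_conv A B y * ennreal (exp (- s * y))"
      using tempered_AE[OF tempered_period_density] by eventually_elim (simp only: ennreal_mult enn2real_nonneg exp_ge_zero)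
  qed
  also have "\<dots> = ennreal (gamma_ratio A B s)" using A B s by (rule nn_integral_period_conv_exp)
  finally have "has_bochner_integral lborel (\<lambda>y. enn2real (period_conv A B y) * exp (- s * y)) (gamma_ratio A B s)"
    using s by (intro has_bochner_integral_nn_integral)
      (auto simp: gamma_ratio_def intro!: divide_nonneg_nonneg mult_nonneg_nonneg less_imp_le[OF Gamma_real_pos])
  then show ?thesis by (rule has_bochner_integral_integral_eq)
qed

text \<open>The log moments are moments in the variable u = ln C - y, so the density is reflected
  about ln C before the moment series is applied; the reflection is also what supplies the factor
  C^e.\<close>

lemma log_moment_sums:
  obtains r where "r > 0" "r \<le> margin" "\<And>e. \<bar>e\<bar> < r \<Longrightarrow>
    (\<lambda>j. real C ^ n * log_moment j n / fact j * e ^ j) sums (exp ((real n + e) * ln (real C)) * gamma_ratio A B (real n + e))"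
proof -
  obtain d where d: "d > 0" "(\<integral>\<^sup>+y. ennreal (enn2real (period_conv A B y) * exp (d * \<bar>y\<bar>)) \<partial>lborel) < \<infinity>"
    using tempered_period_density by (rule tempered_exp_finite)
  define L where "L = ln (real C)"
  define w where "w = (\<lambda>y. enn2real (period_conv A B y) * exp (- (real n * y)))"
  define w' where "w' = (\<lambda>u. w (L - u))"
  have [measurable]: "w \<in> borel_measurable borel" "w' \<in> borel_measurable borel"
    unfolding w'_def w_def by measurable
  have nn: "0 \<le> w' u" for u by (simp add: w'_def w_def)
  have refl: "(\<integral>u. f (L - u) \<partial>lborel) = (\<integral>y. f y \<partial>lborel)" for f :: "real \<Rightarrow> real"
    using lborel_integral_real_affine[of "-1" f L] by simp
  have fin: "(\<integral>\<^sup>+u. ennreal (w' u * exp (d * \<bar>u\<bar>)) \<partial>lborel) < \<infinity>"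
  proof -
    have "(\<integral>\<^sup>+u. ennreal (w' u * exp (d * \<bar>u\<bar>)) \<partial>lborel) = (\<integral>\<^sup>+u. (\<lambda>y. ennreal (w y * exp (d * \<bar>L - y\<bar>))) (L - u) \<partial>lborel)"
      by (simp add: w'_def)
    also have "\<dots> = (\<integral>\<^sup>+y. ennreal (w y * exp (d * \<bar>L - y\<bar>)) \<partial>lborel)"
      by (rule nn_integral_reflect) measurable
    also have "\<dots> \<le> (\<integral>\<^sup>+y. ennreal (exp (d * \<bar>L\<bar>)) * ennreal (enn2real (period_conv A B y) * exp (d * \<bar>y\<bar>)) \<partial>lborel)"
    proof (rule nn_integral_mono)
      fix y :: real
      have "w y * exp (d * \<bar>L - y\<bar>) \<le> exp (d * \<bar>L\<bar>) * (enn2real (period_conv A B y) * exp (d * \<bar>y\<bar>))"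
      proof (cases "y \<le> 0")
        case False
        have "exp (- (real n * y)) \<le> 1" using False by simp
        then have "w y \<le> enn2real (period_conv A B y)" unfolding w_def by (intro mult_left_le) auto
        moreover have "exp (d * \<bar>L - y\<bar>) \<le> exp (d * \<bar>L\<bar>) * exp (d * \<bar>y\<bar>)"
        proof -
          have "d * \<bar>L - y\<bar> \<le> d * (\<bar>L\<bar> + \<bar>y\<bar>)" using d(1) by (intro mult_left_mono) auto
          then show ?thesis by (simp add: exp_add[symmetric] distrib_left)
        qed
        ultimately have "w y * exp (d * \<bar>L - y\<bar>) \<le> enn2real (period_conv A B y) * (exp (d * \<bar>L\<bar>) * exp (d * \<bar>y\<bar>))"
          by (intro mult_mono) auto
        then show ?thesis by (simp add: mult_ac)
      qed (simp add: w_def period_conv_nonpos)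
      then show "ennreal (w y * exp (d * \<bar>L - y\<bar>)) \<le> ennreal (exp (d * \<bar>L\<bar>)) * ennreal (enn2real (period_conv A B y) * exp (d * \<bar>y\<bar>))"
        by (subst ennreal_mult[symmetric]) (auto intro: ennreal_leI)
    qed
    also have "\<dots> = ennreal (exp (d * \<bar>L\<bar>)) * (\<integral>\<^sup>+y. ennreal (enn2real (period_conv A B y) * exp (d * \<bar>y\<bar>)) \<partial>lborel)"
      by (rule nn_integral_cmult) measurable
    also have "\<dots> < \<infinity>" using d(2) by (simp add: ennreal_mult_less_top)
    finally show ?thesis .
  qed
  show thesis
  proof (rule that[of "min d margin"])
    fix e assume e: "\<bar>e\<bar> < min d margin"
    have "(\<lambda>m. (\<integral>u. w' u * u ^ m \<partial>lborel) / fact m * e ^ m) sums (\<integral>u. w' u * exp (e * u) \<partial>lborel)"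
      using e by (intro exp_moment_series(4)[OF _ nn d(1) fin]) auto
    moreover have "(\<integral>u. w' u * u ^ m \<partial>lborel) = log_moment m n" for m
      using refl[of "\<lambda>y. w y * (L - y) ^ m"] by (simp add: w'_def log_moment_def w_def L_def)
    moreover have "(\<integral>u. w' u * exp (e * u) \<partial>lborel) = exp (e * L) * gamma_ratio A B (real n + e)"
    proof -
      have "(\<integral>u. w' u * exp (e * u) \<partial>lborel) = (\<integral>y. w y * exp (e * (L - y)) \<partial>lborel)"
        using refl[of "\<lambda>y. w y * exp (e * (L - y))"] by (simp add: w'_def)
      also have "\<dots> = (\<integral>y. exp (e * L) * (enn2real (period_conv A B y) * exp (- (real n + e) * y)) \<partial>lborel)"
      proof (rule Bochner_Integration.integral_cong)
        fix y
        have "exp (- (real n * y)) * exp (e * (L - y)) = exp (e * L) * exp (- (real n + e) * y)"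
          by (simp add: exp_add[symmetric] algebra_simps)
        then show "w y * exp (e * (L - y)) = exp (e * L) * (enn2real (period_conv A B y) * exp (- (real n + e) * y))"
          by (simp add: w_def mult_ac)
      qed simp
      also have "\<dots> = exp (e * L) * gamma_ratio A B (real n + e)"
      proof -
        have "- margin < real n + e" using e by (simp add: abs_less_iff)
        then show ?thesis
          unfolding integral_mult_right_zero by (simp only: integral_period_conv_exp)
      qed
      finally show ?thesis .
    qed
    ultimately have "(\<lambda>m. real C ^ n * (log_moment m n / fact m * e ^ m)) sums (real C ^ n * (exp (e * L) * gamma_ratio A B (real n + e)))"
      by (intro sums_mult) simp
    moreover have "real C ^ n * exp (e * L) = exp ((real n + e) * L)"
      using C by (simp add: distrib_right exp_add L_def exp_of_nat_mult)
    ultimately show "(\<lambda>j. real C ^ n * log_moment j n / fact j * e ^ j) sums (exp ((real n + e) * ln (real C)) * gamma_ratio A B (real n + e))"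
      by (simp add: L_def mult.assoc[symmetric])
  qed (use d margin in auto)
qed

definition gamma_fun :: "complex \<Rightarrow> complex" where
  "gamma_fun s = exp (s * of_real (ln (real C))) * (Gamma (s + of_real A) * Gamma (s + of_real (1 - A))
     * Gamma (s + of_real B) * Gamma (s + of_real (1 - B))) / Gamma (s + 1) ^ 4"

lemma not_nonpos_Int_of_Re: "Re z > 0 \<Longrightarrow> z \<notin> \<int>\<^sub>\<le>\<^sub>0"
  by (auto elim!: nonpos_Ints_cases)

lemma Re_gamma_args:
  assumes "- margin < Re s"
  shows "Re (s + of_real A) > 0" "Re (s + of_real (1 - A)) > 0" "Re (s + of_real B) > 0" "Re (s + of_real (1 - B)) > 0"
    "Re (s + 1) > 0" "Re (s + 1 + 1) > 0"
  using assms margin A by auto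

lemma gamma_fun_of_real: "gamma_fun (of_real s) = of_real (exp (s * ln (real C)) * gamma_ratio A B s)"
proof -
  have "Gamma (complex_of_real s + of_real u) = of_real (Gamma (s + u))" for u
    using Gamma_complex_of_real[of "s + u"] by simp
  moreover have "Gamma (complex_of_real s + 1) = of_real (Gamma (s + 1))"
    using Gamma_complex_of_real[of "s + 1"] by simp
  ultimately show ?thesis
    by (simp add: gamma_fun_def gamma_ratio_def exp_of_real[symmetric] add_diff_eq del: of_real_diff)
qed

lemma gamma_fun_holomorphic: "gamma_fun holomorphic_on {s. - margin < Re s}"
proof -
  have "Re s > - margin \<Longrightarrow> Gamma (s + 1) \<noteq> 0" for s
    using Re_gamma_args(5)[of s] not_nonpos_Int_of_Re[of "s + 1"] by (simp add: Gamma_eq_zero_iff)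
  then show ?thesis
    unfolding gamma_fun_def
    by (intro holomorphic_intros) (use Re_gamma_args not_nonpos_Int_of_Re in \<open>auto simp del: of_real_diff\<close>)
qed

text \<open>The moment series is known to sum to the Gamma quotient for real arguments only; both
  sides are holomorphic near 0, so they agree as germs.\<close>

lemma gamma_fun_has_fps_expansion:
  "(\<lambda>e. gamma_fun (of_nat n + e)) has_fps_expansion fps_row period_series n"
proof -
  obtain r where r: "r > 0" "r \<le> margin" and sums: "\<And>e. \<bar>e\<bar> < r \<Longrightarrow>
    (\<lambda>j. real C ^ n * log_moment j n / fact j * e ^ j) sums (exp ((real n + e) * ln (real C)) * gamma_ratio A B (real n + e))"
    using log_moment_sums by metis
  define c where "c = (\<lambda>j. real C ^ n * log_moment j n / fact j)"
  define F where "F = Abs_fps (\<lambda>j. complex_of_real (c j))"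
  have F: "fps_row period_series n = F" by (simp add: fps_row_def F_def c_def period_series_def)
  have rad: "fps_conv_radius F \<ge> ereal r"
    unfolding F_def using sums r by (intro fps_conv_radius_of_real_summable) (auto simp: sums_iff c_def)
  have sub: "ball (0::complex) r \<subseteq> eball 0 (fps_conv_radius F)"
  proof
    fix x :: complex assume "x \<in> ball 0 r"
    then have "ereal (norm x) < ereal r" by simp
    from less_le_trans[OF this rad] show "x \<in> eball 0 (fps_conv_radius F)" by (simp add: in_eball_iff)
  qed
  have img: "(\<lambda>e. of_nat n + e) ` ball 0 r \<subseteq> {s. - margin < Re s}"
  proof safe
    fix e :: complex assume "e \<in> ball 0 r"
    then have "\<bar>Re e\<bar> < r" using abs_Re_le_cmod[of e] by simp
    then show "- margin < Re (of_nat n + e)" using r by simp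
  qed
  have "(\<lambda>e. gamma_fun (of_nat n + e)) holomorphic_on ball 0 r"
    using holomorphic_on_compose_gen[OF _ gamma_fun_holomorphic img] by (simp add: o_def holomorphic_intros)
  then have hol: "(\<lambda>e. eval_fps F e - gamma_fun (of_nat n + e)) holomorphic_on ball 0 r"
    by (intro holomorphic_intros sub)
  have "eval_fps F e - gamma_fun (of_nat n + e) = 0" if "e \<in> ball 0 r" for e
  proof (rule holomorphic_zero_of_real_zero[OF hol r(1) _ that])
    fix e :: real assume e: "- r < e" "e < 0"
    have "eval_fps F (of_real e) = of_real (exp ((real n + e) * ln (real C)) * gamma_ratio A B (real n + e))"
      unfolding F_def c_def using sums[of e] e by (intro eval_fps_of_real_sums) auto
    then show "eval_fps F (of_real e) - gamma_fun (of_nat n + of_real e) = 0"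
      using gamma_fun_of_real[of "real n + e"] by simp
  qed
  then have "\<forall>\<^sub>F e in nhds 0. eval_fps F e = gamma_fun (of_nat n + e)"
    unfolding eventually_nhds_metric using r(1) by (intro exI[of _ r]) (auto simp: dist_norm)
  moreover have "fps_conv_radius F > 0"
    using rad r(1) by (intro less_le_trans[OF _ rad]) auto
  ultimately show ?thesis unfolding F has_fps_expansion_def by simp
qed

text \<open>The functional equation Gamma (s + 1) = s Gamma (s) in each factor. Expanded at s = n +
  epsilon it becomes the recurrence of L for the rows of \<open>period_series\<close>.\<close>

lemma gamma_fun_plus1:
  assumes "- margin < Re s"
  shows "(s + 1) ^ 4 * gamma_fun (s + 1) = of_nat C * ((s + of_real A) * (s + of_real (1 - A)) *
      (s + of_real B) * (s + of_real (1 - B))) * gamma_fun s"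
proof -
  note n = Re_gamma_args[OF assms, THEN not_nonpos_Int_of_Re]
  have G: "Gamma (s + 1 + of_real u) = (s + of_real u) * Gamma (s + of_real u)" if "s + of_real u \<notin> \<int>\<^sub>\<le>\<^sub>0" for u
    using Gamma_plus1[OF that] by (simp add: add_ac)
  have G1: "Gamma (s + 1 + 1) = (s + 1) * Gamma (s + 1)" using Gamma_plus1[OF n(5)] .
  have "s + 1 \<noteq> 0" using n(5) by auto
  have e: "exp ((s + 1) * of_real (ln (real C))) = of_nat C * exp (s * of_real (ln (real C)))"
    using C by (simp add: distrib_right exp_add exp_of_real)
  show ?thesis
    unfolding gamma_fun_def G[OF n(1)] G[OF n(2)] G[OF n(3)] G[OF n(4)] G1 e
    using \<open>s + 1 \<noteq> 0\<close> by (simp add: power_mult_distrib mult_ac del: of_real_diff)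
qed

lemma period_series_rec:
  "(fps_const (of_nat (Suc n)) + fps_X) ^ 4 * fps_row period_series (Suc n) =
     fps_const (of_nat C) *
        ((fps_const (of_nat n + of_real A) + fps_X) *
         (fps_const (of_nat n + of_real (1 - A)) + fps_X) *
         (fps_const (of_nat n + of_real B) + fps_X) *
         (fps_const (of_nat n + of_real (1 - B)) + fps_X)) * fps_row period_series n"
proof -
  have X: "(\<lambda>e::complex. c + e) has_fps_expansion fps_const c + fps_X" for c
    by (intro fps_expansion_intros)
  have h1: "(\<lambda>e. (of_nat (Suc n) + e) ^ 4 * gamma_fun (of_nat (Suc n) + e)) has_fps_expansion
      (fps_const (of_nat (Suc n)) + fps_X) ^ 4 * fps_row period_series (Suc n)"
    by (intro has_fps_expansion_mult has_fps_expansion_power X gamma_fun_has_fps_expansion)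
  have h2: "(\<lambda>e. of_nat C * ((of_nat n + of_real A + e) * (of_nat n + of_real (1 - A) + e) *
       (of_nat n + of_real B + e) * (of_nat n + of_real (1 - B) + e)) * gamma_fun (of_nat n + e)) has_fps_expansion
     fps_const (of_nat C) *
        ((fps_const (of_nat n + of_real A) + fps_X) *
         (fps_const (of_nat n + of_real (1 - A)) + fps_X) *
         (fps_const (of_nat n + of_real B) + fps_X) *
         (fps_const (of_nat n + of_real (1 - B)) + fps_X)) * fps_row period_series n"
    by (intro has_fps_expansion_mult has_fps_expansion_const X gamma_fun_has_fps_expansion)
  have ev: "\<forall>\<^sub>F e in nhds 0. (of_nat (Suc n) + e) ^ 4 * gamma_fun (of_nat (Suc n) + e) =
      of_nat C * ((of_nat n + of_real A + e) * (of_nat n + of_real (1 - A) + e) *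
       (of_nat n + of_real B + e) * (of_nat n + of_real (1 - B) + e)) * gamma_fun (of_nat n + e)"
    unfolding eventually_nhds_metric
  proof (intro exI[of _ margin] conjI allI impI margin(1))
    fix e :: complex assume "dist e 0 < margin"
    then have "\<bar>Re e\<bar> < margin" using abs_Re_le_cmod[of e] by simp
    then have "- margin < Re (of_nat n + e)" by simp
    from gamma_fun_plus1[OF this]
    show "(of_nat (Suc n) + e) ^ 4 * gamma_fun (of_nat (Suc n) + e) =
      of_nat C * ((of_nat n + of_real A + e) * (of_nat n + of_real (1 - A) + e) *
       (of_nat n + of_real B + e) * (of_nat n + of_real (1 - B) + e)) * gamma_fun (of_nat n + e)"
      by (simp only: of_nat_Suc add_ac)
  qed
  show ?thesis
    using h1 unfolding has_fps_expansion_cong[OF ev refl] by (rule fps_expansion_unique_complex[OF _ h2])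
qed

lemma gamma_fun_derivative:
  assumes "- margin < Re s"
  shows "(gamma_fun has_field_derivative gamma_fun s * (of_real (ln (real C)) + Digamma (s + of_real A)
     + Digamma (s + of_real (1 - A)) + Digamma (s + of_real B) + Digamma (s + of_real (1 - B)) - 4 * Digamma (s + 1))) (at s)"
proof -
  note n = Re_gamma_args[OF assms, THEN not_nonpos_Int_of_Re]
  have nz: "Gamma (s + 1) \<noteq> 0" using n(5) by (simp add: Gamma_eq_zero_iff)
  define L where "L = complex_of_real (ln (real C))"
  have d: "((\<lambda>s. Gamma (s + of_real u)) has_field_derivative Gamma (s + of_real u) * Digamma (s + of_real u)) (at s)"
    if "s + of_real u \<notin> \<int>\<^sub>\<le>\<^sub>0" for u
    by (subst DERIV_shift[symmetric]) (rule has_field_derivative_Gamma that)+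
  have d1: "((\<lambda>s. Gamma (s + 1)) has_field_derivative Gamma (s + 1) * Digamma (s + 1)) (at s)"
    using d[of 1] n(5) by simp
  have dE: "((\<lambda>s. exp (s * L)) has_field_derivative L * exp (s * L)) (at s)"
    by (auto intro!: derivative_eq_intros)
  have "((\<lambda>s. exp (s * L) * (Gamma (s + of_real A) * Gamma (s + of_real (1 - A))
     * Gamma (s + of_real B) * Gamma (s + of_real (1 - B))) / Gamma (s + 1) ^ 4) has_field_derivative
     exp (s * L) * (Gamma (s + of_real A) * Gamma (s + of_real (1 - A))
     * Gamma (s + of_real B) * Gamma (s + of_real (1 - B))) / Gamma (s + 1) ^ 4 * (L + Digamma (s + of_real A)
     + Digamma (s + of_real (1 - A)) + Digamma (s + of_real B) + Digamma (s + of_real (1 - B)) - 4 * Digamma (s + 1))) (at s)"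
  proof (rule DERIV_cong[OF DERIV_divide[OF DERIV_mult[OF dE DERIV_mult[OF DERIV_mult[OF DERIV_mult[OF
        d[OF n(1)] d[OF n(2)]] d[OF n(3)]] d[OF n(4)]]] DERIV_power[OF d1, of 4]]])
    show "Gamma (s + 1) ^ 4 \<noteq> 0" using nz by simp
  qed (use nz in \<open>simp add: divide_simps power4_eq_xxxx power3_eq_cube numeral_3_eq_3 algebra_simps\<close>)
  then show ?thesis unfolding gamma_fun_def L_def .
qed

text \<open>The Taylor coefficients at 0 of the logarithmic derivative of
  \<open>gamma_fun\<close>.\<close>

definition log_deriv_coeff :: "nat \<Rightarrow> complex" where
  "log_deriv_coeff n = (if n = 0 then of_real (ln (real C)) else 0) + (Polygamma n (of_real A) + Polygamma n (of_real (1 - A))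
     + Polygamma n (of_real B) + Polygamma n (of_real (1 - B)) - 4 * Polygamma n 1) / fact n"

lemma Digamma_has_fps_expansion:
  assumes "Re a > 0"
  shows "(\<lambda>e. Digamma (e + a)) has_fps_expansion Abs_fps (\<lambda>n. Polygamma n a / fact n)"
proof -
  have n: "a \<notin> \<int>\<^sub>\<le>\<^sub>0" using assms by (rule not_nonpos_Int_of_Re)
  have "Digamma analytic_on {a}" using n by (intro analytic_on_Polygamma) auto
  then have "(\<lambda>x. Digamma (a + x)) has_fps_expansion fps_expansion Digamma a"
    by (rule analytic_at_imp_has_fps_expansion)
  moreover have "fps_expansion Digamma a = Abs_fps (\<lambda>n. Polygamma n a / fact n)"
    using higher_deriv_Polygamma[OF n, of _ 0] by (simp add: fps_expansion_def)
  ultimately show ?thesis by (simp add: add.commute)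
qed

lemma gamma_fun_fps_deriv:
  "fps_deriv (fps_row period_series 0) = fps_row period_series 0 * Abs_fps log_deriv_coeff"
proof -
  define F where "F = fps_row period_series 0"
  have F: "gamma_fun has_fps_expansion F" using gamma_fun_has_fps_expansion[of 0] by (simp add: F_def)
  let ?D = "\<lambda>s. of_real (ln (real C)) + Digamma (s + of_real A)
     + Digamma (s + of_real (1 - A)) + Digamma (s + of_real B) + Digamma (s + of_real (1 - B)) - 4 * Digamma (s + 1)"
  define P where "P = (\<lambda>a::complex. Abs_fps (\<lambda>n. Polygamma n a / fact n))"
  have "?D has_fps_expansion fps_const (of_real (ln (real C))) + P (of_real A) + P (of_real (1 - A)) + P (of_real B) + P (of_real (1 - B)) - fps_const 4 * P 1"
    unfolding P_def using A B
    by (intro has_fps_expansion_add has_fps_expansion_diff has_fps_expansion_mult has_fps_expansion_const Digamma_has_fps_expansion) auto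
  also have "fps_const (of_real (ln (real C))) + P (of_real A) + P (of_real (1 - A)) + P (of_real B) + P (of_real (1 - B)) - fps_const 4 * P 1 = Abs_fps log_deriv_coeff"
    by (rule fps_ext) (simp add: P_def log_deriv_coeff_def add_divide_distrib diff_divide_distrib)
  finally have D: "?D has_fps_expansion Abs_fps log_deriv_coeff" .
  have "deriv gamma_fun has_fps_expansion fps_deriv F"
    using F by (rule has_fps_expansion_deriv)
  moreover have "\<forall>\<^sub>F s in nhds 0. deriv gamma_fun s = gamma_fun s * ?D s"
    unfolding eventually_nhds_metric
  proof (intro exI[of _ margin] conjI allI impI margin(1))
    fix s :: complex assume "dist s 0 < margin"
    then have "\<bar>Re s\<bar> < margin" using abs_Re_le_cmod[of s] by simp
    then have "- margin < Re s" by simp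
    then show "deriv gamma_fun s = gamma_fun s * ?D s" by (intro DERIV_imp_deriv gamma_fun_derivative)
  qed
  ultimately have "(\<lambda>s. gamma_fun s * ?D s) has_fps_expansion fps_deriv F"
    by (subst (asm) has_fps_expansion_cong[OF _ refl])
  moreover have "(\<lambda>s. gamma_fun s * ?D s) has_fps_expansion F * Abs_fps log_deriv_coeff"
    by (intro has_fps_expansion_mult F D)
  ultimately show ?thesis unfolding F_def[symmetric] by (rule fps_expansion_unique_complex)
qed

definition leading :: complex where
  "leading = fps_nth (fps_row period_series 0) 0"

lemma leading_eq: "leading = of_real (pi ^ 2 / (sin (pi * A) * sin (pi * B)))"
proof -
  have "gamma_fun 0 = leading"
    using gamma_fun_has_fps_expansion[of 0] has_fps_expansion_imp_0_eq_fps_nth_0[of gamma_fun "fps_row period_series 0"]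
    by (simp add: leading_def)
  moreover have "gamma_fun 0 = of_real (gamma_ratio A B 0)" using gamma_fun_of_real[of 0] by simp
  moreover have "gamma_ratio A B 0 = (Gamma (1 - A) * Gamma A) * (Gamma (1 - B) * Gamma B)"
    by (simp add: gamma_ratio_def)
  moreover have "Gamma (1 - a) * Gamma a = pi / sin (pi * a)" if "0 < a" "a < 1" for a :: real
    using Beta_reflection[OF that] by (simp add: Beta_def)
  ultimately show ?thesis using A B by (simp add: power2_eq_square)
qed

lemma leading_nonzero: "leading \<noteq> 0"
  unfolding leading_eq using sin_pi_pos[OF A] sin_pi_pos[OF B] by simp

text \<open>The relation F' = F D for the logarithmic derivative D is a recursion for the
  coefficients of F. When D has no constant term, products of its coefficients contribute to F only
  from order four on.\<close>

lemma period_series_row_0: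
  assumes "log_deriv_coeff 0 = 0"
  shows "fps_nth (fps_row period_series 0) 1 = 0"
    "fps_nth (fps_row period_series 0) 2 = leading * log_deriv_coeff 1 / 2"
    "fps_nth (fps_row period_series 0) 3 = leading * log_deriv_coeff 2 / 3"
proof -
  define F where "F = fps_row period_series 0"
  have n: "of_nat (Suc n) * fps_nth F (Suc n) = (\<Sum>i=0..n. fps_nth F i * log_deriv_coeff (n - i))" for n
    using arg_cong[OF gamma_fun_fps_deriv, of "\<lambda>f. fps_nth f n"] by (simp add: F_def fps_mult_nth)
  have l: "fps_nth F 0 = leading" by (simp add: leading_def F_def)
  show 1: "fps_nth (fps_row period_series 0) 1 = 0"
    using n[of 0] assms by (simp add: F_def[symmetric])
  show "fps_nth (fps_row period_series 0) 2 = leading * log_deriv_coeff 1 / 2"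
    using n[of 1] assms 1 l by (simp add: F_def[symmetric] numeral_2_eq_2 mult.commute)
  show "fps_nth (fps_row period_series 0) 3 = leading * log_deriv_coeff 2 / 3"
    using n[of 2] assms 1 l by (simp add: F_def[symmetric] numeral_2_eq_2 numeral_3_eq_3 mult.commute)
qed

end

section \<open>Normalisation to the Frobenius basis\<close>

text \<open>As a coefficient of a product of series in epsilon, the construction turns constant
  changes of basis, and the shift of Ln z by 2 pi i, into multiplication by a series in
  epsilon.\<close>

lemma frob_eq_fps_nth:
  "frob f k z = fps_nth (Abs_fps (\<lambda>i. eval_fps (f i) z) * fps_exp (Ln z)) k"
  by (simp add: frob_def fps_mult_nth atMost_atLeast0)

lemma fps_conv_radius_sum_const_mult:
  assumes "\<And>i. fps_conv_radius (f i) \<ge> R"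
  shows "fps_conv_radius (\<Sum>j\<le>(n::nat). fps_const (c j :: complex) * f (m j)) \<ge> R"
proof (induction n)
  case 0
  show ?case using fps_conv_radius_mult[of "fps_const (c 0)" "f (m 0)"] assms[of "m 0"] by simp
next
  case (Suc n)
  have "fps_conv_radius (fps_const (c (Suc n)) * f (m (Suc n))) \<ge> R"
    using fps_conv_radius_mult[of "fps_const (c (Suc n))" "f (m (Suc n))"] assms[of "m (Suc n)"] by simp
  then show ?case
    using fps_conv_radius_add[of "\<Sum>j\<le>n. fps_const (c j) * f (m j)" "fps_const (c (Suc n)) * f (m (Suc n))"] Suc
    by (simp, meson min.boundedI order_trans)
qed

lemma eval_fps_sum_const_mult:
  assumes "\<And>i. ereal (norm z) < fps_conv_radius (f i)"
  shows "eval_fps (\<Sum>j\<le>(n::nat). fps_const (c j :: complex) * f (m j)) z = (\<Sum>j\<le>n. c j * eval_fps (f (m j)) z)"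
proof (induction n)
  case 0
  show ?case using assms by (simp add: eval_fps_mult)
next
  case (Suc n)
  have 1: "ereal (norm z) < fps_conv_radius (fps_const (c (Suc n)) * f (m (Suc n)))"
    using fps_conv_radius_mult[of "fps_const (c (Suc n))" "f (m (Suc n))"] assms[of "m (Suc n)"]
    by (simp add: less_le_trans)
  have 2: "ereal (norm z) < fps_conv_radius (\<Sum>j\<le>k. fps_const (c j) * f (m j))" for k
  proof -
    have "\<forall>j\<in>{..k}. ereal (norm z) < fps_conv_radius (fps_const (c j) * f (m j))"
    proof
      fix j
      show "ereal (norm z) < fps_conv_radius (fps_const (c j) * f (m j))"
        using less_le_trans[OF assms[of "m j"]] fps_conv_radius_mult[of "fps_const (c j)" "f (m j)"] by simp
    qed
    then show ?thesis
    proof (induction k)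
      case (Suc k)
      then have "ereal (norm z) < min (fps_conv_radius (\<Sum>j\<le>k. fps_const (c j) * f (m j)))
          (fps_conv_radius (fps_const (c (Suc k)) * f (m (Suc k))))"
        unfolding min_less_iff_conj by simp
      from less_le_trans[OF this fps_conv_radius_add] show ?case by simp
    qed simp
  qed
  show ?case using Suc assms 1 2[of n] by (simp add: eval_fps_add eval_fps_mult)
qed

context period_data
begin

text \<open>Division by row 0 makes the new row 0 equal to 1, which is the normalisation y_0(0) = 1,
  g_i(0) = 0. The divisor is a series in epsilon independent of n, so the recurrence
  survives.\<close>

definition frob_series :: "nat \<Rightarrow> complex fps" where
  "frob_series i = (\<Sum>j\<le>i. fps_const (fps_nth (inverse (fps_row period_series 0)) j) * period_series (i - j))"

lemma fps_row_frob_series: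
  "fps_row frob_series n = inverse (fps_row period_series 0) * fps_row period_series n"
  by (rule fps_ext) (simp add: fps_row_def[of frob_series] frob_series_def fps_sum_nth
    fps_mult_nth[of "inverse (fps_row period_series 0)"] atMost_atLeast0 fps_row_def[of _ n])

lemma row_inverse: "fps_row period_series 0 * inverse (fps_row period_series 0) = 1"
  using leading_nonzero by (intro inverse_mult_eq_1') (simp add: leading_def)

lemma conv_radius_frob_series: "fps_conv_radius (frob_series i) \<ge> ereal (1 / real C)"
  unfolding frob_series_def by (rule fps_conv_radius_sum_const_mult[where f=period_series, OF conv_radius_period_series])

lemma frob_series_0: "fps_nth (frob_series 0) 0 = 1" and frob_series_Suc_0: "i > 0 \<Longrightarrow> fps_nth (frob_series i) 0 = 0"
proof -
  have "fps_row frob_series 0 = 1" using row_inverse by (simp add: fps_row_frob_series mult.commute)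
  then have "fps_nth (fps_row frob_series 0) i = fps_nth 1 i" for i by simp
  then show "fps_nth (frob_series 0) 0 = 1" "i > 0 \<Longrightarrow> fps_nth (frob_series i) 0 = 0"
    by (auto simp: fps_row_def)
qed

lemma hyp_op_frob_series:
  assumes "z \<in> slit_disc C" "k < 4"
  shows "hyp_op A B C (frob frob_series k) z = 0"
proof (rule hyp_op_frob_eq_0[where f=frob_series, OF conv_radius_frob_series _ assms(2)])
  show "z \<in> slit_ball (1 / real C)" using assms(1) by (simp add: slit_disc_eq)
  fix n
  define I where "I = inverse (fps_row period_series 0)"
  show "(fps_const (of_nat (Suc n)) + fps_X) ^ 4 * fps_row frob_series (Suc n) =
        fps_const (of_nat C) *
        ((fps_const (of_nat n + of_real A) + fps_X) *
         (fps_const (of_nat n + of_real (1 - A)) + fps_X) *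
         (fps_const (of_nat n + of_real B) + fps_X) *
         (fps_const (of_nat n + of_real (1 - B)) + fps_X)) * fps_row frob_series n"
    using arg_cong[OF period_series_rec[of n], of "\<lambda>f. I * f"]
    unfolding fps_row_frob_series I_def[symmetric] by (simp only: mult_ac)
qed

lemma frob_period_series:
  assumes z: "z \<in> slit_disc C"
  shows "frob period_series k z = (\<Sum>j\<le>k. fps_nth (fps_row period_series 0) j * frob frob_series (k - j) z)"
proof -
  define F where "F = fps_row period_series 0"
  have nz: "ereal (norm z) < ereal (1 / real C)" using z by (simp add: slit_disc_def)
  have 1: "period_series i = (\<Sum>j\<le>i. fps_const (fps_nth F j) * frob_series (i - j))" for i
  proof (rule fps_ext)
    fix n
    have "fps_row period_series n = F * fps_row frob_series n"
      unfolding fps_row_frob_series using row_inverse by (simp add: F_def mult.assoc[symmetric])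
    then have "fps_nth (fps_row period_series n) i = fps_nth (F * fps_row frob_series n) i" by simp
    then show "fps_nth (period_series i) n = fps_nth (\<Sum>j\<le>i. fps_const (fps_nth F j) * frob_series (i - j)) n"
      by (simp add: fps_row_def[of _ n] fps_sum_nth fps_mult_nth[of F] atMost_atLeast0)
  qed
  have "eval_fps (period_series i) z = (\<Sum>j\<le>i. fps_nth F j * eval_fps (frob_series (i - j)) z)" for i
    unfolding 1[of i] using less_le_trans[OF nz conv_radius_frob_series] by (rule eval_fps_sum_const_mult)
  then have "Abs_fps (\<lambda>i. eval_fps (period_series i) z) = F * Abs_fps (\<lambda>i. eval_fps (frob_series i) z)"
    by (intro fps_ext) (simp add: fps_mult_nth atMost_atLeast0)
  then have "frob period_series k z = fps_nth (F * (Abs_fps (\<lambda>i. eval_fps (frob_series i) z) * fps_exp (Ln z))) k"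
    by (simp add: frob_eq_fps_nth mult.assoc)
  then show ?thesis
    unfolding frob_eq_fps_nth[of frob_series] F_def[symmetric] by (simp add: fps_mult_nth[of F] atMost_atLeast0)
qed

end

subsection \<open>Uniqueness of the Frobenius basis\<close>

lemma holomorphic_on_theta_plus:
  assumes "f holomorphic_on S" "open S"
  shows "theta_plus a f holomorphic_on S"
  unfolding theta_plus_def theta_def using assms by (intro holomorphic_intros)

lemma theta_plus_diff:
  assumes "f holomorphic_on S" "g holomorphic_on S" "open S" "z \<in> S"
  shows "theta_plus a (\<lambda>z. f z - g z) z = theta_plus a f z - theta_plus a g z"
proof -
  have "deriv (\<lambda>z. f z - g z) z = deriv f z - deriv g z"
    using assms by (intro deriv_diff) (auto simp: holomorphic_on_open field_differentiable_def)
  then show ?thesis unfolding theta_plus_def theta_def by (simp only:) (simp add: algebra_simps)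
qed

lemma hyp_op_diff:
  assumes f: "f holomorphic_on S" and g: "g holomorphic_on S" and S: "open S" and z: "z \<in> S"
    and h: "\<And>w. w \<in> S \<Longrightarrow> h w = f w - g w"
  shows "hyp_op A B C h z = hyp_op A B C f z - hyp_op A B C g z"
proof -
  note H = holomorphic_on_theta_plus[OF _ S]
  have step: "theta_plus a h' w = theta_plus a f' w - theta_plus a g' w"
    if "f' holomorphic_on S" "g' holomorphic_on S" "\<And>w. w \<in> S \<Longrightarrow> h' w = f' w - g' w" "w \<in> S" for a f' g' h' w
    using theta_plus_cong[OF S that(4), of h' "\<lambda>w. f' w - g' w" a] theta_plus_diff[OF that(1,2) S that(4)] that(3) by simp
  have step4: "theta_plus a (theta_plus b (theta_plus c (theta_plus d h))) z
      = theta_plus a (theta_plus b (theta_plus c (theta_plus d f))) z - theta_plus a (theta_plus b (theta_plus c (theta_plus d g))) z" for a b c d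
    by (intro step H f g h z)
  show ?thesis unfolding hyp_op_def theta_funpow_4 step4 by (simp add: algebra_simps)
qed

lemma slit_ball_connected: "R > 0 \<Longrightarrow> connected (slit_ball R)"
proof -
  assume R: "R > 0"
  have "starlike (slit_ball R)"
    unfolding starlike_def
  proof (intro bexI[of _ "of_real (R/2)"] ballI)
    show "complex_of_real (R / 2) \<in> slit_ball R"
      using R by (simp add: complex_nonpos_Reals_iff dist_norm norm_divide)
    fix z assume z: "z \<in> slit_ball R"
    show "closed_segment (of_real (R / 2)) z \<subseteq> slit_ball R"
    proof
      fix w assume w: "w \<in> closed_segment (of_real (R / 2)) z"
      have "complex_of_real (R / 2) \<in> ball 0 R" unfolding mem_ball_0 norm_of_real using R by simp
      then have wb: "w \<in> ball 0 R"
        using w z closed_segment_subset[OF _ _ convex_ball, of "of_real (R / 2)" 0 R z] by blast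
      obtain u where u: "0 \<le> u" "u \<le> 1" "w = (1 - u) *\<^sub>R of_real (R / 2) + u *\<^sub>R z"
        using w by (auto simp: closed_segment_def)
      have "w \<notin> \<real>\<^sub>\<le>\<^sub>0"
      proof
        assume "w \<in> \<real>\<^sub>\<le>\<^sub>0"
        then have *: "(1 - u) * (R / 2) + u * Re z \<le> 0" "u * Im z = 0"
          unfolding u(3) by (auto simp: complex_nonpos_Reals_iff)
        show False
        proof (cases "u = 0")
          case False
          then have "Im z = 0" using * by simp
          then have "Re z > 0" using z by (auto simp: complex_nonpos_Reals_iff)
          then have "u * Re z > 0" using False u by simp
          moreover have "(1 - u) * (R / 2) \<ge> 0" using u R by simp
          ultimately show False using * by linarith
        qed (use * R in simp)
      qed
      then show "w \<in> slit_ball R" using wb by simp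
    qed
  qed
  then show ?thesis by (rule starlike_imp_connected)
qed

lemma eventually_slit_iff:
  "(\<forall>\<^sub>F z in at 0 within - \<real>\<^sub>\<le>\<^sub>0. P z) \<longleftrightarrow> (\<exists>r>0. \<forall>z\<in>slit_ball r. P (z::complex))"
proof
  assume "\<forall>\<^sub>F z in at 0 within - \<real>\<^sub>\<le>\<^sub>0. P z"
  then obtain d where "d > 0" "\<And>z. z \<in> - \<real>\<^sub>\<le>\<^sub>0 \<Longrightarrow> z \<noteq> 0 \<Longrightarrow> dist z 0 < d \<Longrightarrow> P z"
    unfolding eventually_at by blast
  moreover have "z \<noteq> 0" if "z \<notin> \<real>\<^sub>\<le>\<^sub>0" for z :: complex using that by auto
  ultimately show "\<exists>r>0. \<forall>z\<in>slit_ball r. P z" by (intro exI[of _ d]) auto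
next
  assume "\<exists>r>0. \<forall>z\<in>slit_ball r. P z"
  then show "\<forall>\<^sub>F z in at 0 within - \<real>\<^sub>\<le>\<^sub>0. P z"
    unfolding eventually_at by (auto simp: dist_norm)
qed

text \<open>When the difference of two solutions is free of logarithms near 0 and its germ vanishes
  at 0, uniqueness of holomorphic solutions removes it there, and connectedness of the slit disc
  removes it everywhere.\<close>

lemma frobenius_unique_step:
  assumes C: "0 < C"
    and y: "y holomorphic_on slit_disc C" "\<And>z. z \<in> slit_disc C \<Longrightarrow> hyp_op A B C y z = 0"
    and w: "w holomorphic_on slit_disc C" "\<And>z. z \<in> slit_disc C \<Longrightarrow> hyp_op A B C w z = 0"
    and h: "h analytic_on {0}" "h 0 = 0" "\<forall>\<^sub>F z in at 0 within - \<real>\<^sub>\<le>\<^sub>0. y z - w z = h z"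
    and z: "z \<in> slit_disc C"
  shows "y z = w z"
proof -
  have sd: "slit_disc C = slit_ball (1 / real C)" by (simp add: slit_disc_def)
  obtain r where r: "r > 0" "\<And>z. z \<in> slit_ball r \<Longrightarrow> y z - w z = h z"
    using h(3) unfolding eventually_slit_iff by blast
  define s where "s = min r (1 / real C)"
  have s: "s > 0" "slit_ball s \<subseteq> slit_ball r" "slit_ball s \<subseteq> slit_disc C"
    using r C by (auto simp: s_def sd)
  have "hyp_op A B C h z = 0" if "z \<in> slit_ball s" for z
  proof -
    have "hyp_op A B C h z = hyp_op A B C y z - hyp_op A B C w z"
      using s r(2) by (intro hyp_op_diff[OF holomorphic_on_subset[OF y(1) s(3)] holomorphic_on_subset[OF w(1) s(3)] open_slit_ball that])
        (metis subsetD)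
    then show ?thesis using y(2) w(2) that s(3) by (metis diff_self subsetD)
  qed
  then have "\<forall>\<^sub>F z in at 0 within - \<real>\<^sub>\<le>\<^sub>0. hyp_op A B C h z = 0"
    unfolding eventually_slit_iff using s(1) by blast
  then have "\<forall>\<^sub>F z in nhds 0. h z = 0" by (rule hyp_op_germ_unique[OF h(1,2)])
  then obtain q where q: "q > 0" "\<And>z. norm z < q \<Longrightarrow> h z = 0"
    unfolding eventually_nhds_metric by (auto simp: dist_norm)
  define p where "p = min q s"
  have p: "p > 0" "slit_ball p \<subseteq> slit_disc C" using q s by (auto simp: p_def)
  have eq: "y z - w z = 0" if "z \<in> slit_ball p" for z
    using that q(2)[of z] r(2)[of z] s(2) by (auto simp: p_def subset_iff)
  have pin: "complex_of_real (p/2) \<in> slit_ball p"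
    using p(1) by (simp add: complex_nonpos_Reals_iff dist_norm norm_divide)
  have "y z - w z = 0"
  proof (rule analytic_continuation[where f="\<lambda>z. y z - w z" and S="slit_disc C" and U="slit_ball p" and \<xi>="of_real (p/2)"])
    show "(\<lambda>z. y z - w z) holomorphic_on slit_disc C" by (intro holomorphic_intros y(1) w(1))
    show "open (slit_disc C)" unfolding sd by (rule open_slit_ball)
    show "connected (slit_disc C)" unfolding sd using C by (intro slit_ball_connected) simp
    show "complex_of_real (p/2) islimpt slit_ball p"
      using pin by (intro interior_limit_point) (simp only: interior_open[OF open_slit_ball])
    show "complex_of_real (p/2) \<in> slit_disc C" using pin p(2) by blast
  qed (use p(2) eq z in auto)
  then show ?thesis by simp
qed

context period_data
begin

text \<open>The argument is triangular: once y_0 and g_1, ..., g_(i-1) are identified, all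
  logarithms cancel in the difference of the i-th solutions, which is then a holomorphic germ
  vanishing at 0; its vanishing identifies g_i.\<close>

lemma frobenius_basis_unique:
  assumes fb: "frobenius_basis A B C y0 y1 y2 y3" and z: "z \<in> slit_disc C"
  shows "y0 z = frob frob_series 0 z" "y1 z = frob frob_series 1 z"
    "y2 z = frob frob_series 2 z" "y3 z = frob frob_series 3 z"
proof -
  define G where "G = (\<lambda>i. eval_fps (frob_series i))"
  obtain g1 g2 g3 where
    y: "\<And>y. y \<in> {y0, y1, y2, y3} \<Longrightarrow> y holomorphic_on slit_disc C"
      "\<And>y z. y \<in> {y0, y1, y2, y3} \<Longrightarrow> z \<in> slit_disc C \<Longrightarrow> hyp_op A B C y z = 0"
    and y0: "y0 analytic_on {0}" "y0 0 = 1"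
    and g: "\<And>g. g \<in> {g1, g2, g3} \<Longrightarrow> g analytic_on {0}" "\<And>g. g \<in> {g1, g2, g3} \<Longrightarrow> g 0 = 0"
    and ev: "\<forall>\<^sub>F z in at 0 within - \<real>\<^sub>\<le>\<^sub>0. y1 z = y0 z * Ln z + g1 z \<and>
           y2 z = 1/2 * y0 z * (Ln z)^2 + g1 z * Ln z + g2 z \<and>
           y3 z = 1/6 * y0 z * (Ln z)^3 + 1/2 * g1 z * (Ln z)^2 + g2 z * Ln z + g3 z"
    using fb unfolding frobenius_basis_def by blast
  have f: "frob frob_series 0 z = G 0 z" "frob frob_series 1 z = G 0 z * Ln z + G 1 z"
    "frob frob_series 2 z = 1/2 * G 0 z * (Ln z)^2 + G 1 z * Ln z + G 2 z"
    "frob frob_series 3 z = 1/6 * G 0 z * (Ln z)^3 + 1/2 * G 1 z * (Ln z)^2 + G 2 z * Ln z + G 3 z" for z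
    by (simp_all add: frob_def G_def numeral_2_eq_2 numeral_3_eq_3 mult_ac)
  note f' = f[unfolded One_nat_def]
  have Ga: "G i analytic_on {0}" for i
  proof -
    have "0 < fps_conv_radius (frob_series i)"
      using C by (intro less_le_trans[OF _ conv_radius_frob_series]) simp
    then show ?thesis unfolding G_def by (intro analytic_on_eval_fps) (auto simp: zero_ereal_def[symmetric])
  qed
  have G0: "G 0 0 = 1" "i > 0 \<Longrightarrow> G i 0 = 0" for i
    by (simp_all add: G_def eval_fps_at_0 frob_series_0 frob_series_Suc_0)
  have wh: "frob frob_series k holomorphic_on slit_disc C" for k
    unfolding slit_disc_eq by (rule holomorphic_on_frob[OF conv_radius_frob_series])
  have evd: "\<forall>\<^sub>F z in at 0 within - \<real>\<^sub>\<le>\<^sub>0. z \<in> slit_disc C"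
    unfolding eventually_slit_iff slit_disc_eq using C by (intro exI[of _ "1 / real C"]) auto
  have 0: "y0 z = frob frob_series 0 z" if "z \<in> slit_disc C" for z
  proof (rule frobenius_unique_step[OF C y(1) y(2) wh hyp_op_frob_series _ _ _ that])
    show "(\<lambda>z. y0 z - G 0 z) analytic_on {0}" by (intro analytic_intros y0 Ga)
  qed (auto simp: y0 G0 f)
  have e0: "\<forall>\<^sub>F z in at 0 within - \<real>\<^sub>\<le>\<^sub>0. y0 z = G 0 z"
    using evd by eventually_elim (simp add: 0 f)
  have 1: "y1 z = frob frob_series 1 z" if "z \<in> slit_disc C" for z
  proof (rule frobenius_unique_step[OF C y(1) y(2) wh hyp_op_frob_series _ _ _ that])
    show "(\<lambda>z. g1 z - G 1 z) analytic_on {0}" by (intro analytic_intros g Ga) simp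
    show "\<forall>\<^sub>F z in at 0 within - \<real>\<^sub>\<le>\<^sub>0. y1 z - frob frob_series 1 z = g1 z - G 1 z"
      using ev e0 by eventually_elim (simp add: f')
  qed (auto simp: g G0)
  have e1: "\<forall>\<^sub>F z in at 0 within - \<real>\<^sub>\<le>\<^sub>0. g1 z = G 1 z"
    using evd ev e0 by eventually_elim (simp add: 1[unfolded One_nat_def] f')
  have 2: "y2 z = frob frob_series 2 z" if "z \<in> slit_disc C" for z
  proof (rule frobenius_unique_step[OF C y(1) y(2) wh hyp_op_frob_series _ _ _ that])
    show "(\<lambda>z. g2 z - G 2 z) analytic_on {0}" by (intro analytic_intros g Ga) simp
    show "\<forall>\<^sub>F z in at 0 within - \<real>\<^sub>\<le>\<^sub>0. y2 z - frob frob_series 2 z = g2 z - G 2 z"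
      using ev e0 e1 by eventually_elim (simp add: f')
  qed (auto simp: g G0)
  have e2: "\<forall>\<^sub>F z in at 0 within - \<real>\<^sub>\<le>\<^sub>0. g2 z = G 2 z"
    using evd ev e0 e1 by eventually_elim (simp add: 2 f')
  have 3: "y3 z = frob frob_series 3 z" if "z \<in> slit_disc C" for z
  proof (rule frobenius_unique_step[OF C y(1) y(2) wh hyp_op_frob_series _ _ _ that])
    show "(\<lambda>z. g3 z - G 3 z) analytic_on {0}" by (intro analytic_intros g Ga) simp
    show "\<forall>\<^sub>F z in at 0 within - \<real>\<^sub>\<le>\<^sub>0. y3 z - frob frob_series 3 z = g3 z - G 3 z"
      using ev e0 e1 e2 by eventually_elim (simp add: f')
  qed (auto simp: g G0)
  show "y0 z = frob frob_series 0 z" "y1 z = frob frob_series 1 z"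
    "y2 z = frob frob_series 2 z" "y3 z = frob frob_series 3 z"
    using 0 1 2 3 z by auto
qed

end

subsection \<open>Continuation of logarithms\<close>

lemma Ln_mult_exp:
  assumes "Re u > 0" "\<bar>Im d\<bar> < pi / 2"
  shows "Ln (u * exp d) = Ln u + d"
proof -
  have u: "u \<noteq> 0" using assms(1) by auto
  have "\<bar>Im (Ln u)\<bar> < pi / 2" using assms(1) Re_Ln_pos_lt[OF u] by simp
  then have "- pi < Im (Ln u + d)" "Im (Ln u + d) \<le> pi" using assms(2) by (auto simp: abs_less_iff)
  then have "Ln (exp (Ln u + d)) = Ln u + d" by (rule Ln_exp)
  then show ?thesis using u by (simp add: exp_add)
qed

text \<open>The branch of log (z - p) near the point p + e^(q s) that takes the value
  \<open>q s\<close> there. The argument of \<open>Ln\<close> is close to 1, so its cut is not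
  met.\<close>

definition log_branch :: "complex \<Rightarrow> (real \<Rightarrow> complex) \<Rightarrow> real \<Rightarrow> complex \<Rightarrow> complex" where
  "log_branch p q s z = Ln ((z - p) / exp (q s)) + q s"

lemma log_branch_analytic: "log_branch p q s analytic_on {p + exp (q s)}"
  unfolding log_branch_def by (intro analytic_intros) auto

lemma log_branch_locally_constant:
  assumes q: "continuous_on {0..1} q" and s: "s \<in> {0..1}"
  shows "\<forall>\<^sub>F r in at s within {0..1}. \<forall>\<^sub>F z in nhds (p + exp (q r)). log_branch p q r z = log_branch p q s z"
proof -
  have "(q \<longlongrightarrow> q s) (at s within {0..1})" using q s by (simp add: continuous_on_def)
  then have "\<forall>\<^sub>F r in at s within {0..1}. dist (q r) (q s) < 1" by (rule tendstoD) simp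
  then show ?thesis
  proof eventually_elim
    case (elim r)
    then have d: "\<bar>Im (q r - q s)\<bar> < pi / 2"
      using abs_Im_le_cmod[of "q r - q s"] pi_gt3 by (simp add: dist_norm)
    have "((\<lambda>z. Re ((z - p) / exp (q r))) \<longlongrightarrow> 1) (nhds (p + exp (q r)))"
      by (auto intro!: tendsto_eq_intros filterlim_ident)
    then have "\<forall>\<^sub>F z in nhds (p + exp (q r)). 0 < Re ((z - p) / exp (q r))"
      by (rule order_tendstoD) simp
    then show ?case
    proof eventually_elim
      case (elim z)
      have "(z - p) / exp (q s) = (z - p) / exp (q r) * exp (q r - q s)" by (simp add: exp_diff)
      then show ?case unfolding log_branch_def using Ln_mult_exp[OF elim d] by simp
    qed
  qed
qed

text \<open>All multivaluedness is carried by one logarithm, so a continuous lift q of the path to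
  the logarithm of its distance vector from p continues the whole expression.\<close>

lemma continues_along_log_branch:
  assumes q: "continuous_on {0..1} q" and \<gamma>: "\<And>s. s \<in> {0..1} \<Longrightarrow> \<gamma> s = p + exp (q s)"
    and \<Phi>: "\<And>s l. s \<in> {0..1} \<Longrightarrow> l analytic_on {\<gamma> s} \<Longrightarrow> (\<lambda>z. \<Phi> z (l z)) analytic_on {\<gamma> s}"
    and f: "\<forall>\<^sub>F z in nhds (\<gamma> 0). \<Phi> z (log_branch p q 0 z) = f z"
    and h: "\<forall>\<^sub>F z in nhds (\<gamma> 1). \<Phi> z (log_branch p q 1 z) = h z"
  shows "continues_along \<gamma> f h"
  unfolding continues_along_def
proof (intro exI[of _ "\<lambda>s z. \<Phi> z (log_branch p q s z)"] conjI ballI)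
  fix s :: real assume s: "s \<in> {0..1}"
  show "(\<lambda>z. \<Phi> z (log_branch p q s z)) analytic_on {\<gamma> s}"
    using \<Phi>[OF s] log_branch_analytic[of p q s] \<gamma>[OF s] by simp
  have "\<forall>\<^sub>F r in at s within {0..1}. r \<in> {0..1}" by (simp add: eventually_at_filter)
  with log_branch_locally_constant[OF q s, of p]
  show "\<forall>\<^sub>F r in at s within {0..1}. \<forall>\<^sub>F z in nhds (\<gamma> r). \<Phi> z (log_branch p q r z) = \<Phi> z (log_branch p q s z)"
  proof eventually_elim
    case (elim r)
    from elim(1) show ?case unfolding \<gamma>[OF elim(2)] by eventually_elim simp
  qed
qed (use f h in auto)

section \<open>Trigamma values\<close>

text \<open>Two differentiations of the reflection formula for Gamma. The intermediate Digamma
  formula is kept multiplied by the sine, so that the second differentiation involves no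
  quotient.\<close>

lemma Polygamma_1_reflection:
  assumes "0 < a" "a < (1::real)"
  shows "Polygamma 1 a + Polygamma 1 (1 - a) = pi ^ 2 / sin (pi * a) ^ 2"
proof -
  have n: "x \<notin> \<int>\<^sub>\<le>\<^sub>0" if "x > 0" for x :: real using that by (auto elim!: nonpos_Ints_cases)
  have 1: "(Digamma x - Digamma (1 - x)) * sin (pi * x) = - pi * cos (pi * x)" if x: "0 < x" "x < 1" for x
  proof -
    define G where "G = Gamma (1 - x) * Gamma x"
    have s: "sin (pi * x) > 0" by (rule sin_pi_pos[OF x])
    have G: "G = pi / sin (pi * x)" using Beta_reflection[OF x] by (simp add: Beta_def G_def)
    have "((\<lambda>x. Gamma (1 - x) * Gamma x) has_real_derivative G * (Digamma x - Digamma (1 - x))) (at x)"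
      using n[of x] n[of "1 - x"] x by (auto intro!: derivative_eq_intros simp: G_def algebra_simps)
    moreover have "((\<lambda>x. Gamma (1 - x) * Gamma x) has_real_derivative - (pi * (pi * cos (pi * x))) / sin (pi * x) ^ 2) (at x)"
    proof (rule has_field_derivative_transform_within_open[where S="{0<..<1}" and f="\<lambda>x. pi / sin (pi * x)"])
      show "((\<lambda>x. pi / sin (pi * x)) has_real_derivative - (pi * (pi * cos (pi * x))) / sin (pi * x) ^ 2) (at x)"
        using s by (auto intro!: derivative_eq_intros simp: power2_eq_square)
      show "pi / sin (pi * y) = Gamma (1 - y) * Gamma y" if "y \<in> {0<..<1}" for y
        using Beta_reflection[of y] that by (simp add: Beta_def)
    qed (use x in auto)
    ultimately have "G * (Digamma x - Digamma (1 - x)) = - (pi * (pi * cos (pi * x))) / sin (pi * x) ^ 2"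
      by (rule DERIV_unique)
    then have "G * (Digamma x - Digamma (1 - x)) * sin (pi * x) ^ 2 = - (pi * (pi * cos (pi * x)))"
      using s by simp
    moreover have "G * (Digamma x - Digamma (1 - x)) * sin (pi * x) ^ 2
        = (G * sin (pi * x) ^ 2) * (Digamma x - Digamma (1 - x))" by (simp only: mult_ac)
    moreover have "G * sin (pi * x) ^ 2 = pi * sin (pi * x)"
      unfolding G using s by (simp add: power2_eq_square)
    ultimately have "pi * sin (pi * x) * (Digamma x - Digamma (1 - x)) = - (pi * (pi * cos (pi * x)))"
      by (simp only:)
    then have "pi * ((Digamma x - Digamma (1 - x)) * sin (pi * x)) = pi * (- pi * cos (pi * x))"
      by (simp add: mult_ac)
    then show ?thesis by (metis mult_left_cancel pi_neq_zero)
  qed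
  have s: "sin (pi * a) > 0" by (rule sin_pi_pos[OF assms])
  have "((\<lambda>x. (Digamma x - Digamma (1 - x)) * sin (pi * x)) has_real_derivative
     (Polygamma 1 a + Polygamma 1 (1 - a)) * sin (pi * a) + (Digamma a - Digamma (1 - a)) * (pi * cos (pi * a))) (at a)"
    using n[of a] n[of "1 - a"] assms by (auto intro!: derivative_eq_intros simp: algebra_simps)
  moreover have "((\<lambda>x. (Digamma x - Digamma (1 - x)) * sin (pi * x)) has_real_derivative pi ^ 2 * sin (pi * a)) (at a)"
  proof (rule has_field_derivative_transform_within_open[where S="{0<..<1}" and f="\<lambda>x. - pi * cos (pi * x)"])
    show "((\<lambda>x. - pi * cos (pi * x)) has_real_derivative pi ^ 2 * sin (pi * a)) (at a)"
      by (auto intro!: derivative_eq_intros simp: power2_eq_square)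
  qed (use assms 1 in auto)
  ultimately have "(Polygamma 1 a + Polygamma 1 (1 - a)) * sin (pi * a) + (Digamma a - Digamma (1 - a)) * (pi * cos (pi * a))
     = pi ^ 2 * sin (pi * a)" by (rule DERIV_unique)
  from arg_cong[OF this, of "\<lambda>y. y * sin (pi * a)"] have "(Polygamma 1 a + Polygamma 1 (1 - a)) * sin (pi * a) ^ 2
     + ((Digamma a - Digamma (1 - a)) * sin (pi * a)) * (pi * cos (pi * a)) = pi ^ 2 * sin (pi * a) ^ 2"
    by (simp add: power2_eq_square algebra_simps)
  then have "(Polygamma 1 a + Polygamma 1 (1 - a)) * sin (pi * a) ^ 2 = pi ^ 2 * (sin (pi * a) ^ 2 + cos (pi * a) ^ 2)"
    unfolding 1[OF assms] by algebra
  then show ?thesis using s by (simp add: field_simps)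
qed

lemma Polygamma_1_1: "Polygamma 1 (1::real) = pi ^ 2 / 6"
proof -
  have "(\<lambda>k. inverse ((1 + real k) ^ 2)) sums Polygamma 1 1"
    using Polygamma_LIMSEQ[of "1::real" 1] by (simp add: numeral_2_eq_2)
  moreover have "(\<lambda>k. inverse ((1 + real k) ^ 2)) sums (pi ^ 2 / 6)"
    using inverse_squares_sums by (simp add: inverse_eq_divide add.commute)
  ultimately show ?thesis by (rule sums_unique2)
qed

section \<open>Local monodromy at 0 and at 1/C\<close>

context period_data
begin

lemma mult_C_in_slit_plane: "z \<in> slit_plane \<Longrightarrow> of_nat C * z \<in> slit_plane"
  using C by (auto simp: complex_nonpos_Reals_iff mult_le_0_iff)

text \<open>Around 0 the logarithm gains 2 pi i, so the generating series in epsilon is multiplied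
  by e^(2 pi i epsilon); the coefficients of this exponential are the entries of the matrix.\<close>

lemma monodromy_at_zero:
  assumes t: "0 < t" "t < 1 / real C"
    and f: "\<And>z. z \<in> slit_disc C \<Longrightarrow> f z = c * frob frob_series k z"
    and h: "\<And>z. z \<in> slit_disc C \<Longrightarrow> h z = c * (\<Sum>j\<le>k. frob frob_series j z * ((2 * of_real pi * \<i>) ^ (k - j) / fact (k - j)))"
  shows "continues_along (circlepath 0 t) f h"
proof -
  define q where "q = (\<lambda>s::real. of_real (ln t) + 2 * of_real pi * \<i> * of_real s :: complex)"
  define \<Phi> where "\<Phi> = (\<lambda>z w. c * (\<Sum>i\<le>k. eval_fps (frob_series i) z * w ^ (k - i) / fact (k - i)))"
  have eq: "exp (q s) = of_real t * exp (2 * of_real pi * \<i> * of_real s)" for s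
    using t by (simp add: q_def exp_add exp_of_real)
  have \<gamma>: "circlepath 0 t s = 0 + exp (q s)" for s by (simp add: circlepath eq)
  have tin: "of_real t \<in> slit_disc C"
    using t by (simp add: slit_disc_def complex_nonpos_Reals_iff dist_norm)
  have ev: "\<forall>\<^sub>F z in nhds (of_real t). z \<in> slit_disc C"
    using tin open_slit_ball unfolding slit_disc_eq by (rule eventually_nhds_in_open[rotated])
  have e01: "exp (q 0) = of_real t" "exp (q 1) = of_real t" by (simp_all add: eq)
  have branch: "log_branch 0 q 0 z = Ln z" "log_branch 0 q 1 z = Ln z + 2 * of_real pi * \<i>" if "z \<in> slit_disc C" for z
  proof -
    have "z \<noteq> 0" using that by (auto simp: slit_disc_def)
    then have "Ln (z / of_real t) = Ln z - of_real (ln t)" using t by (intro Ln_divide_of_real) auto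
    then show "log_branch 0 q 0 z = Ln z" "log_branch 0 q 1 z = Ln z + 2 * of_real pi * \<i>"
      unfolding log_branch_def e01 by (simp_all add: q_def)
  qed
  have P: "\<Phi> z w = c * fps_nth (Abs_fps (\<lambda>i. eval_fps (frob_series i) z) * fps_exp w) k" for z w
    by (simp add: \<Phi>_def fps_mult_nth atMost_atLeast0)
  show ?thesis
  proof (rule continues_along_log_branch[where q=q and p=0 and \<Phi>=\<Phi>])
    show "continuous_on {0..1} q" unfolding q_def by (intro continuous_intros)
    show "circlepath 0 t s = 0 + exp (q s)" for s by (rule \<gamma>)
    show "(\<lambda>z. \<Phi> z (l z)) analytic_on {circlepath 0 t s}" if "l analytic_on {circlepath 0 t s}" for s l
    proof -
      have "norm (circlepath 0 t s) = t" using t by (simp add: circlepath norm_mult)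
      then have "ereal (norm (circlepath 0 t s)) < ereal (1 / real C)" using t by simp
      from less_le_trans[OF this conv_radius_frob_series]
      have "circlepath 0 t s \<in> eball 0 (fps_conv_radius (frob_series i))" for i
        by (simp add: in_eball_iff)
      then show ?thesis unfolding \<Phi>_def using that by (intro analytic_intros) auto
    qed
    show "\<forall>\<^sub>F z in nhds (circlepath 0 t 0). \<Phi> z (log_branch 0 q 0 z) = f z"
      unfolding \<gamma> e01 add_0_left using ev
      by eventually_elim (simp add: branch f P frob_eq_fps_nth)
    show "\<forall>\<^sub>F z in nhds (circlepath 0 t 1). \<Phi> z (log_branch 0 q 1 z) = h z"
      unfolding \<gamma> e01 add_0_left using ev
    proof eventually_elim
      case (elim z)
      have "\<Phi> z (log_branch 0 q 1 z) = c * fps_nth ((Abs_fps (\<lambda>i. eval_fps (frob_series i) z) * fps_exp (Ln z)) * fps_exp (2 * of_real pi * \<i>)) k"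
        unfolding branch(2)[OF elim] P fps_exp_add_mult by (simp only: mult.assoc)
      then show ?case
        unfolding h[OF elim] frob_eq_fps_nth
        by (simp only: fps_mult_nth[of _ "fps_exp (2 * of_real pi * \<i>)"] atMost_atLeast0 fps_exp_nth of_nat_fact)
    qed
  qed
qed

text \<open>A continuous logarithm of the path minus 1/C gains 2 pi i times the winding number,
  which is 1. The loop stays in the slit plane, where \<open>H\<close> and \<open>W\<close> are
  holomorphic, so they return unchanged and only the factor of \<open>W\<close> moves.\<close>

lemma monodromy_at_conifold:
  assumes t: "0 < t" "t < 1 / real C" and loop: "conifold_loop C t \<gamma>"
    and H: "H holomorphic_on slit_plane" and W: "W holomorphic_on slit_plane"
    and f: "\<And>z. z \<in> slit_disc C \<Longrightarrow> f z = H z + W z * Ln (1 - of_nat C * z)"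
    and h: "\<And>z. z \<in> slit_disc C \<Longrightarrow> h z = f z + 2 * of_real pi * \<i> * W z"
  shows "continues_along \<gamma> f h"
proof -
  define p where "p = 1 / complex_of_nat C"
  have \<gamma>: "path \<gamma>" "\<gamma> 0 = of_real t" "\<gamma> 1 = of_real t" "path_image \<gamma> \<subseteq> slit_plane" "p \<notin> path_image \<gamma>" "winding_number \<gamma> p = 1"
    using loop by (auto simp: conifold_loop_def p_def simple_path_def pathstart_def pathfinish_def)
  obtain q where q: "path q" "pathfinish q - pathstart q = 2 * of_real pi * \<i> * winding_number \<gamma> p"
    "\<And>s. s \<in> {0..1} \<Longrightarrow> \<gamma> s = p + exp (q s)"
    using winding_number_as_continuous_log[OF \<gamma>(1,5)] by metis
  have q1: "q 1 = q 0 + 2 * of_real pi * \<i>"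
    using q(2) \<gamma>(6) by (simp add: pathstart_def pathfinish_def algebra_simps)
  have e01: "exp (q 0) = of_real t - p" "exp (q 1) = of_real t - p"
    using q(3)[of 0] q(3)[of 1] \<gamma>(2,3) by (auto simp: algebra_simps)
  \<comment> \<open>The additive constant matches the lifted branch of log (z - 1/C) with
    \<open>Ln (1 - of_nat C * z)\<close> near the base point t.\<close>
  define \<Phi> where "\<Phi> = (\<lambda>z w. H z + W z * (w + (of_real (ln (1 - real C * t)) - q 0)))"
  have Ct: "1 - real C * t > 0" using t C by (simp add: field_simps)
  have tin: "of_real t \<in> slit_disc C"
    using t by (simp add: slit_disc_def complex_nonpos_Reals_iff dist_norm)
  have ev: "\<forall>\<^sub>F z in nhds (of_real t). z \<in> slit_disc C"
    using tin open_slit_ball unfolding slit_disc_eq by (rule eventually_nhds_in_open[rotated])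
  have branch: "log_branch p q 0 z + (of_real (ln (1 - real C * t)) - q 0) = Ln (1 - of_nat C * z)"
    "log_branch p q 1 z = log_branch p q 0 z + 2 * of_real pi * \<i>" if z: "z \<in> slit_disc C" for z
  proof -
    have "norm (of_nat C * z) < 1" using z C by (simp add: slit_disc_def norm_mult field_simps)
    then have nz: "1 - of_nat C * z \<noteq> 0" by auto
    have "(z - p) / (of_real t - p) = (- of_nat C * (z - p)) / (- of_nat C * (of_real t - p))"
      using C by simp
    also have "- of_nat C * (z - p) = 1 - of_nat C * z" using C by (simp add: p_def algebra_simps)
    also have "- of_nat C * (of_real t - p) = of_real (1 - real C * t)" using C by (simp add: p_def algebra_simps)
    finally have "Ln ((z - p) / (of_real t - p)) = Ln (1 - of_nat C * z) - of_real (ln (1 - real C * t))"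
      by (simp only: Ln_divide_of_real[OF Ct nz])
    then show "log_branch p q 0 z + (of_real (ln (1 - real C * t)) - q 0) = Ln (1 - of_nat C * z)"
      "log_branch p q 1 z = log_branch p q 0 z + 2 * of_real pi * \<i>"
      unfolding log_branch_def e01 by (simp_all add: q1)
  qed
  show ?thesis
  proof (rule continues_along_log_branch[where q=q and p=p and \<Phi>=\<Phi>])
    show "continuous_on {0..1} q" using q(1) by (simp add: path_def)
    show "\<gamma> s = p + exp (q s)" if "s \<in> {0..1}" for s using that by (rule q(3))
    show "(\<lambda>z. \<Phi> z (l z)) analytic_on {\<gamma> s}" if "s \<in> {0..1}" "l analytic_on {\<gamma> s}" for s l
    proof -
      have "\<gamma> s \<in> path_image \<gamma>" using that(1) by (simp add: path_image_def)
      then have "\<gamma> s \<in> slit_plane" using \<gamma>(4) by blast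
      then have "H analytic_on {\<gamma> s}" "W analytic_on {\<gamma> s}"
        using H W open_slit_plane by (auto intro: holomorphic_on_imp_analytic_at)
      then show ?thesis unfolding \<Phi>_def using that(2) by (intro analytic_intros)
    qed
    show "\<forall>\<^sub>F z in nhds (\<gamma> 0). \<Phi> z (log_branch p q 0 z) = f z"
      unfolding \<gamma>(2) using ev by eventually_elim (simp add: \<Phi>_def branch(1) f)
    show "\<forall>\<^sub>F z in nhds (\<gamma> 1). \<Phi> z (log_branch p q 1 z) = h z"
      unfolding \<gamma>(3) using ev
    proof eventually_elim
      case (elim z)
      have "log_branch p q 1 z + (of_real (ln (1 - real C * t)) - q 0) = Ln (1 - of_nat C * z) + 2 * of_real pi * \<i>"
        using branch[OF elim] by (simp add: algebra_simps)
      then show ?case unfolding h[OF elim] f[OF elim] \<Phi>_def by (simp only:) (simp add: algebra_simps)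
    qed
  qed
qed

text \<open>The left-hand side is used through its series, which is holomorphic on the slit unit
  disc in x = C z; the formula known on (0, 1) spreads from there.\<close>

lemma log_stieltjes_0_eq_complex:
  assumes z: "z \<in> slit_disc C"
  shows "log_stieltjes (period_conv A B) 0 (of_nat C * z)
     = stieltjes_regular A B (of_nat C * z) + vanishing_period A B (of_nat C * z) * Ln (1 - of_nat C * z)"
proof -
  define f where "f = (\<lambda>x. - frob period_series 0 (x / of_nat C))"
  have f: "f (of_nat C * z) = log_stieltjes (period_conv A B) 0 (of_nat C * z)" if "z \<in> slit_disc C" for z
  proof -
    have "frob period_series 0 z = - log_stieltjes (period_conv A B) 0 (of_nat C * z)"
      using log_stieltjes_eq_frob[OF that, of 0] by simp
    then show ?thesis using C by (simp add: f_def)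
  qed
  have img: "x / of_nat C \<in> slit_disc C" if "x \<in> slit_ball 1" for x
    using that C unfolding slit_disc_eq
    by (auto simp: norm_divide complex_nonpos_Reals_iff divide_less_cancel zero_less_divide_iff divide_le_0_iff)
  have sub: "slit_ball 1 \<subseteq> slit_plane" by auto
  have "f (of_nat C * z) = stieltjes_regular A B (of_nat C * z) + vanishing_period A B (of_nat C * z) * Ln (1 - of_nat C * z)"
  proof (rule holomorphic_eq_of_unit_interval[where S="slit_ball 1" and f=f
      and g="\<lambda>x. stieltjes_regular A B x + vanishing_period A B x * Ln (1 - x)"])
    have "frob period_series 0 holomorphic_on slit_disc C"
      unfolding slit_disc_eq by (rule holomorphic_on_frob[OF conv_radius_period_series])
    moreover have "(\<lambda>x. x / of_nat C) holomorphic_on slit_ball 1" using C by (intro holomorphic_intros) auto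
    ultimately have "(\<lambda>x. frob period_series 0 (x / of_nat C)) holomorphic_on slit_ball 1"
      using holomorphic_on_compose_gen[of "\<lambda>x. x / of_nat C" "slit_ball 1" "frob period_series 0" "slit_disc C"] img
      by (simp add: o_def image_subset_iff)
    then show "f holomorphic_on slit_ball 1" unfolding f_def by (intro holomorphic_intros)
    have ln: "1 - x \<notin> \<real>\<^sub>\<le>\<^sub>0" if "x \<in> slit_ball 1" for x
    proof -
      have "\<bar>Re x\<bar> < 1" using that abs_Re_le_cmod[of x] by simp
      then show ?thesis by (simp add: complex_nonpos_Reals_iff)
    qed
    show "(\<lambda>x. stieltjes_regular A B x + vanishing_period A B x * Ln (1 - x)) holomorphic_on slit_ball 1"
      using ln by (intro holomorphic_intros holomorphic_on_subset[OF holomorphic_on_stieltjes_regular[OF A B] sub]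
        holomorphic_on_subset[OF holomorphic_on_vanishing_period[OF A B] sub]) auto
    show "open (slit_ball 1)" by (rule open_slit_ball)
    show "connected (slit_ball 1)" by (rule slit_ball_connected) simp
    show "complex_of_real ` {0<..<1} \<subseteq> slit_ball 1" by (auto simp: complex_nonpos_Reals_iff)
    show "of_nat C * z \<in> slit_ball 1"
      using z C by (auto simp: slit_disc_eq norm_mult field_simps complex_nonpos_Reals_iff mult_le_0_iff)
    fix x :: real assume x: "0 < x" "x < 1"
    have "complex_of_real x \<in> slit_ball 1" using x by (simp add: complex_nonpos_Reals_iff)
    from f[OF img[OF this]]
    show "f (of_real x) = stieltjes_regular A B (of_real x) + vanishing_period A B (of_real x) * Ln (1 - of_real x)"
      using log_stieltjes_0_eq[OF A B x] C by simp
  qed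
  then show ?thesis using f[OF z] by simp
qed

section \<open>The vanishing cycle in the Frobenius basis\<close>

text \<open>This and \<open>cubic_coeff\<close> are the coefficients of epsilon^2 and epsilon^3 in
  \<open>gamma_fun\<close> divided by its value at 0, under the condition that the linear
  coefficient vanishes.\<close>

definition quadratic_coeff :: complex where "quadratic_coeff = log_deriv_coeff 1 / 2"

definition cubic_coeff :: complex where "cubic_coeff = log_deriv_coeff 2 / 3"

lemma log_stieltjes_frob_series:
  assumes z: "z \<in> slit_disc C" and l: "log_deriv_coeff 0 = 0"
  shows "log_stieltjes (period_conv A B) 0 (of_nat C * z) = - leading * frob frob_series 0 z"
    and "log_stieltjes (period_conv A B) 1 (of_nat C * z) = - leading * frob frob_series 1 z"
    and "log_stieltjes (period_conv A B) 2 (of_nat C * z) = - 2 * leading * (frob frob_series 2 z + quadratic_coeff * frob frob_series 0 z)"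
    and "log_stieltjes (period_conv A B) 3 (of_nat C * z) = - 6 * leading * (frob frob_series 3 z
      + quadratic_coeff * frob frob_series 1 z + cubic_coeff * frob frob_series 0 z)"
proof -
  define S where "S = (\<lambda>k. \<Sum>j\<le>k. fps_nth (fps_row period_series 0) j * frob frob_series (k - j) z)"
  have *: "log_stieltjes (period_conv A B) k (of_nat C * z) = - fact k * S k" for k
  proof -
    have "log_stieltjes (period_conv A B) k (of_nat C * z) = - fact k * (- log_stieltjes (period_conv A B) k (of_nat C * z) / fact k)"
      by simp
    then show ?thesis by (simp only: log_stieltjes_eq_frob[OF z] frob_period_series[OF z] S_def)
  qed
  have r: "fps_nth (fps_row period_series 0) 0 = leading" "fps_nth (fps_row period_series 0) 1 = 0"
    "fps_nth (fps_row period_series 0) 2 = leading * quadratic_coeff"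
    "fps_nth (fps_row period_series 0) 3 = leading * cubic_coeff"
    unfolding period_series_row_0[OF l] by (simp_all add: leading_def quadratic_coeff_def cubic_coeff_def)
  have a: "{..0::nat} = {0}" "{..1::nat} = {0,1}" "{..2::nat} = {0,1,2}" "{..3::nat} = {0,1,2,3}" by auto
  have S: "S 0 = leading * frob frob_series 0 z" "S 1 = leading * frob frob_series 1 z"
    "S 2 = leading * (frob frob_series 2 z + quadratic_coeff * frob frob_series 0 z)"
    "S 3 = leading * (frob frob_series 3 z + quadratic_coeff * frob frob_series 1 z + cubic_coeff * frob frob_series 0 z)"
    unfolding S_def a using r by (simp_all add: algebra_simps)
  show "log_stieltjes (period_conv A B) 0 (of_nat C * z) = - leading * frob frob_series 0 z"
    "log_stieltjes (period_conv A B) 1 (of_nat C * z) = - leading * frob frob_series 1 z"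
    "log_stieltjes (period_conv A B) 2 (of_nat C * z) = - 2 * leading * (frob frob_series 2 z + quadratic_coeff * frob frob_series 0 z)"
    "log_stieltjes (period_conv A B) 3 (of_nat C * z) = - 6 * leading * (frob frob_series 3 z
      + quadratic_coeff * frob frob_series 1 z + cubic_coeff * frob frob_series 0 z)"
    unfolding * S by (simp_all add: fact_numeral)
qed

lemma log_deriv_coeff_0:
  assumes "ln (real C) + Digamma A + Digamma (1 - A) + Digamma B + Digamma (1 - B) - 4 * Digamma 1 = 0"
  shows "log_deriv_coeff 0 = 0"
proof -
  have "log_deriv_coeff 0 = of_real (ln (real C) + Digamma A + Digamma (1 - A) + Digamma B + Digamma (1 - B) - 4 * Digamma 1)"
    using A B Polygamma_of_real[of A 0, where 'a=complex] Polygamma_of_real[of "1 - A" 0, where 'a=complex]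
      Polygamma_of_real[of B 0, where 'a=complex] Polygamma_of_real[of "1 - B" 0, where 'a=complex]
      Polygamma_of_real[of 1 0, where 'a=complex]
    by (simp add: log_deriv_coeff_def)
  then show ?thesis by (simp only: assms of_real_0)
qed

lemma quadratic_coeff_eq:
  "quadratic_coeff = of_real (pi ^ 2 / 2 * (1 / sin (pi * A) ^ 2 + 1 / sin (pi * B) ^ 2) - pi ^ 2 / 3)"
proof -
  have "quadratic_coeff = of_real ((Polygamma 1 A + Polygamma 1 (1 - A) + (Polygamma 1 B + Polygamma 1 (1 - B)) - 4 * Polygamma 1 1) / 2)"
    using A B Polygamma_of_real[of A 1, where 'a=complex] Polygamma_of_real[of "1 - A" 1, where 'a=complex]
      Polygamma_of_real[of B 1, where 'a=complex] Polygamma_of_real[of "1 - B" 1, where 'a=complex]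
      Polygamma_of_real[of 1 1, where 'a=complex]
    by (simp add: log_deriv_coeff_def quadratic_coeff_def)
  also have "(Polygamma 1 A + Polygamma 1 (1 - A) + (Polygamma 1 B + Polygamma 1 (1 - B)) - 4 * Polygamma 1 1) / 2
     = pi ^ 2 / 2 * (1 / sin (pi * A) ^ 2 + 1 / sin (pi * B) ^ 2) - pi ^ 2 / 3"
    unfolding Polygamma_1_reflection[OF A] Polygamma_1_reflection[OF B] Polygamma_1_1 by (simp add: field_simps)
  finally show ?thesis .
qed

lemma cubic_coeff_eq:
  "cubic_coeff = of_real ((Polygamma 2 A + Polygamma 2 (1 - A) + Polygamma 2 B + Polygamma 2 (1 - B) - 4 * Polygamma 2 1) / 6)"
  using A B Polygamma_of_real[of A 2, where 'a=complex] Polygamma_of_real[of "1 - A" 2, where 'a=complex]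
      Polygamma_of_real[of B 2, where 'a=complex] Polygamma_of_real[of "1 - B" 2, where 'a=complex]
      Polygamma_of_real[of 1 2, where 'a=complex]
  by (simp add: log_deriv_coeff_def cubic_coeff_def fact_numeral)

text \<open>With Q the quadratic coefficient, the trigamma reflection gives kappa_A + kappa_B =
  kappa_A kappa_B (2 Q + 2 pi^2 / 3), where kappa_a = (sin (pi a) / pi)^2. The pi^2 terms of
  \<open>vanishing_period_eq\<close> then cancel, and 2 Q y_1 is subtracted from the y_3 + Q y_1
  contained in \<open>\<Phi>\<^sub>3\<close>; hence the reversed sign of Q.\<close>

lemma vanishing_period_frob:
  assumes z: "z \<in> slit_disc C" and l: "log_deriv_coeff 0 = 0"
  shows "vanishing_period A B (of_nat C * z) / leading =
    of_real (sin (pi * A) ^ 2 * sin (pi * B) ^ 2 / pi ^ 4) *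
      (frob frob_series 3 z - quadratic_coeff * frob frob_series 1 z + cubic_coeff * frob frob_series 0 z)"
proof -
  define u where "u = sin (pi * A) ^ 2"
  define v where "v = sin (pi * B) ^ 2"
  define Q where "Q = pi ^ 2 / 2 * (1 / u + 1 / v) - pi ^ 2 / 3"
  have uv: "u \<noteq> 0" "v \<noteq> 0" using sin_pi_pos[OF A] sin_pi_pos[OF B] by (auto simp: u_def v_def)
  have q: "quadratic_coeff = of_real Q" by (simp only: quadratic_coeff_eq Q_def u_def v_def)
  have k: "(sin (pi * A) / pi) ^ 2 = u / pi ^ 2" "(sin (pi * B) / pi) ^ 2 = v / pi ^ 2"
    by (simp_all add: u_def v_def power_divide)
  have sp: "of_nat C * z \<in> slit_plane" using z by (intro mult_C_in_slit_plane) (auto simp: slit_disc_def)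
  have r: "u / pi ^ 2 + v / pi ^ 2 = u * v / pi ^ 4 * (2 * Q + 2 * pi ^ 2 / 3)"
    using uv by (simp add: Q_def field_simps power2_eq_square power4_eq_xxxx)
  have e: "u / pi ^ 2 * (v / pi ^ 2) = u * v / pi ^ 4" by (simp add: power2_eq_square power4_eq_xxxx)
  define K where "K = complex_of_real (u * v / pi ^ 4)"
  define L1 where "L1 = log_stieltjes (period_conv A B) 1 (of_nat C * z)"
  define L3 where "L3 = log_stieltjes (period_conv A B) 3 (of_nat C * z)"
  define X where "X = frob frob_series 3 z + of_real Q * frob frob_series 1 z + cubic_coeff * frob frob_series 0 z"
  have L1: "L1 = - leading * frob frob_series 1 z" unfolding L1_def by (rule log_stieltjes_frob_series[OF z l])
  have L3: "L3 / 6 = - leading * X"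
    unfolding L3_def log_stieltjes_frob_series(4)[OF z l] q X_def by simp
  have "vanishing_period A B (of_nat C * z) =
     of_real (u / pi ^ 2 + v / pi ^ 2) * L1 - of_real (u / pi ^ 2 * (v / pi ^ 2)) * (L3 / 6 + 2 * of_real pi ^ 2 / 3 * L1)"
    using vanishing_period_eq[OF A B sp] unfolding k L1_def L3_def .
  also have "\<dots> = K * of_real (2 * Q + 2 * pi ^ 2 / 3) * L1 - K * (L3 / 6 + of_real (2 * pi ^ 2 / 3) * L1)"
    unfolding r e of_real_mult[of "u * v / pi ^ 4"] K_def[symmetric] by simp
  also have "\<dots> = leading * (K * (X - 2 * of_real Q * frob frob_series 1 z))"
    unfolding L1 L3 by (simp add: algebra_simps)
  also have "X - 2 * of_real Q * frob frob_series 1 z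
      = frob frob_series 3 z - of_real Q * frob frob_series 1 z + cubic_coeff * frob frob_series 0 z"
    by (simp add: X_def)
  finally show ?thesis using leading_nonzero unfolding q K_def u_def v_def by simp
qed

text \<open>The amount by which y_0 decreases under continuation around 1/C.\<close>

definition vanishing_cycle :: "complex \<Rightarrow> complex" where
  "vanishing_cycle z = 2 * of_real pi * \<i> * (vanishing_period A B (of_nat C * z) / leading)"

text \<open>Being multiples of \<open>\<Phi>\<^sub>1\<close>, \<open>\<Phi>\<^sub>2\<close>,
  \<open>\<Phi>\<^sub>3\<close>, the functions y_1, y_2 + \<open>quadratic_coeff\<close> y_0 and y_3
  + \<open>quadratic_coeff\<close> y_1 + \<open>cubic_coeff\<close> y_0 extend to the slit plane and
  are fixed. Only y_0 jumps, by minus the vanishing cycle, and solving for y_2 and y_3 gives the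
  list of multipliers.\<close>

lemma conifold_monodromy_frob:
  assumes t: "0 < t" "t < 1 / real C" and loop: "conifold_loop C t \<gamma>" and l: "log_deriv_coeff 0 = 0"
    and k: "k < 4"
    and f: "\<And>z. z \<in> slit_disc C \<Longrightarrow> f z = c * frob frob_series k z"
    and h: "\<And>z. z \<in> slit_disc C \<Longrightarrow>
      h z = c * (frob frob_series k z + [- 1, 0, quadratic_coeff, cubic_coeff] ! k * vanishing_cycle z)"
  shows "continues_along \<gamma> f h"
proof -
  define w where "w = [- 1, 0, quadratic_coeff, cubic_coeff] ! k / leading"
  define S where "S = (\<lambda>z. stieltjes_regular A B (of_nat C * z))"
  define P where "P = (\<lambda>j z. log_stieltjes (period_conv A B) j (of_nat C * z))"
  define W where "W = (\<lambda>z. vanishing_period A B (of_nat C * z))"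
  define H where "H = [\<lambda>z. 0, \<lambda>z. - P 1 z / leading, \<lambda>z. - P 2 z / (2 * leading),
    \<lambda>z. quadratic_coeff * P 1 z / leading - P 3 z / (6 * leading)] ! k"
  have hol: "(\<lambda>z. g (of_nat C * z)) holomorphic_on slit_plane" if "g holomorphic_on slit_plane" for g
    using holomorphic_on_compose_gen[OF _ that, of "\<lambda>z. of_nat C * z" slit_plane] mult_C_in_slit_plane
    by (auto simp: o_def image_subset_iff intro!: holomorphic_intros)
  have S: "S holomorphic_on slit_plane" unfolding S_def
    by (rule hol[OF holomorphic_on_stieltjes_regular[OF A B]])
  have W: "W holomorphic_on slit_plane" unfolding W_def
    by (rule hol[OF holomorphic_on_vanishing_period[OF A B]])
  have P: "P j holomorphic_on slit_plane" if "j > 0" for j unfolding P_def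
    by (rule hol[OF holomorphic_on_log_stieltjes[OF tempered_period_density that]])
  have k4: "k = 0 \<or> k = 1 \<or> k = 2 \<or> k = 3" using k by auto
  have H: "H holomorphic_on slit_plane"
    using k4 leading_nonzero P[of 1] P[of 2] P[of 3] unfolding H_def
    by (elim disjE) (auto intro!: holomorphic_intros)
  show ?thesis
  proof (rule monodromy_at_conifold[OF t loop, where H="\<lambda>z. c * (H z + w * S z)" and W="\<lambda>z. c * (w * W z)"])
    fix z assume z: "z \<in> slit_disc C"
    have P0: "P 0 z = S z + W z * Ln (1 - of_nat C * z)"
      unfolding P_def S_def W_def by (rule log_stieltjes_0_eq_complex[OF z])
    have P: "P j z = log_stieltjes (period_conv A B) j (of_nat C * z)" for j by (simp add: P_def)
    note F = log_stieltjes_frob_series[OF z l, folded P]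
    have "frob frob_series k z = H z + w * P 0 z"
      using k4 leading_nonzero unfolding H_def w_def
      by (elim disjE) (simp_all add: F[unfolded One_nat_def] field_simps)
    then show "f z = c * (H z + w * S z) + c * (w * W z) * Ln (1 - of_nat C * z)"
      unfolding f[OF z] P0 by (simp add: algebra_simps)
    show "h z = f z + 2 * of_real pi * \<i> * (c * (w * W z))"
      unfolding f[OF z] h[OF z] vanishing_cycle_def w_def W_def by (simp add: algebra_simps)
  qed (use H S W in \<open>auto intro!: holomorphic_intros\<close>)
qed

end

lemma vector_4:
  "(vector [w, x, y, z] :: 'a::zero ^ 4) $ 1 = w" "(vector [w, x, y, z] :: 'a::zero ^ 4) $ 2 = x"
  "(vector [w, x, y, z] :: 'a::zero ^ 4) $ 3 = y" "(vector [w, x, y, z] :: 'a::zero ^ 4) $ 4 = z"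
  by (simp_all add: vector_def)

theorem theorem1:
  fixes A B :: real and C H3 c2H :: nat and c3 :: int
    and y0 y1 y2 y3 :: "complex \<Rightarrow> complex" and t :: real
  assumes "(A, B, C, H3, c2H, c3) \<in> cy_table"
    and "frobenius_basis A B C y0 y1 y2 y3"
    and "0 < t" and "t < 1 / real C"
  shows "has_monodromy_matrix (circlepath 0 t) (frobenius_vector y0 y1 y2 y3) matrix_at_zero \<and>
    (let a = of_int c3 / (2 * of_real pi * \<i>)^3 * of_real (zeta_nat 3);
         b = of_nat c2H / 24;
         d = of_nat H3
     in \<forall>\<gamma>. conifold_loop C t \<gamma> \<longrightarrow>
          has_monodromy_matrix \<gamma> (frobenius_vector y0 y1 y2 y3) (matrix_at_conifold a b d))"
proof -
  note row = assms(1) and t = assms(3,4)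
  interpret period_data A B C
    by unfold_locales (use cy_table_bounds[OF row] in auto)
  note y = frobenius_basis_unique[OF assms(2)]
  define e where "e = 2 * complex_of_real pi * \<i>"
  have e: "e \<noteq> 0" by (simp add: e_def)
  have l: "log_deriv_coeff 0 = 0" by (rule log_deriv_coeff_0[OF cy_table_Digamma[OF row]])
  have v: "frobenius_vector y0 y1 y2 y3 = (\<lambda>z. vector [y3 z / e ^ 3, y2 z / e ^ 2, y1 z / e, y0 z])"
    by (rule ext) (simp only: frobenius_vector_def e_def)
  have s: "{..0::nat} = {0}" "{..1::nat} = {0, 1}" "{..2::nat} = {0, 1, 2}" "{..3::nat} = {0, 1, 2, 3}" by auto
  have "has_monodromy_matrix (circlepath 0 t) (frobenius_vector y0 y1 y2 y3) matrix_at_zero"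
    unfolding has_monodromy_matrix_def v matrix_at_zero_def forall_4 sum_4 vector_4
  proof (intro conjI)
    note M = monodromy_at_zero[OF t, folded e_def]
    show "continues_along (circlepath 0 t) (\<lambda>z. y3 z / e ^ 3)
      (\<lambda>z. 1 * (y3 z / e ^ 3) + 1 * (y2 z / e ^ 2) + 1 / 2 * (y1 z / e) + 1 / 6 * y0 z)"
      by (rule M[where c="1 / e ^ 3" and k=3])
        (use e in \<open>simp_all add: s y field_simps eval_nat_numeral\<close>)
    show "continues_along (circlepath 0 t) (\<lambda>z. y2 z / e ^ 2)
      (\<lambda>z. 0 * (y3 z / e ^ 3) + 1 * (y2 z / e ^ 2) + 1 * (y1 z / e) + 1 / 2 * y0 z)"
      by (rule M[where c="1 / e ^ 2" and k=2])
        (use e in \<open>simp_all add: s y field_simps eval_nat_numeral\<close>)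
    show "continues_along (circlepath 0 t) (\<lambda>z. y1 z / e)
      (\<lambda>z. 0 * (y3 z / e ^ 3) + 0 * (y2 z / e ^ 2) + 1 * (y1 z / e) + 1 * y0 z)"
      by (rule M[where c="1 / e" and k=1])
        (use e in \<open>simp_all add: s y field_simps\<close>)
    show "continues_along (circlepath 0 t) y0
      (\<lambda>z. 0 * (y3 z / e ^ 3) + 0 * (y2 z / e ^ 2) + 0 * (y1 z / e) + 1 * y0 z)"
      by (rule M[where c=1 and k=0]) (simp_all add: y)
  qed
  moreover {
    fix \<gamma> assume loop: "conifold_loop C t \<gamma>"
    define a where "a = of_int c3 / e ^ 3 * complex_of_real (zeta_nat 3)"
    define b where "b = complex_of_nat c2H / 24"
    define d where "d = complex_of_nat H3"
    have d: "d \<noteq> 0" using cy_table_bounds(6)[OF row] by (simp add: d_def)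
    have e2: "e ^ 2 = of_real (- 4 * pi ^ 2)" by (simp add: e_def power_mult_distrib)
    have e4: "e ^ 4 = of_real (16 * pi ^ 4)" by (simp add: e_def power_mult_distrib)
    \<comment> \<open>The 24 in the definition of b is this 6 times the 4 in (2 pi i)^2 = - 4 pi^2,
      which also gives the sign.\<close>
    have "quadratic_coeff = of_real (pi ^ 2 / 6 * (3 * (1 / sin (pi * A) ^ 2 + 1 / sin (pi * B) ^ 2) - 2))"
      unfolding quadratic_coeff_eq by (rule arg_cong[of _ _ of_real]) (simp add: field_simps)
    also have "\<dots> = - (e ^ 2 * b / d)"
      unfolding cy_table_sin(2)[OF row] e2 b_def d_def by simp
    finally have p1: "quadratic_coeff = - (e ^ 2 * b / d)" .
    have p2: "cubic_coeff = e ^ 3 * a / d"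
      unfolding cubic_coeff_eq cy_table_Polygamma_2[OF row] a_def d_def using e by simp
    \<comment> \<open>The factor 16 between H^3 and the product of squared sines is absorbed by (2
      pi i)^4 = 16 pi^4.\<close>
    have "sin (pi * A) ^ 2 * sin (pi * B) ^ 2 / pi ^ 4 = real H3 / (16 * pi ^ 4)"
      using cy_table_sin(1)[OF row] by (simp add: field_simps)
    then have K: "complex_of_real (sin (pi * A) ^ 2 * sin (pi * B) ^ 2 / pi ^ 4) = d / e ^ 4"
      unfolding e4 d_def by simp
    \<comment> \<open>In the scaled basis the cycle has coordinates (d, 0, b, a). The four basis
      elements gain a/d, - b/d, 0 and -1 times it, so the matrix differs from the identity by a
      matrix of rank one.\<close>
    have V: "vanishing_cycle z = d * (y3 z / e ^ 3) + b * (y1 z / e) + a * y0 z" if "z \<in> slit_disc C" for z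
      unfolding vanishing_cycle_def vanishing_period_frob[OF that l] K p1 p2 y[OF that] e_def[symmetric]
      using e d by (simp add: field_simps eval_nat_numeral)
    note M = conifold_monodromy_frob[OF t loop l]
    have "has_monodromy_matrix \<gamma> (frobenius_vector y0 y1 y2 y3) (matrix_at_conifold a b d)"
      unfolding has_monodromy_matrix_def v matrix_at_conifold_def forall_4 sum_4 vector_4
    proof (intro conjI)
      show "continues_along \<gamma> (\<lambda>z. y3 z / e ^ 3)
        (\<lambda>z. (1 + a) * (y3 z / e ^ 3) + 0 * (y2 z / e ^ 2) + a * b / d * (y1 z / e) + a ^ 2 / d * y0 z)"
        by (rule M[where c="1 / e ^ 3" and k=3])
          (use e d in \<open>simp_all add: V p1 p2 y[symmetric] field_simps power2_eq_square\<close>)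
      show "continues_along \<gamma> (\<lambda>z. y2 z / e ^ 2)
        (\<lambda>z. - b * (y3 z / e ^ 3) + 1 * (y2 z / e ^ 2) + - (b ^ 2 / d) * (y1 z / e) + - (a * b / d) * y0 z)"
        by (rule M[where c="1 / e ^ 2" and k=2])
          (use e d in \<open>simp_all add: V p1 p2 y[symmetric] field_simps power2_eq_square\<close>)
      show "continues_along \<gamma> (\<lambda>z. y1 z / e)
        (\<lambda>z. 0 * (y3 z / e ^ 3) + 0 * (y2 z / e ^ 2) + 1 * (y1 z / e) + 0 * y0 z)"
        by (rule M[where c="1 / e" and k=1]) (simp_all add: y)
      show "continues_along \<gamma> y0
        (\<lambda>z. - d * (y3 z / e ^ 3) + 0 * (y2 z / e ^ 2) + - b * (y1 z / e) + (1 - a) * y0 z)"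
        by (rule M[where c=1 and k=0]) (simp_all add: V y[symmetric] algebra_simps)
    qed
    then have "has_monodromy_matrix \<gamma> (frobenius_vector y0 y1 y2 y3)
      (matrix_at_conifold (of_int c3 / e ^ 3 * complex_of_real (zeta_nat 3)) (of_nat c2H / 24) (of_nat H3))"
      by (simp only: a_def b_def d_def) }
  ultimately show ?thesis unfolding Let_def e_def by blast
qed

end
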